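(* Let $n\geq 3$ and let $\mathcal{P}$ be a pencil of integrable $1$-forms at $(\mathbb{C}^n,0)$. Then at least one of the following conditions is satisfied: (a) There exists a closed meromorphic $1$-form $\theta$ such that $d\omega=\theta\wedge\omega$ for every $1$-form $\omega\in\mathcal{P}$. When $\theta$ is holomorphic, all foliations in $\mathcal{P}$ admit holomorphic first integrals. (b) The axis foliation of $\mathcal{P}$ is tangent to the levels of a non-constant meromorphic function. In particular, there exists a germ of hypersurface at $(\mathbb{C}^n,0)$ that is tangent to (i.e. invariant by) the axis foliation of $\mathcal{P}$.
   Context: All objects are germs at $0\in\mathbb{C}^n$. Two germs of holomorphic $1$-forms $\omega_1,\omega_2$ are independent if $\omega_1\wedge\omega_2\neq 0$ (not identically zero). The pencil generated by independent $\omega_1,\omega_2$ is the complex linear space $\mathcal{P}=\mathcal{P}(\omega_1,\omega_2)=\{a\omega_1+b\omega_2: a,b\in\mathbb{C}\}$. A $1$-form $\omega$ is integrable if $\omega\wedge d\omega=0$. $\mathcal{P}$ is a pencil of integrable $1$-forms (integrable pencil) if the generators $\omega_1,\omega_2$ are independent, their singular (zero) sets have no common component of codimension one, and every $\omega\in\mathcal{P}$ is integrable (equivalently, all $a\omega_1+b\omega_2$ are integrable; given integrability of $\omega_1,\omega_2$ this means $\omega_1\wedge d\omega_2+\omega_2\wedge d\omega_1=0$). Each non-zero $\omega\in\mathcal{P}$, after cancelling codimension one components of its singular set, defines a germ of singular holomorphic foliation of codimension one; these are the foliations in $\mathcal{P}$. The axis foliation of $\mathcal{P}$ is the singular holomorphic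 foliation of codimension two defined by $\omega_1\wedge\omega_2$ after cancelling singular components of codimension one; it is tangent to all foliations in $\mathcal{P}$. A first integral of a foliation is a non-constant function constant along its leaves. *)

theory Defs
  imports "HOL-Analysis.Analysis"
begin

text \<open>Germs at \<open>0\<close> are represented by total functions (or sets), regarded only near \<open>0\<close>: every
  notion below depends on eventual behaviour along \<^term>\<open>nhds 0\<close> only.\<close>

section \<open>Holomorphic and meromorphic germs\<close>

definition complex_differentiable_at :: "(complex^'n \<Rightarrow> complex) \<Rightarrow> complex^'n \<Rightarrow> bool" where
  "complex_differentiable_at f x \<longleftrightarrow>
     (\<exists>L. (f has_derivative L) (at x) \<and> (\<forall>c v. L (c *s v) = c * L v))"

definition holo_at :: "(complex^'n \<Rightarrow> complex) \<Rightarrow> complex^'n \<Rightarrow> bool" where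
  "holo_at f x \<longleftrightarrow> (\<forall>\<^sub>F y in nhds x. complex_differentiable_at f y)"

definition zero_germ :: "(complex^'n \<Rightarrow> 'b::zero) \<Rightarrow> bool" where
  "zero_germ F \<longleftrightarrow> (\<forall>\<^sub>F x in nhds 0. F x = 0)"

text \<open>The values of a meromorphic germ on its polar set are irrelevant. Identities between
  meromorphic objects are therefore stated at the points near \<open>0\<close> where the representing
  function is holomorphic; these include the dense set where the denominator does not vanish.\<close>

definition mero_germ :: "(complex^'n \<Rightarrow> complex) \<Rightarrow> bool" where
  "mero_germ f \<longleftrightarrow> (\<exists>p q. holo_at p 0 \<and> holo_at q 0 \<and> \<not> zero_germ q \<and>
     (\<forall>\<^sub>F x in nhds 0. q x \<noteq> 0 \<longrightarrow> f x = p x / q x))"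

definition nonconstant_holo_germ :: "(complex^'n \<Rightarrow> complex) \<Rightarrow> bool" where
  "nonconstant_holo_germ f \<longleftrightarrow> holo_at f 0 \<and> \<not> (\<exists>c. \<forall>\<^sub>F x in nhds 0. f x = c)"

definition nonconstant_mero_germ :: "(complex^'n \<Rightarrow> complex) \<Rightarrow> bool" where
  "nonconstant_mero_germ f \<longleftrightarrow> mero_germ f \<and>
     \<not> (\<exists>c. \<forall>\<^sub>F x in nhds 0. holo_at f x \<longrightarrow> f x = c)"

section \<open>Differential forms\<close>

text \<open>A 1-form \<open>\<Sum>i. \<omega>\<^sub>i dx\<^sub>i\<close> is given by its coefficient vector \<open>\<omega>\<^sub>i\<close>; a 2-form
  \<open>\<Sum>i<j. \<Omega>\<^sub>i\<^sub>j dx\<^sub>i \<and> dx\<^sub>j\<close> by the antisymmetric matrix of its values \<open>\<Omega>\<^sub>i\<^sub>j\<close> on pairs of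
  coordinate vectors; a 3-form likewise by its values on triples.\<close>

definition holo_form1_at :: "(complex^'n \<Rightarrow> complex^'n) \<Rightarrow> complex^'n \<Rightarrow> bool" where
  "holo_form1_at \<omega> x \<longleftrightarrow> (\<forall>i. holo_at (\<lambda>y. \<omega> y $ i) x)"

definition holo_form2_at :: "(complex^'n \<Rightarrow> complex^'n^'n) \<Rightarrow> complex^'n \<Rightarrow> bool" where
  "holo_form2_at \<Omega> x \<longleftrightarrow> (\<forall>i j. holo_at (\<lambda>y. \<Omega> y $ i $ j) x)"

definition mero_form1 :: "(complex^'n \<Rightarrow> complex^'n) \<Rightarrow> bool" where
  "mero_form1 \<theta> \<longleftrightarrow> (\<forall>i. mero_germ (\<lambda>x. \<theta> x $ i))"

definition partial_deriv :: "'n \<Rightarrow> (complex^'n \<Rightarrow> complex) \<Rightarrow> complex^'n \<Rightarrow> complex" where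
  "partial_deriv i f x = frechet_derivative f (at x) (axis i 1)"

definition ext_deriv :: "(complex^'n \<Rightarrow> complex^'n) \<Rightarrow> complex^'n \<Rightarrow> complex^'n^'n" where
  "ext_deriv \<omega> x =
     (\<chi> i j. partial_deriv i (\<lambda>y. \<omega> y $ j) x - partial_deriv j (\<lambda>y. \<omega> y $ i) x)"

definition wedge11 :: "complex^'n \<Rightarrow> complex^'n \<Rightarrow> complex^'n^'n" where
  "wedge11 \<alpha> \<beta> = (\<chi> i j. \<alpha> $ i * \<beta> $ j - \<alpha> $ j * \<beta> $ i)"

definition wedge12 :: "complex^'n \<Rightarrow> complex^'n^'n \<Rightarrow> complex^'n^'n^'n" where
  "wedge12 \<alpha> \<Omega> = (\<chi> i j k. \<alpha> $ i * \<Omega> $ j $ k - \<alpha> $ j * \<Omega> $ i $ k + \<alpha> $ k * \<Omega> $ i $ j)"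

definition integrable_form :: "(complex^'n \<Rightarrow> complex^'n) \<Rightarrow> bool" where
  "integrable_form \<omega> \<longleftrightarrow> zero_germ (\<lambda>x. wedge12 (\<omega> x) (ext_deriv \<omega> x))"

definition closed_mero_form1 :: "(complex^'n \<Rightarrow> complex^'n) \<Rightarrow> bool" where
  "closed_mero_form1 \<theta> \<longleftrightarrow> mero_form1 \<theta> \<and>
     (\<forall>\<^sub>F x in nhds 0. holo_form1_at \<theta> x \<longrightarrow> ext_deriv \<theta> x = 0)"

text \<open>A meromorphic 1-form is holomorphic if it coincides, as a meromorphic 1-form, with a
  holomorphic one.\<close>

definition mero_form1_is_holo :: "(complex^'n \<Rightarrow> complex^'n) \<Rightarrow> bool" where
  "mero_form1_is_holo \<theta> \<longleftrightarrow>
     (\<exists>\<eta>. holo_form1_at \<eta> 0 \<and> (\<forall>\<^sub>F x in nhds 0. holo_form1_at \<theta> x \<longrightarrow> \<theta> x = \<eta> x))"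

section \<open>Germs of analytic sets\<close>

definition germ_subset :: "(complex^'n) set \<Rightarrow> (complex^'n) set \<Rightarrow> bool" where
  "germ_subset X Y \<longleftrightarrow> (\<forall>\<^sub>F x in nhds 0. x \<in> X \<longrightarrow> x \<in> Y)"

definition germ_set_eq :: "(complex^'n) set \<Rightarrow> (complex^'n) set \<Rightarrow> bool" where
  "germ_set_eq X Y \<longleftrightarrow> (\<forall>\<^sub>F x in nhds 0. x \<in> X \<longleftrightarrow> x \<in> Y)"

definition analytic_germ :: "(complex^'n) set \<Rightarrow> bool" where
  "analytic_germ X \<longleftrightarrow>
     (\<exists>S. finite S \<and> (\<forall>f\<in>S. holo_at f 0) \<and> germ_set_eq X {x. \<forall>f\<in>S. f x = 0})"

definition irreducible_germ :: "(complex^'n) set \<Rightarrow> bool" where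
  "irreducible_germ Z \<longleftrightarrow> analytic_germ Z \<and> 0 \<in> Z \<and>
     (\<forall>X Y. analytic_germ X \<and> analytic_germ Y \<and> germ_set_eq Z (X \<union> Y) \<longrightarrow>
        germ_set_eq Z X \<or> germ_set_eq Z Y)"

definition irreducible_component :: "(complex^'n) set \<Rightarrow> (complex^'n) set \<Rightarrow> bool" where
  "irreducible_component Z X \<longleftrightarrow> irreducible_germ Z \<and> germ_subset Z X \<and>
     (\<forall>W. irreducible_germ W \<and> germ_subset Z W \<and> germ_subset W X \<longrightarrow> germ_set_eq Z W)"

definition hypersurface_germ :: "(complex^'n) set \<Rightarrow> bool" where
  "hypersurface_germ H \<longleftrightarrow>
     (\<exists>h. holo_at h 0 \<and> h 0 = 0 \<and> \<not> zero_germ h \<and> germ_set_eq H {x. h x = 0})"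

text \<open>An irreducible germ has codimension one iff it is a hypersurface.\<close>

definition codim1_component :: "(complex^'n) set \<Rightarrow> (complex^'n) set \<Rightarrow> bool" where
  "codim1_component Z X \<longleftrightarrow> irreducible_component Z X \<and> hypersurface_germ Z"

definition sing :: "(complex^'n \<Rightarrow> 'b::zero) \<Rightarrow> (complex^'n) set" where
  "sing F = {x. F x = 0}"

section \<open>Pencils of integrable 1-forms\<close>

definition pencil ::
  "(complex^'n \<Rightarrow> complex^'n) \<Rightarrow> (complex^'n \<Rightarrow> complex^'n) \<Rightarrow> (complex^'n \<Rightarrow> complex^'n) set" where
  "pencil \<omega>1 \<omega>2 = {(\<lambda>x. a *s \<omega>1 x + b *s \<omega>2 x) | a b. True}"

definition integrable_pencil ::
  "(complex^'n \<Rightarrow> complex^'n) \<Rightarrow> (complex^'n \<Rightarrow> complex^'n) \<Rightarrow> bool" where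
  "integrable_pencil \<omega>1 \<omega>2 \<longleftrightarrow>
     holo_form1_at \<omega>1 0 \<and> holo_form1_at \<omega>2 0 \<and>
     \<not> zero_germ (\<lambda>x. wedge11 (\<omega>1 x) (\<omega>2 x)) \<and>
     \<not> (\<exists>Z. codim1_component Z (sing \<omega>1) \<and> codim1_component Z (sing \<omega>2)) \<and>
     (\<forall>\<omega>\<in>pencil \<omega>1 \<omega>2. integrable_form \<omega>)"

text \<open>\<open>d\<omega> = \<theta> \<and> \<omega>\<close> for all \<open>\<omega> \<in> P\<close>, as an identity of meromorphic 2-forms.\<close>

definition twists_pencil ::
  "(complex^'n \<Rightarrow> complex^'n) \<Rightarrow> (complex^'n \<Rightarrow> complex^'n) set \<Rightarrow> bool" where
  "twists_pencil \<theta> P \<longleftrightarrow> (\<forall>\<omega>\<in>P. \<forall>\<^sub>F x in nhds 0.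
     holo_form1_at \<theta> x \<longrightarrow> ext_deriv \<omega> x = wedge11 (\<theta> x) (\<omega> x))"

section \<open>Foliations\<close>

text \<open>A foliation is represented by a form \<open>F\<close> whose singular set has no component of codimension
  one: a 1-form in codimension one, a 2-form in codimension two. At a point with \<open>F x \<noteq> 0\<close> its
  tangent space is the kernel of the form. Such an \<open>F\<close> exists for every nonzero form of the pencil
  (the ring of germs is factorial) and is unique up to a unit, hence statements about the
  foliation may quantify over all representatives.\<close>

definition ker1 :: "complex^'n \<Rightarrow> (complex^'n) set" where
  "ker1 \<alpha> = {v. (\<Sum>i\<in>UNIV. \<alpha> $ i * v $ i) = 0}"

definition ker2 :: "complex^'n^'n \<Rightarrow> (complex^'n) set" where
  "ker2 \<Omega> = {v. \<forall>j. (\<Sum>i\<in>UNIV. v $ i * \<Omega> $ i $ j) = 0}"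

definition foliation_in_pencil ::
  "(complex^'n \<Rightarrow> complex^'n) set \<Rightarrow> (complex^'n \<Rightarrow> complex^'n) \<Rightarrow> bool" where
  "foliation_in_pencil P \<eta> \<longleftrightarrow> holo_form1_at \<eta> 0 \<and> \<not> (\<exists>Z. codim1_component Z (sing \<eta>)) \<and>
     (\<exists>\<omega>\<in>P. \<not> zero_germ \<omega> \<and>
        (\<exists>h. holo_at h 0 \<and> (\<forall>\<^sub>F x in nhds 0. \<omega> x = h x *s \<eta> x)))"

definition axis_foliation ::
  "(complex^'n \<Rightarrow> complex^'n) \<Rightarrow> (complex^'n \<Rightarrow> complex^'n) \<Rightarrow> (complex^'n \<Rightarrow> complex^'n^'n) \<Rightarrow> bool"
  where
  "axis_foliation \<omega>1 \<omega>2 \<Omega> \<longleftrightarrow> holo_form2_at \<Omega> 0 \<and> \<not> (\<exists>Z. codim1_component Z (sing \<Omega>)) \<and>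
     (\<exists>h. holo_at h 0 \<and>
        (\<forall>\<^sub>F x in nhds 0. wedge11 (\<omega>1 x) (\<omega>2 x) = (\<chi> i j. h x * \<Omega> x $ i $ j)))"

text \<open>The leaf through \<open>p\<close> of the foliation given by \<open>F\<close> on the open set \<open>U\<close> consists of the points
  joined to \<open>p\<close> by a \<open>C\<^sup>1\<close> path of regular points of \<open>U\<close> that is everywhere tangent to the
  foliation. The argument \<open>K\<close> is \<^const>\<open>ker1\<close> or \<^const>\<open>ker2\<close>.\<close>

definition leaf ::
  "('b::zero \<Rightarrow> (complex^'n) set) \<Rightarrow> (complex^'n \<Rightarrow> 'b) \<Rightarrow> (complex^'n) set \<Rightarrow> complex^'n
     \<Rightarrow> (complex^'n) set" where
  "leaf K F U p = {q. \<exists>\<gamma> \<gamma>'. \<gamma> 0 = p \<and> \<gamma> 1 = q \<and> continuous_on {0..1::real} \<gamma>' \<and>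
     (\<forall>t\<in>{0..1}. (\<gamma> has_vector_derivative \<gamma>' t) (at t within {0..1}) \<and>
        \<gamma> t \<in> U - sing F \<and> \<gamma>' t \<in> K (F (\<gamma> t)))}"

definition holo_first_integral ::
  "('b::zero \<Rightarrow> (complex^'n) set) \<Rightarrow> (complex^'n \<Rightarrow> 'b) \<Rightarrow> (complex^'n \<Rightarrow> complex) \<Rightarrow> bool" where
  "holo_first_integral K F f \<longleftrightarrow> nonconstant_holo_germ f \<and>
     (\<exists>U. open U \<and> 0 \<in> U \<and> (\<forall>p\<in>U - sing F. \<forall>q\<in>leaf K F U p. f q = f p))"

definition tangent_to_levels ::
  "('b::zero \<Rightarrow> (complex^'n) set) \<Rightarrow> (complex^'n \<Rightarrow> 'b) \<Rightarrow> (complex^'n \<Rightarrow> complex) \<Rightarrow> bool" where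
  "tangent_to_levels K F f \<longleftrightarrow>
     (\<forall>\<^sub>F x in nhds 0. holo_at f x \<and> x \<notin> sing F \<longrightarrow>
        (\<forall>v\<in>K (F x). frechet_derivative f (at x) v = 0))"

definition invariant_germ ::
  "('b::zero \<Rightarrow> (complex^'n) set) \<Rightarrow> (complex^'n \<Rightarrow> 'b) \<Rightarrow> (complex^'n) set \<Rightarrow> bool" where
  "invariant_germ K F H \<longleftrightarrow>
     (\<exists>U. open U \<and> 0 \<in> U \<and> (\<forall>p\<in>(U - sing F) \<inter> H. leaf K F U p \<subseteq> H))"

end

theory Submission
  imports Defs "HOL-Complex_Analysis.Complex_Analysis"
    "HOL-Computational_Algebra.Fundamental_Theorem_Algebra"
begin

text \<open>Write \<open>\<alpha>, \<beta>\<close> for the generators of the pencil.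

  \<^bold>\<open>The dichotomy.\<close> At points where \<open>\<alpha> \<and> \<beta> \<noteq> 0\<close>, the integrability of \<open>\<alpha>\<close>, \<open>\<beta>\<close> and \<open>\<alpha> + \<beta>\<close> is exactly
  what makes the linear system \<open>d\<alpha> = \<theta> \<and> \<alpha>\<close>, \<open>d\<beta> = \<theta> \<and> \<beta>\<close> solvable, and Cramer's rule gives its
  solution \<open>\<theta>\<close>, a meromorphic 1-form (\<open>twist_algebra\<close>). Applying \<open>d\<close> yields
  \<open>d\<theta> \<and> \<alpha> = d\<theta> \<and> \<beta> = 0\<close>, so \<open>d\<theta> = \<kappa> \<alpha> \<and> \<beta>\<close> with \<open>\<kappa>\<close> meromorphic (\<open>decomposable_algebra\<close>).
  If \<open>\<kappa> = 0\<close>, then \<open>\<theta>\<close> is closed, the first alternative. Otherwise put \<open>\<sigma> = d\<kappa> / 2\<kappa>\<close>. Applying \<open>d\<close> again gives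
  \<open>(\<theta> + \<sigma>) \<and> \<alpha> \<and> \<beta> = 0\<close>, so \<open>\<theta> + \<sigma> = P\<alpha> + R\<beta>\<close>, and applying \<open>d\<close> to this
  \<open>(dP - P\<sigma>) \<and> \<alpha> + (dR - R\<sigma>) \<and> \<beta> = \<kappa> \<alpha> \<and> \<beta>\<close>.
  Contracting with a vector killed by \<open>\<alpha>\<close> and \<open>\<beta>\<close> shows that \<open>dP - P\<sigma>\<close> and \<open>dR - R\<sigma>\<close> kill it too;
  in other words \<open>P\<^sup>2/\<kappa>\<close> and \<open>R\<^sup>2/\<kappa>\<close> are constant along the axis (\<open>framed_first_integrals\<close>). They are
  not both constant functions, for then the left-hand side would vanish (\<open>framed_not_both_constant\<close>).
  So one of them is a non-constant meromorphic first integral of the axis, the second alternative.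

  \<^bold>\<open>Holomorphic twisting form.\<close> If \<open>\<theta>\<close> is closed and holomorphic, \<open>\<theta> = dg\<close> by the Poincare lemma,
  and \<open>e\<^sup>-\<^sup>g \<omega>\<close> is closed, hence exact, for each \<open>\<omega>\<close> in the pencil; a primitive is the first integral
  (\<open>integrating_factor\<close>).

  \<^bold>\<open>The invariant hypersurface.\<close> It is enough to find a germ \<open>D \<noteq> 0\<close> with \<open>D(0) = 0\<close> that divides \<open>X(D)\<close> for
  each holomorphic vector field \<open>X\<close> killed by \<open>\<alpha>\<close> and \<open>\<beta>\<close>: along a path in a leaf \<open>D\<close> then satisfies a
  homogeneous linear differential equation, so it vanishes along the path once it vanishes at its
  start (\<open>invariant_equation_germ\<close>). Such a \<open>D\<close> is a generator of an ideal of denominators.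
  In the second alternative take \<open>{a. a f holomorphic}\<close> for the first integral \<open>f\<close>; it is stable under \<open>X\<close> because
  \<open>X(a) f = X(a f)\<close>. In the first take \<open>{a. a \<theta> holomorphic}\<close>; as \<open>\<theta>\<close> is closed, its Lie derivative
  along \<open>X\<close> is \<open>d(\<theta>(X))\<close>, and contracting \<open>d\<omega> = \<theta> \<and> \<omega>\<close> with \<open>X\<close> shows that \<open>\<theta>(X) \<omega>\<close> is holomorphic.
  Hence \<open>\<theta>(X)\<close> is holomorphic once the common factor of the coefficients of the pencil has been
  divided out, and the ideal is again stable under \<open>X\<close> (\<open>reduced_twist_hypersurface\<close>). If there are no
  poles, a level set of a holomorphic first integral takes the place of the polar set.

  \<^bold>\<open>Denominators.\<close> What remains is that an ideal of denominators \<open>{a. \<forall>p\<in>S. q divides a p}\<close> is principal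
  (\<open>denominators_principal\<close>); this also provides greatest common divisors (\<open>gcd_reduction\<close>). By Riemann's
  extension theorem, divisibility is boundedness of a quotient (\<open>germ_dvd_if_bounded\<close>). Restrict all
  functions to the lines \<open>x + T v\<close> in a direction where \<open>q\<close> does not vanish identically, and consider
  polynomials in \<open>T\<close>, with germs in \<open>x\<close> as coefficients, that clear the denominators. The Weierstrass
  polynomial of \<open>q\<close> is one. A non-zero one of least degree divides, up to a power of its leading
  coefficient, the Weierstrass polynomial; so its roots stay in a fixed disc, its coefficients are
  bounded multiples of the leading one, and it can be made monic (\<open>monic_generator\<close>). Weierstrass division
  by this polynomial then shows that its value at \<open>T = 0\<close> generates the ideal (\<open>division_bound\<close>).\<close>

(* Vector components are written with the same infix symbol. *)
no_notation fps_nth (infixl "$" 75)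

section \<open>Complex derivatives and means over circles\<close>

lemma norm_vsmult: "norm (c *s v) = cmod c * norm (v :: complex^'n)"
  unfolding norm_vec_def by (simp add: norm_mult L2_set_right_distrib)

lemma bounded_bilinear_vsmult: "bounded_bilinear (\<lambda>c (v :: complex^'n). c *s v)"
proof
  show "\<exists>K. \<forall>a (b :: complex^'n). norm (a *s b) \<le> norm a * norm b * K"
    by (rule exI[of _ 1]) (simp add: norm_vsmult)
qed (simp_all add: vec_eq_iff algebra_simps)

lemmas continuous_vsmult [continuous_intros] = bounded_bilinear.continuous_on[OF bounded_bilinear_vsmult]

abbreviation cdiff where "cdiff \<equiv> complex_differentiable_at"
abbreviation fd where "fd f x \<equiv> frechet_derivative f (at x)"

lemma cdiff_has_derivative:
  assumes "cdiff f x"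
  shows "(f has_derivative fd f x) (at x)" and "fd f x (c *s v) = c * fd f x v"
proof -
  obtain L where L: "(f has_derivative L) (at x)" "\<forall>c v. L (c *s v) = c * L v"
    using assms unfolding complex_differentiable_at_def by blast
  then have "fd f x = L" using frechet_derivative_at[OF L(1)] by simp
  with L show "(f has_derivative fd f x) (at x)" "fd f x (c *s v) = c * fd f x v" by auto
qed

lemma cdiffI: "(f has_derivative L) (at x) \<Longrightarrow> (\<And>c v. L (c *s v) = c * L v) \<Longrightarrow> cdiff f x"
  unfolding complex_differentiable_at_def by blast

lemma fd_eqI: "(f has_derivative L) (at x) \<Longrightarrow> fd f x = L"
  using frechet_derivative_at by metis

lemma cdiff_isCont: "cdiff f x \<Longrightarrow> isCont f x"
  using cdiff_has_derivative(1) has_derivative_continuous by blast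

lemma cdiff_const: "cdiff (\<lambda>x. c) x" and fd_const: "fd (\<lambda>x. c) x v = 0"
  by (auto intro!: cdiffI[where L="\<lambda>_. 0"])

lemma cdiff_nth: "cdiff (\<lambda>x. x $ i) x" and fd_nth: "fd (\<lambda>x. x $ i) x v = v $ i"
proof -
  have h: "((\<lambda>x. x $ i) has_derivative (\<lambda>v. v $ i)) (at x)"
    by (rule bounded_linear_imp_has_derivative[OF bounded_linear_vec_nth])
  then show "cdiff (\<lambda>x. x $ i) x" "fd (\<lambda>x. x $ i) x v = v $ i"
    by (auto intro!: cdiffI simp: fd_eqI[OF h])
qed

lemma
  assumes "cdiff f x" "cdiff g x"
  shows cdiff_add: "cdiff (\<lambda>x. f x + g x) x" and fd_add: "fd (\<lambda>x. f x + g x) x v = fd f x v + fd g x v"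
    and cdiff_diff: "cdiff (\<lambda>x. f x - g x) x" and fd_diff: "fd (\<lambda>x. f x - g x) x v = fd f x v - fd g x v"
    and cdiff_mult: "cdiff (\<lambda>x. f x * g x) x"
    and fd_mult: "fd (\<lambda>x. f x * g x) x v = fd f x v * g x + f x * fd g x v"
    and cdiff_divide: "g x \<noteq> 0 \<Longrightarrow> cdiff (\<lambda>x. f x / g x) x"
    and fd_divide: "g x \<noteq> 0 \<Longrightarrow> fd (\<lambda>x. f x / g x) x v = (fd f x v * g x - f x * fd g x v) / (g x)\<^sup>2"
proof -
  note d = cdiff_has_derivative(1)[OF assms(1)] cdiff_has_derivative(1)[OF assms(2)]
  note l = cdiff_has_derivative(2)[OF assms(1)] cdiff_has_derivative(2)[OF assms(2)]
  note 1 = has_derivative_add[OF d] and 2 = has_derivative_diff[OF d] and 3 = has_derivative_mult[OF d]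
  show "cdiff (\<lambda>x. f x + g x) x" "fd (\<lambda>x. f x + g x) x v = fd f x v + fd g x v"
    by (auto intro!: cdiffI[OF 1] simp: fd_eqI[OF 1] l algebra_simps)
  show "cdiff (\<lambda>x. f x - g x) x" "fd (\<lambda>x. f x - g x) x v = fd f x v - fd g x v"
    by (auto intro!: cdiffI[OF 2] simp: fd_eqI[OF 2] l algebra_simps)
  show "cdiff (\<lambda>x. f x * g x) x" "fd (\<lambda>x. f x * g x) x v = fd f x v * g x + f x * fd g x v"
    by (auto intro!: cdiffI[OF 3] simp: fd_eqI[OF 3] l algebra_simps)
  assume n: "g x \<noteq> 0"
  note 4 = has_derivative_divide'[OF d n]
  show "cdiff (\<lambda>x. f x / g x) x" "fd (\<lambda>x. f x / g x) x v = (fd f x v * g x - f x * fd g x v) / (g x)\<^sup>2"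
    by (auto intro!: cdiffI[OF 4] simp: fd_eqI[OF 4] l n field_simps power2_eq_square)
qed

lemma
  assumes "cdiff f x" and "(h has_field_derivative h') (at (f x))"
  shows cdiff_comp: "cdiff (\<lambda>x. h (f x)) x" and fd_comp: "fd (\<lambda>x. h (f x)) x v = h' * fd f x v"
proof -
  have 1: "((\<lambda>x. h (f x)) has_derivative (\<lambda>v. h' * fd f x v)) (at x)"
    using has_derivative_compose[OF cdiff_has_derivative(1)[OF assms(1)]] assms(2)
    unfolding has_field_derivative_def by blast
  then show "cdiff (\<lambda>x. h (f x)) x" "fd (\<lambda>x. h (f x)) x v = h' * fd f x v"
    by (auto intro!: cdiffI[OF 1] simp: fd_eqI[OF 1] cdiff_has_derivative(2)[OF assms(1)])
qed

lemma fd_linear: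
  assumes "cdiff f x"
  shows "fd f x (u + v) = fd f x u + fd f x v" "fd f x (c *s v) = c * fd f x v"
    "fd f x (\<Sum>i\<in>I. w i) = (\<Sum>i\<in>I. fd f x (w i))" "fd f x 0 = 0"
  using cdiff_has_derivative[OF assms] has_derivative_bounded_linear bounded_linear.linear
    linear_add linear_sum linear_0 by blast+

lemma has_derivative_germ_cong:
  assumes "\<forall>\<^sub>F y in nhds x. f y = g y"
  shows "(f has_derivative L) (at x) = (g has_derivative L) (at x)"
proof -
  have x: "f x = g x" using eventually_nhds_x_imp_x[OF assms] .
  have 1: "\<forall>\<^sub>F y in at x. f y = g y" using assms unfolding eventually_at_filter by eventually_elim simp
  then have 2: "\<forall>\<^sub>F y in at x. g y = f y" by eventually_elim simp
  show ?thesis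
    using has_derivative_transform_eventually[OF _ 1 x UNIV_I] has_derivative_transform_eventually[OF _ 2 x[symmetric] UNIV_I]
    by blast
qed

lemma fd_cong: "\<forall>\<^sub>F y in nhds x. f y = g y \<Longrightarrow> fd f x = fd g x"
  unfolding frechet_derivative_def by (simp only: has_derivative_germ_cong)

lemma cdiff_cong: "\<forall>\<^sub>F y in nhds x. f y = g y \<Longrightarrow> cdiff f x = cdiff g x"
  unfolding complex_differentiable_at_def by (simp only: has_derivative_germ_cong)

lemma cdiff_line:
  assumes "cdiff f (x + T *s v)"
  shows "((\<lambda>T. f (x + T *s v)) has_field_derivative fd f (x + T *s v) v) (at T)"
proof -
  have "((\<lambda>T. x + T *s v) has_derivative (\<lambda>h. h *s v)) (at T)"
    using has_derivative_add[OF has_derivative_const, OF bounded_linear_imp_has_derivative[OF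
       bounded_bilinear.bounded_linear_left[OF bounded_bilinear_vsmult]]] by fastforce
  from has_derivative_compose[OF this cdiff_has_derivative(1)[OF assms]]
  show ?thesis unfolding has_field_derivative_def
    by (rule has_derivative_eq_rhs) (auto simp: cdiff_has_derivative(2)[OF assms])
qed

text \<open>The circle is parametrised by \<open>[0, 1]\<close>, so that \<open>circle_mean r g\<close> is
  \<open>(1/2\<pi>\<i>) \<integral> g(\<zeta>)/\<zeta> d\<zeta>\<close> over the circle of radius \<open>r\<close>. Estimates and differentiation under the
  integral sign then concern an ordinary integral over a fixed interval.\<close>
definition circle_point :: "real \<Rightarrow> real \<Rightarrow> complex" where
  "circle_point r t = complex_of_real r * exp (2 * complex_of_real pi * \<i> * complex_of_real t)"

definition circle_mean :: "real \<Rightarrow> (complex \<Rightarrow> complex) \<Rightarrow> complex" where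
  "circle_mean r g = integral (cbox 0 1) (\<lambda>t. g (circle_point r t))"

lemma cmod_circle_point [simp]: "0 \<le> r \<Longrightarrow> cmod (circle_point r t) = r"
  unfolding circle_point_def by (simp add: norm_mult norm_exp_eq_Re)

lemma circle_point_neq_0: "0 < r \<Longrightarrow> circle_point r t \<noteq> 0"
  unfolding circle_point_def by simp

lemma continuous_circle_point [continuous_intros]: "continuous_on A f \<Longrightarrow> continuous_on A (\<lambda>t. circle_point r (f t))"
  unfolding circle_point_def by (intro continuous_intros)

lemma contour_integral_eq_circle_mean:
  assumes "0 < r"
  shows "contour_integral (circlepath 0 r) h = 2 * of_real pi * \<i> * circle_mean r (\<lambda>\<zeta>. \<zeta> * h \<zeta>)"
proof -
  have "contour_integral (circlepath 0 r) h
    = integral {0..1} (\<lambda>t. h (circlepath 0 r t) * vector_derivative (circlepath 0 r) (at t))"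
    by (simp add: contour_integral_integral)
  also have "\<dots> = integral {0..1} (\<lambda>t. (2 * of_real pi * \<i>) * (circle_point r t * h (circle_point r t)))"
    unfolding vector_derivative_circlepath by (intro integral_cong) (simp add: circlepath circle_point_def mult_ac)
  finally show ?thesis by (simp add: circle_mean_def)
qed

lemma circle_mean_cauchy:
  assumes "continuous_on (cball 0 r) g" "g holomorphic_on ball 0 r" "cmod w < r"
  shows "circle_mean r (\<lambda>\<zeta>. g \<zeta> * (\<zeta> / (\<zeta> - w))) = g w"
proof -
  have r: "0 < r" using assms(3) norm_ge_zero[of w] by linarith
  have "2 * of_real pi * \<i> * circle_mean r (\<lambda>\<zeta>. \<zeta> * (g \<zeta> / (\<zeta> - w))) = 2 * of_real pi * \<i> * g w"
    using contour_integral_unique[OF Cauchy_integral_circlepath[OF assms(1,2)]] assms(3)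
      contour_integral_eq_circle_mean[OF r] by simp
  then show ?thesis by (simp add: mult_ac)
qed

lemma circle_mean_deriv:
  assumes "continuous_on (cball 0 r) g" "g holomorphic_on ball 0 r" "0 < r"
  shows "circle_mean r (\<lambda>\<zeta>. g \<zeta> / \<zeta>) = deriv g 0"
proof -
  have "2 * of_real pi * \<i> * circle_mean r (\<lambda>\<zeta>. \<zeta> * (g \<zeta> / (\<zeta> - 0)^2)) = 2 * of_real pi * \<i> * deriv g 0"
    using Cauchy_contour_integral_circlepath_2[OF assms(1,2), of 0] assms(3)
    unfolding contour_integral_eq_circle_mean[OF assms(3)] by simp
  then have "circle_mean r (\<lambda>\<zeta>. \<zeta> * (g \<zeta> / (\<zeta> - 0)^2)) = deriv g 0" by simp
  moreover have "\<zeta> * (g \<zeta> / (\<zeta> - 0)^2) = g \<zeta> / \<zeta>" for \<zeta>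
    by (cases "\<zeta> = 0") (auto simp: power2_eq_square)
  ultimately show ?thesis by simp
qed

lemma circle_mean_bound:
  assumes "0 < r" "continuous_on (sphere 0 r) g" "\<And>z. cmod z = r \<Longrightarrow> cmod (g z) \<le> M"
  shows "cmod (circle_mean r g) \<le> M"
proof -
  have "continuous_on (cbox 0 1) (\<lambda>t. g (circle_point r t))"
    by (rule continuous_on_compose2[OF assms(2)]) (use assms(1) in \<open>auto intro!: continuous_intros\<close>)
  then have "norm (integral (cbox 0 1) (\<lambda>t. g (circle_point r t))) \<le> M * Henstock_Kurzweil_Integration.content (cbox 0 (1::real))"
    using assms(1) by (intro integrable_bound integrable_continuous assms(3))
      (auto intro!: order_trans[OF norm_ge_zero assms(3)[of "circle_point r 0"]])
  then show ?thesis by (simp add: circle_mean_def)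
qed

lemma circle_mean_cong: "0 \<le> r \<Longrightarrow> (\<And>z. cmod z = r \<Longrightarrow> f z = g z) \<Longrightarrow> circle_mean r f = circle_mean r g"
  unfolding circle_mean_def by (intro integral_cong) simp

lemma circle_mean_cmult: "circle_mean r (\<lambda>z. c * f z) = c * circle_mean r f"
  unfolding circle_mean_def by (rule integral_mult_right)

lemma circle_point_integrable:
  assumes "0 \<le> r" "continuous_on (sphere 0 r) (f :: complex \<Rightarrow> complex)"
  shows "(\<lambda>t. f (circle_point r t)) integrable_on cbox 0 1"
  by (rule integrable_continuous, rule continuous_on_compose2[OF assms(2)])
     (use assms(1) in \<open>auto intro!: continuous_intros\<close>)

lemma circle_mean_add:
  assumes "0 \<le> r" "continuous_on (sphere 0 r) f" "continuous_on (sphere 0 r) g"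
  shows "circle_mean r (\<lambda>z. f z + g z) = circle_mean r f + circle_mean r g"
  unfolding circle_mean_def by (intro integral_add circle_point_integrable assms)

lemma circle_mean_sum:
  assumes "0 \<le> r" "finite I" "\<And>i. i \<in> I \<Longrightarrow> continuous_on (sphere 0 r) (f i)"
  shows "circle_mean r (\<lambda>z. \<Sum>i\<in>I. f i z) = (\<Sum>i\<in>I. circle_mean r (f i))"
  unfolding circle_mean_def by (intro integral_sum circle_point_integrable assms)

lemma cdiff_shift:
  assumes "cdiff f (x + a)"
  shows "cdiff (\<lambda>y. f (y + a)) x" and "fd (\<lambda>y. f (y + a)) x v = fd f (x + a) v"
proof -
  have "((\<lambda>y. y + a) has_derivative (\<lambda>v. v)) (at x)" by (auto intro!: derivative_eq_intros)
  from has_derivative_compose[OF this cdiff_has_derivative(1)[OF assms]]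
  have 1: "((\<lambda>y. f (y + a)) has_derivative fd f (x + a)) (at x)" .
  then show "cdiff (\<lambda>y. f (y + a)) x" "fd (\<lambda>y. f (y + a)) x v = fd f (x + a) v"
    by (auto intro!: cdiffI[OF 1] simp: fd_eqI[OF 1] cdiff_has_derivative(2)[OF assms])
qed

lemma line_holomorphic:
  assumes "\<And>T. T \<in> S \<Longrightarrow> cdiff f (x + T *s v)"
  shows "(\<lambda>T. f (x + T *s v)) holomorphic_on S"
proof (rule holomorphic_onI)
  fix T assume "T \<in> S"
  then have "(\<lambda>T. f (x + T *s v)) field_differentiable (at T)"
    unfolding field_differentiable_def using cdiff_line[OF assms] by (intro exI)
  then show "(\<lambda>T. f (x + T *s v)) field_differentiable (at T within S)"
    by (rule field_differentiable_at_within)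
qed

text \<open>Cauchy's formula for the derivative of the restriction to a complex line. It expresses a
  derivative by values of the function, and so transfers continuity and differentiability in
  parameters from a function to its derivatives.\<close>
lemma fd_eq_circle_mean:
  assumes "0 < r" "\<And>\<zeta>. cmod \<zeta> \<le> r \<Longrightarrow> cdiff f (x + \<zeta> *s v)"
  shows "fd f x v = circle_mean r (\<lambda>\<zeta>. f (x + \<zeta> *s v) / \<zeta>)"
proof -
  have h: "(\<lambda>T. f (x + T *s v)) holomorphic_on cball 0 r"
    by (rule line_holomorphic) (use assms in auto)
  have "((\<lambda>T. f (x + T *s v)) has_field_derivative fd f x v) (at 0)"
    using cdiff_line[of f x 0 v] assms(2)[of 0] assms(1) by simp
  then have "deriv (\<lambda>T. f (x + T *s v)) 0 = fd f x v" by (rule DERIV_imp_deriv)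
  then show ?thesis
    using circle_mean_deriv[OF holomorphic_on_imp_continuous_on[OF h]
      holomorphic_on_subset[OF h ball_subset_cball] assms(1)] by simp
qed

section \<open>Integrals depending holomorphically on a parameter\<close>

lemma continuous_on_compose_pair:
  assumes "continuous_on S (\<lambda>(x, y). g x y)" "continuous_on A f" "continuous_on A h"
    and "\<And>z. z \<in> A \<Longrightarrow> (f z, h z) \<in> S"
  shows "continuous_on A (\<lambda>z. g (f z) (h z))"
proof -
  have "continuous_on A (\<lambda>z. (f z, h z))" using assms by (intro continuous_on_Pair)
  from continuous_on_compose2[OF assms(1) this] assms(4) show ?thesis by auto
qed

lemma cont_circle_param:
  assumes "continuous_on (U \<times> sphere 0 r) (\<lambda>(x, \<zeta>). G x \<zeta>)" "0 \<le> r"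
  shows "continuous_on (U \<times> cbox 0 1) (\<lambda>(x, t). G x (circle_point r t))"
  unfolding case_prod_beta
  by (rule continuous_on_compose_pair[OF assms(1)])
     (use assms(2) in \<open>auto intro!: continuous_intros\<close>)

text \<open>Leibniz' rule asks for a derivative that is jointly continuous in the point and the parameter.
  Here joint continuity of \<open>G\<close> itself suffices: by Cauchy's formula the derivative is a mean of \<open>G\<close>.\<close>
lemma param_integral:
  fixes G :: "complex^'n \<Rightarrow> real \<Rightarrow> complex"
  assumes R: "0 < R" and cont: "continuous_on (ball c R \<times> cbox 0 1) (\<lambda>(x, t). G x t)"
    and hol: "\<And>x t. x \<in> ball c R \<Longrightarrow> t \<in> cbox 0 1 \<Longrightarrow> cdiff (\<lambda>x. G x t) x"
  shows "cdiff (\<lambda>x. integral (cbox 0 1) (G x)) c"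
    and "fd (\<lambda>x. integral (cbox 0 1) (G x)) c v = integral (cbox 0 1) (\<lambda>t. fd (\<lambda>x. G x t) c v)"
proof -
  \<comment> \<open>On the half ball the circles of radius \<open>R/2\<close> in unit directions stay inside \<open>ball c R\<close>.\<close>
  define U where "U = ball c (R/2)"
  have sub: "x + \<zeta> *s b \<in> ball c R" if "x \<in> U" "cmod \<zeta> \<le> R/2" "norm b \<le> 1" for x \<zeta> and b :: "complex^'n"
  proof -
    have "dist c (x + \<zeta> *s b) \<le> dist c x + norm (\<zeta> *s b)"
      by (metis add.commute dist_norm dist_triangle2 add_diff_cancel_left')
    also have "norm (\<zeta> *s b) \<le> R/2 * 1"
      unfolding norm_vsmult by (rule mult_mono) (use that R in auto)
    finally show ?thesis using that(1) unfolding U_def by auto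
  qed
  define fx where "fx x t = Blinfun (fd (\<lambda>x. G x t) x)" for x t
  have UR: "U \<subseteq> ball c R" using R unfolding U_def by auto
  have fx: "blinfun_apply (fx x t) = fd (\<lambda>x. G x t) x" if "x \<in> U" "t \<in> cbox 0 1" for x t
    unfolding fx_def using that UR
    by (intro bounded_linear_Blinfun_apply has_derivative_bounded_linear[OF cdiff_has_derivative(1)] hol) auto
  have cfx: "continuous_on (U \<times> cbox 0 1) (\<lambda>(x, t). fx x t)"
    unfolding case_prod_beta
  proof (rule continuous_on_blinfun_componentwise)
    fix b :: "complex^'n" assume "b \<in> Basis"
    then have nb: "norm b = 1" by simp
    have "continuous_on (U \<times> cbox 0 1) (\<lambda>p. integral (cbox 0 1)
            (\<lambda>s. G (fst p + circle_point (R/2) s *s b) (snd p) / circle_point (R/2) s))"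
    proof (rule integral_continuous_on_param, unfold case_prod_beta)
      show "continuous_on ((U \<times> cbox 0 1) \<times> cbox 0 1)
         (\<lambda>x. G (fst (fst x) + circle_point (R/2) (snd x) *s b) (snd (fst x)) / circle_point (R/2) (snd x))"
      proof (rule continuous_on_divide)
        show "continuous_on ((U \<times> cbox 0 1) \<times> cbox 0 1)
           (\<lambda>x. G (fst (fst x) + circle_point (R/2) (snd x) *s b) (snd (fst x)))"
        proof (rule continuous_on_compose_pair[OF cont])
          show "(fst (fst z) + circle_point (R/2) (snd z) *s b, snd (fst z)) \<in> ball c R \<times> cbox 0 1"
            if "z \<in> (U \<times> cbox 0 1) \<times> cbox 0 1" for z
            using sub[of "fst (fst z)" "circle_point (R/2) (snd z)" b] that R nb by (auto simp: mem_Times_iff)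
        qed (intro continuous_intros)+
        have "circle_point (R/2) s \<noteq> 0" for s using R by (intro circle_point_neq_0) simp
        then show "\<forall>x\<in>(U \<times> cbox 0 1) \<times> cbox 0 1. circle_point (R/2) (snd x) \<noteq> 0" by blast
      qed (intro continuous_intros)
    qed
    then show "continuous_on (U \<times> cbox 0 1) (\<lambda>p. blinfun_apply (fx (fst p) (snd p)) b)"
    proof (rule continuous_on_eq)
      fix p assume p: "p \<in> U \<times> cbox 0 (1::real)"
      have "fd (\<lambda>x. G x (snd p)) (fst p) b = circle_mean (R/2) (\<lambda>\<zeta>. G (fst p + \<zeta> *s b) (snd p) / \<zeta>)"
        by (rule fd_eq_circle_mean) (use R p nb in \<open>auto intro!: hol sub simp del: mem_ball\<close>)
      then show "integral (cbox 0 1) (\<lambda>s. G (fst p + circle_point (R/2) s *s b) (snd p) / circle_point (R/2) s)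
          = blinfun_apply (fx (fst p) (snd p)) b"
        using p by (simp add: fx mem_Times_iff circle_mean_def)
    qed
  qed
  have cU: "c \<in> U" "open U" "convex U" using R unfolding U_def by auto
  have D: "((\<lambda>x. integral (cbox 0 1) (G x)) has_derivative integral (cbox 0 1) (fx c)) (at c within U)"
  proof (rule leibniz_rule[OF _ _ cfx cU(1) cU(3)])
    show "((\<lambda>x. G x t) has_derivative blinfun_apply (fx x t)) (at x within U)" if "x \<in> U" "t \<in> cbox 0 1" for x t
    proof -
      have "cdiff (\<lambda>x. G x t) x" using that UR hol by blast
      from has_derivative_at_withinI[OF cdiff_has_derivative(1)[OF this]] show ?thesis
        using fx[OF that] by simp
    qed
    show "G x integrable_on cbox 0 1" if "x \<in> U" for x
      by (rule integrable_continuous, rule continuous_on_compose_pair[OF cont])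
         (use that UR in \<open>auto intro!: continuous_intros\<close>)
  qed
  then have D: "((\<lambda>x. integral (cbox 0 1) (G x)) has_derivative integral (cbox 0 1) (fx c)) (at c)"
    unfolding at_within_open[OF cU(1,2)] .
  have int: "fx c integrable_on cbox 0 1"
    by (rule integrable_continuous, rule continuous_on_compose_pair[OF cfx])
       (use cU in \<open>auto intro!: continuous_intros\<close>)
  have ap: "blinfun_apply (integral (cbox 0 1) (fx c)) u = integral (cbox 0 1) (\<lambda>t. fd (\<lambda>x. G x t) c u)" for u
  proof -
    have "integral (cbox 0 1) (\<lambda>t. fd (\<lambda>x. G x t) c u) = integral (cbox 0 1) ((\<lambda>g. blinfun_apply g u) \<circ> fx c)"
      by (intro integral_cong) (use fx cU in auto)
    then show ?thesis
      using integral_linear[OF int blinfun.bounded_linear_left[of u]] by simp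
  qed
  show "fd (\<lambda>x. integral (cbox 0 1) (G x)) c v = integral (cbox 0 1) (\<lambda>t. fd (\<lambda>x. G x t) c v)"
    using fd_eqI[OF D] ap by simp
  show "cdiff (\<lambda>x. integral (cbox 0 1) (G x)) c"
  proof (rule cdiffI[OF D])
    fix a :: complex and u
    have "integral (cbox 0 1) (\<lambda>t. fd (\<lambda>x. G x t) c (a *s u)) = integral (cbox 0 1) (\<lambda>t. a * fd (\<lambda>x. G x t) c u)"
      by (intro integral_cong) (use hol UR cU in \<open>auto intro!: cdiff_has_derivative(2)\<close>)
    then show "blinfun_apply (integral (cbox 0 1) (fx c)) (a *s u) = a * blinfun_apply (integral (cbox 0 1) (fx c)) u"
      unfolding ap by simp
  qed
qed

lemma param_mean:
  assumes "0 < R" "0 \<le> r" "continuous_on (ball c R \<times> sphere 0 r) (\<lambda>(x, \<zeta>). G x \<zeta>)"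
    and hol: "\<And>x \<zeta>. x \<in> ball c R \<Longrightarrow> cmod \<zeta> = r \<Longrightarrow> cdiff (\<lambda>x. G x \<zeta>) x"
  shows "cdiff (\<lambda>x. circle_mean r (G x)) c"
    and "fd (\<lambda>x. circle_mean r (G x)) c v = circle_mean r (\<lambda>\<zeta>. fd (\<lambda>x. G x \<zeta>) c v)"
  unfolding circle_mean_def
  by (rule param_integral[OF assms(1) cont_circle_param[OF assms(3,2)]]; use assms in simp)+

lemma holo_at_ball: "holo_at f x \<longleftrightarrow> (\<exists>e>0. \<forall>y\<in>ball x e. cdiff f y)"
  unfolding holo_at_def eventually_nhds_metric Ball_def mem_ball by (simp only: dist_commute[of x])

lemma holo_at_param_mean:
  assumes "0 < R" "0 \<le> r" "continuous_on (ball c R \<times> sphere 0 r) (\<lambda>(x, \<zeta>). G x \<zeta>)"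
    and hol: "\<And>x \<zeta>. x \<in> ball c R \<Longrightarrow> cmod \<zeta> = r \<Longrightarrow> cdiff (\<lambda>x. G x \<zeta>) x"
  shows "holo_at (\<lambda>x. circle_mean r (G x)) c"
  unfolding holo_at_ball
proof (intro exI[of _ "R/2"] conjI ballI)
  fix y assume y: "y \<in> ball c (R/2)"
  have "ball y (R/2) \<subseteq> ball c R"
  proof
    fix z assume "z \<in> ball y (R/2)"
    then show "z \<in> ball c R" using y dist_triangle[of c z y] by auto
  qed
  then show "cdiff (\<lambda>x. circle_mean r (G x)) y"
    using assms by (intro param_mean[where R = "R/2"]) (auto intro: continuous_on_subset)
qed (use assms in auto)

lemma holo_at_eventually: "holo_at f x \<Longrightarrow> \<forall>\<^sub>F y in nhds x. holo_at f y"
  unfolding holo_at_def by (simp add: eventually_eventually)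

lemma holo_at_imp_cdiff: "holo_at f x \<Longrightarrow> cdiff f x"
  unfolding holo_at_def using eventually_nhds_x_imp_x by blast

lemma holo_at_isCont: "holo_at f x \<Longrightarrow> isCont f x"
  using holo_at_imp_cdiff cdiff_isCont by blast

lemma holo_at_small_disc:
  assumes "holo_at f x"
  shows "\<exists>e r. 0 < e \<and> 0 < r \<and> (\<forall>y\<in>ball x e. \<forall>\<zeta>. cmod \<zeta> \<le> r \<longrightarrow> cdiff f (y + \<zeta> *s v))"
proof -
  obtain e where e: "0 < e" "\<And>y. y \<in> ball x e \<Longrightarrow> cdiff f y"
    using assms unfolding holo_at_ball by blast
  define r where "r = e / (2 * (norm v + 1))"
  have r: "0 < r" using e unfolding r_def by (simp add: add_nonneg_pos)
  have "cdiff f (y + \<zeta> *s v)" if "y \<in> ball x (e/2)" "cmod \<zeta> \<le> r" for y \<zeta>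
  proof -
    have "norm (\<zeta> *s v) \<le> r * (norm v + 1)"
      unfolding norm_vsmult by (rule mult_mono) (use that r in auto)
    also have "\<dots> = e / 2" unfolding r_def using norm_ge_zero[of v] by (simp add: field_simps add_nonneg_eq_0_iff)
    finally have n: "norm (\<zeta> *s v) \<le> e / 2" .
    have "dist x (y + \<zeta> *s v) \<le> dist x y + norm (\<zeta> *s v)"
      by (metis add.commute dist_norm dist_triangle2 add_diff_cancel_left')
    then show ?thesis using that n by (intro e(2)) auto
  qed
  with e r show ?thesis by (intro exI[of _ "e/2"] exI[of _ r]) simp
qed

lemma fd_param:
  assumes "0 < e" "0 < r" and h: "\<And>y \<zeta>. y \<in> ball x e \<Longrightarrow> cmod \<zeta> \<le> r \<Longrightarrow> cdiff f (y + \<zeta> *s v)"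
  shows "continuous_on (ball x e \<times> sphere 0 r) (\<lambda>(y, \<zeta>). f (y + \<zeta> *s v) / \<zeta>)"
    and "\<And>y \<zeta>. y \<in> ball x e \<Longrightarrow> cmod \<zeta> = r \<Longrightarrow> cdiff (\<lambda>y. f (y + \<zeta> *s v) / \<zeta>) y"
proof -
  have "continuous_on {z. cdiff f z} f"
    using cdiff_isCont continuous_at_imp_continuous_on by blast
  then show "continuous_on (ball x e \<times> sphere 0 r) (\<lambda>(y, \<zeta>). f (y + \<zeta> *s v) / \<zeta>)"
    unfolding case_prod_beta
  proof (rule continuous_on_divide[OF continuous_on_compose2])
    show "continuous_on (ball x e \<times> sphere 0 r) (\<lambda>p. fst p + snd p *s v)"
      by (intro continuous_intros)
    show "(\<lambda>p. fst p + snd p *s v) ` (ball x e \<times> sphere 0 r) \<subseteq> {z. cdiff f z}"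
      using h by auto
    show "\<forall>p\<in>ball x e \<times> sphere 0 r. snd p \<noteq> 0" using assms(2) by auto
  qed (intro continuous_intros)
  show "cdiff (\<lambda>y. f (y + \<zeta> *s v) / \<zeta>) y" if "y \<in> ball x e" "cmod \<zeta> = r" for y \<zeta>
    using that assms by (intro cdiff_divide cdiff_const cdiff_shift h) auto
qed

text \<open>The derivative is a circle mean of the function, hence holomorphic in the point.\<close>
lemma holo_at_fd:
  assumes "holo_at f x"
  shows "holo_at (\<lambda>y. fd f y v) x"
proof -
  obtain e r where er: "0 < e" "0 < r" "\<And>y \<zeta>. y \<in> ball x e \<Longrightarrow> cmod \<zeta> \<le> r \<Longrightarrow> cdiff f (y + \<zeta> *s v)"
    using holo_at_small_disc[OF assms, of v] by blast
  have m: "fd f y v = circle_mean r (\<lambda>\<zeta>. f (y + \<zeta> *s v) / \<zeta>)" if "y \<in> ball x e" for y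
    by (rule fd_eq_circle_mean) (use er that in auto)
  have "holo_at (\<lambda>y. circle_mean r (\<lambda>\<zeta>. f (y + \<zeta> *s v) / \<zeta>)) x"
    using holo_at_param_mean[OF er(1) less_imp_le[OF er(2)] fd_param[OF er]] .
  moreover have "\<forall>\<^sub>F y in nhds x. y \<in> ball x e"
    using er(1) by (intro eventually_nhds_in_open) auto
  ultimately have "\<forall>\<^sub>F y in nhds x. cdiff (\<lambda>y. circle_mean r (\<lambda>\<zeta>. f (y + \<zeta> *s v) / \<zeta>)) y \<and> y \<in> ball x e"
    unfolding holo_at_def by eventually_elim blast
  then show ?thesis unfolding holo_at_def
  proof eventually_elim
    case (elim y)
    have "\<forall>\<^sub>F z in nhds y. z \<in> ball x e" by (rule eventually_nhds_in_open) (use elim in auto)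
    then have "\<forall>\<^sub>F z in nhds y. circle_mean r (\<lambda>\<zeta>. f (z + \<zeta> *s v) / \<zeta>) = fd f z v"
      by eventually_elim (use m in auto)
    from cdiff_cong[OF this] elim show ?case by simp
  qed
qed

text \<open>Writing the inner derivative as a circle mean, the outer one passes under the integral, where it
  meets the function only once; reading the mean formula backwards exchanges the two.\<close>
lemma fd_commute:
  assumes "holo_at f x"
  shows "fd (\<lambda>y. fd f y v) x u = fd (\<lambda>y. fd f y u) x v"
proof -
  obtain e r where er: "0 < e" "0 < r" "\<And>y \<zeta>. y \<in> ball x e \<Longrightarrow> cmod \<zeta> \<le> r \<Longrightarrow> cdiff f (y + \<zeta> *s v)"
    using holo_at_small_disc[OF assms, of v] by blast
  obtain e' r' where er': "0 < e'" "0 < r'"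
      "\<And>y \<zeta>. y \<in> ball x e' \<Longrightarrow> cmod \<zeta> \<le> r' \<Longrightarrow> cdiff (\<lambda>y. fd f y u) (y + \<zeta> *s v)"
    using holo_at_small_disc[OF holo_at_fd[OF assms], of u v] by blast
  define \<rho> where "\<rho> = min r r'"
  have \<rho>: "0 < \<rho>" "\<rho> \<le> r" "\<rho> \<le> r'" using er er' unfolding \<rho>_def by auto
  have er2: "cdiff f (y + \<zeta> *s v)" if "y \<in> ball x e" "cmod \<zeta> \<le> \<rho>" for y \<zeta>
    using er(3) that \<rho> by simp
  have "fd f y v = circle_mean \<rho> (\<lambda>\<zeta>. f (y + \<zeta> *s v) / \<zeta>)" if "y \<in> ball x e" for y
    by (rule fd_eq_circle_mean) (use er2 \<rho> that in auto)
  then have "\<forall>\<^sub>F y in nhds x. fd f y v = circle_mean \<rho> (\<lambda>\<zeta>. f (y + \<zeta> *s v) / \<zeta>)"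
    using er(1) by (auto simp: eventually_nhds_metric dist_commute)
  then have "fd (\<lambda>y. fd f y v) x u = fd (\<lambda>y. circle_mean \<rho> (\<lambda>\<zeta>. f (y + \<zeta> *s v) / \<zeta>)) x u"
    by (simp only: fd_cong)
  also have "\<dots> = circle_mean \<rho> (\<lambda>\<zeta>. fd (\<lambda>y. f (y + \<zeta> *s v) / \<zeta>) x u)"
    using param_mean(2)[OF er(1) less_imp_le[OF \<rho>(1)] fd_param[OF er(1) \<rho>(1) er2]] .
  also have "\<dots> = circle_mean \<rho> (\<lambda>\<zeta>. fd f (x + \<zeta> *s v) u / \<zeta>)"
    unfolding circle_mean_def
  proof (intro integral_cong)
    fix t :: real
    let ?z = "circle_point \<rho> t"
    have z: "?z \<noteq> 0" "cmod ?z \<le> \<rho>" using \<rho>(1) circle_point_neq_0[OF \<rho>(1), of t] by auto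
    have c: "cdiff f (x + ?z *s v)" using er2[OF _ z(2), of x] er(1) by simp
    show "fd (\<lambda>y. f (y + ?z *s v) / ?z) x u = fd f (x + ?z *s v) u / ?z"
      using fd_divide[OF cdiff_shift(1)[OF c] cdiff_const, of ?z u] z
      by (simp add: fd_const cdiff_shift(2)[OF c] power2_eq_square)
  qed
  also have "\<dots> = fd (\<lambda>y. fd f y u) x v"
    by (rule fd_eq_circle_mean[symmetric]) (use \<rho> er' in auto)
  finally show ?thesis .
qed

section \<open>Germs of holomorphic functions\<close>

lemma holo_at_cong: "\<forall>\<^sub>F y in nhds x. f y = g y \<Longrightarrow> holo_at f x = holo_at g x"
proof -
  have *: "holo_at f x" if "\<forall>\<^sub>F y in nhds x. f y = g y" "holo_at g x" for f g :: "complex^'a \<Rightarrow> complex"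
  proof -
    have "\<forall>\<^sub>F y in nhds x. \<forall>\<^sub>F z in nhds y. f z = g z" using that(1) by (simp add: eventually_eventually)
    with that(2) show ?thesis unfolding holo_at_def
      by eventually_elim (simp add: cdiff_cong)
  qed
  assume "\<forall>\<^sub>F y in nhds x. f y = g y"
  moreover from this have "\<forall>\<^sub>F y in nhds x. g y = f y" by eventually_elim simp
  ultimately show ?thesis using * by blast
qed

lemma holo_at_const: "holo_at (\<lambda>x. c) x" by (simp add: holo_at_def cdiff_const)

lemma holo_at_nth: "holo_at (\<lambda>x. x $ i) x" by (simp add: holo_at_def cdiff_nth)

lemma
  assumes "holo_at f x" "holo_at g x"
  shows holo_at_add: "holo_at (\<lambda>x. f x + g x) x" and holo_at_diff: "holo_at (\<lambda>x. f x - g x) x"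
    and holo_at_mult: "holo_at (\<lambda>x. f x * g x) x"
    and holo_at_divide: "g x \<noteq> 0 \<Longrightarrow> holo_at (\<lambda>x. f x / g x) x"
proof -
  note h = assms[unfolded holo_at_def]
  show "holo_at (\<lambda>x. f x + g x) x" "holo_at (\<lambda>x. f x - g x) x" "holo_at (\<lambda>x. f x * g x) x"
    using h unfolding holo_at_def by (eventually_elim; simp add: cdiff_add cdiff_diff cdiff_mult)+
  assume "g x \<noteq> 0"
  then have "\<forall>\<^sub>F y in nhds x. g y \<noteq> 0"
    using holo_at_isCont[OF assms(2)] continuous_imp_tendsto tendsto_imp_eventually_ne
    unfolding isCont_def tendsto_at_iff_tendsto_nhds by blast
  with h show "holo_at (\<lambda>x. f x / g x) x"
    unfolding holo_at_def by eventually_elim (simp add: cdiff_divide)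
qed

lemma holo_at_uminus: "holo_at f x \<Longrightarrow> holo_at (\<lambda>x. - f x) x"
  using holo_at_diff[OF holo_at_const[of 0]] by simp

lemma holo_at_power: "holo_at f x \<Longrightarrow> holo_at (\<lambda>x. f x ^ k) x"
  by (induction k) (simp_all add: holo_at_const holo_at_mult)

lemma holo_at_sum: "(\<And>i. i \<in> I \<Longrightarrow> holo_at (f i) x) \<Longrightarrow> holo_at (\<lambda>x. \<Sum>i\<in>I. f i x) x"
  by (induction I rule: infinite_finite_induct) (simp_all add: holo_at_const holo_at_add)

lemmas holo_intros = holo_at_const holo_at_nth holo_at_add holo_at_diff holo_at_mult holo_at_uminus
  holo_at_power holo_at_sum

section \<open>The identity theorem and density\<close>

text \<open>Join a point near which \<open>f\<close> vanishes to \<open>y\<close> by a complex line. Its intersection with the ball is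
  convex, hence connected, and the identity theorem in one variable applies.\<close>
lemma identity_ball:
  assumes "\<And>x. x \<in> ball 0 e \<Longrightarrow> cdiff f x" "x0 \<in> ball 0 e" "\<forall>\<^sub>F x in nhds x0. f x = 0" "y \<in> ball 0 e"
  shows "f y = 0"
proof -
  define l where "l T = x0 + T *s (y - x0)" for T
  have contl: "continuous_on UNIV l" unfolding l_def by (intro continuous_intros)
  define S where "S = l -` ball 0 e"
  have "open S" unfolding S_def by (rule open_vimage[OF _ contl]) simp
  have linl: "l ((1 - u) *\<^sub>R a + u *\<^sub>R b) = (1 - u) *\<^sub>R l a + u *\<^sub>R l b" for u a b
    unfolding l_def by (simp add: vec_eq_iff scaleR_conv_of_real[where 'a = complex] algebra_simps)
  have "convex S"
    unfolding convex_alt S_def using convex_ball[of 0 e, unfolded convex_alt] linl by auto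
  have h: "(\<lambda>T. f (l T)) holomorphic_on S"
    unfolding l_def by (rule line_holomorphic) (use assms(1) in \<open>auto simp: S_def l_def\<close>)
  have "isCont l 0" using contl by (simp add: continuous_on_eq_continuous_at)
  then have "(l \<longlongrightarrow> x0) (nhds 0)" unfolding isCont_def tendsto_at_iff_tendsto_nhds by (simp add: l_def)
  then have ev: "\<forall>\<^sub>F T in nhds 0. f (l T) = 0" using assms(3) filterlim_iff by blast
  obtain d where d: "d > 0" "\<And>T. T \<in> ball 0 d \<Longrightarrow> f (l T) = 0"
    using ev unfolding eventually_nhds_metric by (auto simp: dist_commute)
  have 0: "0 \<in> S" and 1: "1 \<in> S" using assms(2,4) by (auto simp: S_def l_def)
  have "f (l 1) = 0"
  proof (rule analytic_continuation[OF h \<open>open S\<close> convex_connected[OF \<open>convex S\<close>], of "S \<inter> ball 0 d" 0])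
    show "0 islimpt S \<inter> ball 0 d"
      using open_imp_islimpt interior_limit_point[of 0 "S \<inter> ball 0 d"] 0 d(1) \<open>open S\<close>
      by (simp add: interior_open open_Int)
  qed (use 0 1 d in auto)
  then show ?thesis by (simp add: l_def)
qed

text \<open>Identities between meromorphic objects are proved where a denominator \<open>q\<close> is non-zero. That set
  accumulates at every point near \<open>0\<close>, so they extend by continuity.\<close>
lemma nonzero_dense:
  assumes "holo_at q 0" "\<not> zero_germ q"
  shows "\<forall>\<^sub>F x in nhds 0. \<exists>\<^sub>F y in nhds x. q y \<noteq> 0"
proof -
  obtain e where e: "e > 0" "\<And>x. x \<in> ball 0 e \<Longrightarrow> cdiff q x"
    using assms(1) unfolding holo_at_ball by blast
  have "\<exists>\<^sub>F y in nhds x. q y \<noteq> 0" if x: "x \<in> ball 0 e" for x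
  proof (rule ccontr)
    assume "\<not> ?thesis"
    then have "\<forall>\<^sub>F y in nhds x. q y = 0" by (simp add: not_frequently)
    then have "q y = 0" if "y \<in> ball 0 e" for y using identity_ball[OF e(2) x _ that] by blast
    then have "zero_germ q" unfolding zero_germ_def eventually_nhds_metric
      using e(1) by (auto simp: dist_commute intro!: exI[of _ e])
    with assms(2) show False by blast
  qed
  then show ?thesis
    using e(1) by (auto simp: eventually_nhds_metric dist_commute intro!: exI[of _ e])
qed

lemma nonzero_dense_on:
  assumes "holo_at q 0" "\<not> zero_germ q" "\<forall>\<^sub>F x in nhds 0. q x \<noteq> 0 \<longrightarrow> P x"
  shows "\<forall>\<^sub>F x in nhds 0. \<exists>\<^sub>F y in nhds x. q y \<noteq> 0 \<and> P y"
proof -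
  have "\<forall>\<^sub>F x in nhds 0. \<forall>\<^sub>F y in nhds x. q y \<noteq> 0 \<longrightarrow> P y" using assms(3) by (simp add: eventually_eventually)
  with nonzero_dense[OF assms(1,2)] show ?thesis
    by eventually_elim (auto elim: frequently_rev_mp eventually_mono)
qed

lemma dense_eq:
  fixes F G :: "'a::t2_space \<Rightarrow> 'b::t2_space"
  assumes "isCont F x" "isCont G x" "\<exists>\<^sub>F y in nhds x. F y = G y"
  shows "F x = G x"
proof (rule ccontr)
  assume "F x \<noteq> G x"
  then obtain U V where UV: "open U" "open V" "F x \<in> U" "G x \<in> V" "U \<inter> V = {}"
    using hausdorff[OF \<open>F x \<noteq> G x\<close>] by blast
  note c = assms(1,2)[unfolded isCont_def tendsto_at_iff_tendsto_nhds]
  have "\<forall>\<^sub>F y in nhds x. F y \<in> U" "\<forall>\<^sub>F y in nhds x. G y \<in> V"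
    using topological_tendstoD[OF c(1) UV(1,3)] topological_tendstoD[OF c(2) UV(2,4)] .
  then have "\<forall>\<^sub>F y in nhds x. F y \<noteq> G y" by eventually_elim (use UV in auto)
  with assms(3) show False by (simp add: frequently_def)
qed

lemma dense_le:
  fixes F G :: "'a::t2_space \<Rightarrow> real"
  assumes "isCont F x" "isCont G x" "\<exists>\<^sub>F y in nhds x. F y \<le> G y"
  shows "F x \<le> G x"
proof (rule ccontr)
  assume "\<not> F x \<le> G x"
  then have "F x - G x > 0" by simp
  moreover have "((\<lambda>y. F y - G y) \<longlongrightarrow> F x - G x) (nhds x)"
    using assms(1,2) unfolding isCont_def tendsto_at_iff_tendsto_nhds by (intro tendsto_diff)
  ultimately have "\<forall>\<^sub>F y in nhds x. F y - G y > 0" by (rule order_tendstoD(1)[rotated])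
  then have "\<forall>\<^sub>F y in nhds x. \<not> F y \<le> G y" by eventually_elim auto
  with assms(3) show False by (simp add: frequently_def)
qed

lemma zero_germ_mult:
  assumes "holo_at f 0" "holo_at g 0" "\<not> zero_germ f" "\<not> zero_germ g"
  shows "\<not> zero_germ (\<lambda>x. f x * g x)"
proof
  assume "zero_germ (\<lambda>x. f x * g x)"
  then have "\<forall>\<^sub>F x in nhds 0. f x \<noteq> 0 \<longrightarrow> g x = 0"
    unfolding zero_germ_def by eventually_elim auto
  from nonzero_dense_on[OF assms(1,3) this] holo_at_eventually[OF assms(2)]
  have "\<forall>\<^sub>F x in nhds 0. g x = 0"
  proof eventually_elim
    case (elim x)
    have "\<exists>\<^sub>F y in nhds x. g y = 0" using elim(1) by (rule frequently_elim1) blast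
    then show ?case using dense_eq[OF holo_at_isCont[OF elim(2)], of "\<lambda>_. 0"] by simp
  qed
  with assms(4) show False by (simp add: zero_germ_def)
qed

lemma holo_eq_dense:
  assumes "holo_at q 0" "\<not> zero_germ q" "holo_at f 0" "holo_at g 0"
    and "\<forall>\<^sub>F x in nhds 0. q x \<noteq> 0 \<longrightarrow> f x = g x"
  shows "\<forall>\<^sub>F x in nhds 0. f x = g x"
  using nonzero_dense_on[OF assms(1,2,5)] holo_at_eventually[OF assms(3)] holo_at_eventually[OF assms(4)]
proof eventually_elim
  case (elim x)
  show ?case
    by (rule dense_eq[OF holo_at_isCont[OF elim(2)] holo_at_isCont[OF elim(3)]])
       (rule frequently_elim1[OF elim(1)], blast)
qed

section \<open>Divisibility as boundedness of the quotient\<close>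

lemma frequently_at_imp_nhds:
  assumes "\<exists>\<^sub>F y in at x. P y"
  shows "\<exists>\<^sub>F y in nhds x. P y"
  unfolding frequently_def
proof
  assume "\<forall>\<^sub>F y in nhds x. \<not> P y"
  then have "\<forall>\<^sub>F y in at x. \<not> P y" unfolding eventually_at_filter by eventually_elim simp
  with assms show False unfolding frequently_def by blast
qed

lemma finite_zeros_disc:
  fixes g :: "complex \<Rightarrow> complex"
  assumes "0 < r" "r < R" "g holomorphic_on ball 0 R" "\<And>z. cmod z = r \<Longrightarrow> g z \<noteq> 0"
  shows "finite {z\<in>cball 0 r. g z = 0}"
proof (cases "g constant_on ball 0 R")
  case True
  then obtain c where c: "\<And>z. z \<in> ball 0 R \<Longrightarrow> g z = c" by (auto simp: constant_on_def)
  have "g (of_real r) \<noteq> 0" using assms(1) by (intro assms(4)) simp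
  then have "c \<noteq> 0" using c[of "of_real r"] assms(1,2) by auto
  then have "{z\<in>cball 0 r. g z = 0} = {}" using c assms(2) by auto
  then show ?thesis by (simp only: finite.emptyI)
next
  case False
  then show ?thesis
    using assms(2) by (intro holomorphic_compact_finite_zeros[OF assms(3)]) auto
qed

text \<open>Riemann's removable singularity theorem at the finitely many zeros of \<open>g\<close>.\<close>
lemma quotient_1d:
  fixes f g :: "complex \<Rightarrow> complex"
  assumes "0 < r" "r < R" "f holomorphic_on ball 0 R" "g holomorphic_on ball 0 R"
    and nz: "\<And>z. cmod z = r \<Longrightarrow> g z \<noteq> 0"
    and bd: "\<And>z. cmod z < r \<Longrightarrow> g z = 0 \<Longrightarrow> (\<lambda>w. f w / g w) \<in> O[at z](\<lambda>_. 1)"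
  shows "\<exists>h. h holomorphic_on cball 0 r \<and> (\<forall>z\<in>cball 0 r. f z = h z * g z)"
proof -
  define Z where "Z = {z\<in>cball 0 r. g z = 0}"
  have sub: "cball 0 r \<subseteq> ball (0::complex) R" using assms by auto
  have fZ: "finite Z" unfolding Z_def by (rule finite_zeros_disc[OF assms(1,2,4) nz])
  have Zb: "Z \<subseteq> ball 0 r" unfolding Z_def using nz by (auto simp: less_le)
  have hq: "(\<lambda>w. f w / g w) holomorphic_on (cball 0 r - Z)"
    using sub by (intro holomorphic_on_divide holomorphic_on_subset[OF assms(3)] holomorphic_on_subset[OF assms(4)])
      (auto simp: Z_def)
  have "\<exists>h. h holomorphic_on cball 0 r \<and> (\<forall>z\<in>cball 0 r - Z. h z = f z / g z)"
  proof (rule removable_singularities[OF fZ _ hq])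
    show "(\<lambda>w. f w / g w) \<in> O[at z](\<lambda>_. 1)" if "z \<in> Z" for z
      using that Zb by (intro bd) (auto simp: Z_def)
  qed (use Zb in auto)
  then obtain h where h: "h holomorphic_on cball 0 r" "\<And>z. z \<in> cball 0 r - Z \<Longrightarrow> h z = f z / g z"
    by blast
  have "f z = h z * g z" if z: "z \<in> cball 0 r" for z
  proof (cases "z \<in> Z")
    case False
    then show ?thesis using h(2)[of z] z by (auto simp: Z_def)
  next
    case True
    then have zb: "z \<in> ball 0 r" using Zb by blast
    have "ball 0 r \<subseteq> ball (0::complex) R" using assms(2) by (intro subset_ball) simp
    then have hb: "h holomorphic_on ball 0 r" "f holomorphic_on ball 0 r" "g holomorphic_on ball 0 r"
      using holomorphic_on_subset[OF h(1) ball_subset_cball]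
        holomorphic_on_subset[OF assms(3), of "ball 0 r"] holomorphic_on_subset[OF assms(4), of "ball 0 r"]
      by auto
    note cont = holomorphic_on_imp_continuous_on[THEN continuous_on_interior, of _ "ball 0 r" z]
    have c: "isCont f z" "isCont (\<lambda>z. h z * g z) z"
      using zb by (intro cont hb holomorphic_on_mult; simp)+
    have "\<forall>\<^sub>F w in nhds z. w \<in> ball 0 r - (Z - {z})"
      using fZ zb by (intro eventually_nhds_in_open open_Diff finite_imp_closed) auto
    then have "\<forall>\<^sub>F w in at z. w \<in> ball 0 r - Z"
      unfolding eventually_at_filter by eventually_elim auto
    then have "\<forall>\<^sub>F w in at z. f w = h w * g w"
      by eventually_elim (use h(2) in \<open>auto simp: Z_def\<close>)
    then have "\<exists>\<^sub>F w in at z. f w = h w * g w" by (rule eventually_frequently[OF at_neq_bot])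
    then have "\<exists>\<^sub>F w in nhds z. f w = h w * g w"
      by (rule frequently_at_imp_nhds)
    then show ?thesis using dense_eq[OF c] by blast
  qed
  with h(1) show ?thesis by blast
qed

text \<open>The maximum principle for the extended quotient: a bound on the circle holds inside. The local
  boundedness at the zeros may come with other constants, and the outcome is a uniform one.\<close>
lemma quotient_1d_bound:
  fixes f g :: "complex \<Rightarrow> complex"
  assumes "0 < r" "r < R" "f holomorphic_on ball 0 R" "g holomorphic_on ball 0 R"
    and nz: "\<And>z. cmod z = r \<Longrightarrow> g z \<noteq> 0"
    and bd: "\<And>z. cmod z < r \<Longrightarrow> g z = 0 \<Longrightarrow> (\<lambda>w. f w / g w) \<in> O[at z](\<lambda>_. 1)"
    and M: "\<And>z. cmod z = r \<Longrightarrow> cmod (f z) \<le> M * cmod (g z)" and z: "cmod z \<le> r"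
  shows "cmod (f z) \<le> M * cmod (g z)"
proof -
  obtain h where h: "h holomorphic_on cball 0 r" "\<And>z. z \<in> cball 0 r \<Longrightarrow> f z = h z * g z"
    using quotient_1d[OF assms(1-6)] by blast
  have "cmod (h z) \<le> M"
  proof (rule maximum_modulus_frontier[of h "cball 0 r"])
    show "h holomorphic_on interior (cball 0 r)"
      using h(1) holomorphic_on_subset interior_subset by blast
    show "continuous_on (closure (cball 0 r)) h"
      using h(1) holomorphic_on_imp_continuous_on by simp
    fix w assume "w \<in> frontier (cball (0::complex) r)"
    then have w: "cmod w = r" using assms(1) by (simp add: frontier_cball)
    then have "cmod (h w) * cmod (g w) \<le> M * cmod (g w)" using M[OF w] h(2)[of w] by (simp add: norm_mult)
    then show "cmod (h w) \<le> M" using nz[OF w] by simp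
  qed (use z in auto)
  then show ?thesis using h(2)[of z] z by (simp add: norm_mult mult_right_mono)
qed

definition germ_dvd :: "(complex^'n \<Rightarrow> complex) \<Rightarrow> (complex^'n \<Rightarrow> complex) \<Rightarrow> bool" where
  "germ_dvd b a \<longleftrightarrow> (\<exists>c. holo_at c 0 \<and> (\<forall>\<^sub>F x in nhds 0. a x = c x * b x))"

lemma eventually_tube:
  fixes K :: "complex set"
  assumes "compact K" "\<And>T. T \<in> K \<Longrightarrow> \<forall>\<^sub>F z in nhds (x0, T). P z"
  shows "\<forall>\<^sub>F x in nhds (x0 :: 'a::metric_space). \<forall>T\<in>K. P (x, T)"
proof -
  define W where "W = interior {z. P z}"
  have "{x0} \<times> K \<subseteq> W"
  proof
    fix z assume "z \<in> {x0} \<times> K"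
    then have "\<forall>\<^sub>F w in nhds z. P w" using assms(2) by auto
    then show "z \<in> W" unfolding W_def by (auto simp: eventually_nhds interior_def)
  qed
  from Elementary_Topology.tube_lemma[OF assms(1) _ this] obtain X where
    "x0 \<in> X" "open X" "X \<times> K \<subseteq> W" unfolding W_def by auto
  then show ?thesis using interior_subset[of "{z. P z}"]
    by (auto simp: eventually_nhds W_def intro!: exI[of _ X])
qed

lemma isCont_nhds: "isCont f x \<Longrightarrow> (f \<longlongrightarrow> f x) (nhds x)"
  unfolding isCont_def tendsto_at_iff_tendsto_nhds .

lemma isCont_line: "isCont (\<lambda>p. fst p + snd p *s (v :: complex^'n)) z"
proof -
  have "continuous_on UNIV (\<lambda>p. fst p + snd p *s v)" by (intro continuous_intros)
  then show ?thesis by (simp only: continuous_on_eq_continuous_at[OF open_UNIV] ball_UNIV)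
qed

lemma isCont_along_line:
  assumes "isCont f (x + T *s (v :: complex^'n))"
  shows "isCont (\<lambda>p. f (fst p + snd p *s v)) (x, T)"
proof (rule isCont_o2[where g = f])
qed (use assms in \<open>simp_all add: isCont_line\<close>)

lemma line_eventually:
  assumes "\<forall>\<^sub>F y in nhds 0. P y"
  shows "\<exists>r>0. \<forall>\<^sub>F x in nhds 0. \<forall>T. cmod T \<le> r \<longrightarrow> P (x + T *s (v :: complex^'n))"
proof -
  have "((\<lambda>p. fst p + snd p *s v) \<longlongrightarrow> 0) (nhds 0 \<times>\<^sub>F nhds 0)"
    using isCont_nhds[OF isCont_line[where v = v and z = "(0, 0)"]]
    unfolding nhds_prod fst_conv snd_conv by simp
  from eventually_compose_filterlim[OF assms this]
  have "\<forall>\<^sub>F p in nhds 0 \<times>\<^sub>F nhds 0. P (fst p + snd p *s v)" .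
  then obtain P1 P2 where P: "\<forall>\<^sub>F x in nhds 0. P1 x" "\<forall>\<^sub>F T in nhds 0. P2 T"
    "\<And>x T. P1 x \<Longrightarrow> P2 T \<Longrightarrow> P (x + T *s v)" unfolding eventually_prod_filter by force
  obtain d where "d > 0" "\<And>T. cmod T < d \<Longrightarrow> P2 T" using P(2) unfolding eventually_nhds_metric by auto
  then show ?thesis using P(1,3) by (intro exI[of _ "d/2"]) (auto elim!: eventually_mono)
qed

text \<open>Some point \<open>v\<close> near \<open>0\<close> has \<open>q v \<noteq> 0\<close>, so \<open>q\<close> does not vanish identically on the line spanned by \<open>v\<close>,
  and its zero at the origin of that line, if any, is isolated.\<close>
lemma regular_direction:
  assumes "holo_at q 0" "\<not> zero_germ q"
  shows "\<exists>v r. 0 < r \<and> (\<forall>T. 0 < cmod T \<longrightarrow> cmod T \<le> r \<longrightarrow> q (T *s v) \<noteq> 0)"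
proof -
  obtain e where e: "e > 0" "\<And>x. x \<in> ball 0 e \<Longrightarrow> cdiff q x"
    using assms(1) unfolding holo_at_ball by blast
  obtain v where v: "v \<in> ball 0 e" "q v \<noteq> 0"
  proof (rule ccontr)
    assume "\<not> thesis"
    then have "\<forall>v\<in>ball 0 e. q v = 0" using that by blast
    then have "zero_germ q" unfolding zero_germ_def eventually_nhds_metric
      using e(1) by (auto intro!: exI[of _ e])
    with assms(2) show False by blast
  qed
  obtain R where R: "R > 1" "R * norm v < e"
  proof (cases "norm v = 0")
    case True then show ?thesis using that[of 2] e by simp
  next
    case False
    then have "norm v > 0" by simp
    moreover from this have "1 < e / norm v" using v by simp
    ultimately show ?thesis using dense[of 1 "e / norm v"] that by (auto simp: pos_less_divide_eq)
  qed
  have S: "T *s v \<in> ball 0 e" if "T \<in> ball 0 R" for T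
  proof -
    have "norm (T *s v) \<le> R * norm v" unfolding norm_vsmult using that by (intro mult_right_mono) auto
    then show ?thesis using R by simp
  qed
  have h: "(\<lambda>T. q (0 + T *s v)) holomorphic_on ball 0 R"
    by (rule line_holomorphic) (use S e in auto)
  have "\<forall>\<^sub>F w in at 0. q (0 + w *s v) \<noteq> 0 \<and> w \<in> ball 0 R"
    by (rule non_zero_neighbour_alt[OF h, of 0 1]) (use R v in auto)
  then obtain d where "d > 0" "\<And>w. w \<noteq> 0 \<Longrightarrow> cmod w < d \<Longrightarrow> q (w *s v) \<noteq> 0"
    unfolding eventually_at by auto
  then show ?thesis by (intro exI[of _ v] exI[of _ "d/2"]) auto
qed

lemma holo_at_along_line:
  assumes "holo_at f (x + T *s v)"
  shows "holo_at (\<lambda>y. f (y + T *s v)) x"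
proof -
  have "((\<lambda>y. y + T *s v) \<longlongrightarrow> x + T *s v) (nhds x)" by (intro tendsto_intros filterlim_ident)
  from eventually_compose_filterlim[OF assms[unfolded holo_at_def] this]
  show ?thesis unfolding holo_at_def by eventually_elim (rule cdiff_shift(1))
qed

text \<open>Riemann's extension theorem in several variables. On each line \<open>x + T v\<close> in a regular direction the
  quotient extends across the zeros of \<open>b\<close>, and its value at \<open>T = 0\<close> is its mean over a circle on which
  \<open>b\<close> has no zeros. This mean depends holomorphically on \<open>x\<close>.\<close>
lemma germ_dvd_if_bounded:
  assumes "holo_at a 0" "holo_at b 0" "\<not> zero_germ b"
    and bd: "\<forall>\<^sub>F x in nhds 0. cmod (a x) \<le> M * cmod (b x)"
  shows "germ_dvd b a"
proof -
  obtain v r0 where r0: "0 < r0" "\<And>T. 0 < cmod T \<Longrightarrow> cmod T \<le> r0 \<Longrightarrow> b (T *s v) \<noteq> 0"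
    using regular_direction[OF assms(2,3)] by blast
  have "\<forall>\<^sub>F x in nhds 0. cdiff a x \<and> cdiff b x \<and> cmod (a x) \<le> M * cmod (b x)"
    using assms(1,2) bd unfolding holo_at_def by eventually_elim blast
  from line_eventually[OF this, of v]
  obtain r1 where r1: "0 < r1" "\<forall>\<^sub>F x in nhds 0. \<forall>T. cmod T \<le> r1 \<longrightarrow>
      (cdiff a (x + T *s v) \<and> cdiff b (x + T *s v) \<and> cmod (a (x + T *s v)) \<le> M * cmod (b (x + T *s v)))"
    by blast
  define r where "r = min r0 (r1 / 2)"
  have r: "0 < r" "r \<le> r0" "r < r1" using r0 r1 unfolding r_def by auto
  have nz: "\<forall>\<^sub>F x in nhds 0. \<forall>T\<in>sphere 0 r. b (fst (x, T) + snd (x, T) *s v) \<noteq> 0"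
  proof (rule eventually_tube)
    fix T :: complex assume T: "T \<in> sphere 0 r"
    have "cdiff b (0 + T *s v)" using eventually_nhds_x_imp_x[OF r1(2)] T r by auto
    from isCont_nhds[OF isCont_along_line[OF cdiff_isCont[OF this]], unfolded fst_conv snd_conv]
    have "((\<lambda>p. b (fst p + snd p *s v)) \<longlongrightarrow> b (0 + T *s v)) (nhds (0, T))" .
    moreover have "b (0 + T *s v) \<noteq> 0"
    proof -
      have "cmod T = r" using T by simp
      then have "b (T *s v) \<noteq> 0" using r by (intro r0(2)) linarith+
      then show ?thesis by simp
    qed
    ultimately show "\<forall>\<^sub>F p in nhds (0, T). b (fst p + snd p *s v) \<noteq> 0"
      by (rule tendsto_imp_eventually_ne)
  qed simp
  obtain \<delta> where \<delta>: "0 < \<delta>" and *: "\<And>x. x \<in> ball 0 \<delta> \<Longrightarrow> (\<forall>T. cmod T \<le> r1 \<longrightarrow>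
      (cdiff a (x + T *s v) \<and> cdiff b (x + T *s v) \<and> cmod (a (x + T *s v)) \<le> M * cmod (b (x + T *s v))))
      \<and> (\<forall>T\<in>sphere 0 r. b (x + T *s v) \<noteq> 0)"
    using eventually_conj[OF r1(2) nz] unfolding eventually_nhds_metric by (auto simp: dist_commute)
  define c where "c x = circle_mean r (\<lambda>\<zeta>. a (x + \<zeta> *s v) / b (x + \<zeta> *s v))" for x
  have contab: "continuous_on {z. cdiff a z \<and> cdiff b z} a" "continuous_on {z. cdiff a z \<and> cdiff b z} b"
    by (simp_all add: cdiff_isCont continuous_at_imp_continuous_on)
  have "holo_at c 0"
    unfolding c_def
  proof (rule holo_at_param_mean[OF \<delta>])
    show "continuous_on (ball 0 \<delta> \<times> sphere 0 r) (\<lambda>(x, \<zeta>). a (x + \<zeta> *s v) / b (x + \<zeta> *s v))"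
      unfolding case_prod_beta
    proof (rule continuous_on_divide[OF continuous_on_compose2[OF contab(1)] continuous_on_compose2[OF contab(2)]])
      show "continuous_on (ball 0 \<delta> \<times> sphere 0 r) (\<lambda>p. fst p + snd p *s v)"
        by (intro continuous_intros)
      then show "continuous_on (ball 0 \<delta> \<times> sphere 0 r) (\<lambda>p. fst p + snd p *s v)" .
      show "(\<lambda>p. fst p + snd p *s v) ` (ball 0 \<delta> \<times> sphere 0 r) \<subseteq> {z. cdiff a z \<and> cdiff b z}"
        using * r by auto
      then show "(\<lambda>p. fst p + snd p *s v) ` (ball 0 \<delta> \<times> sphere 0 r) \<subseteq> {z. cdiff a z \<and> cdiff b z}" .
      show "\<forall>p\<in>ball 0 \<delta> \<times> sphere 0 r. b (fst p + snd p *s v) \<noteq> 0" using * by auto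
    qed
    show "cdiff (\<lambda>x. a (x + \<zeta> *s v) / b (x + \<zeta> *s v)) x" if "x \<in> ball 0 \<delta>" "cmod \<zeta> = r" for x \<zeta>
      using that *[OF that(1)] r by (intro cdiff_divide cdiff_shift(1)) auto
  qed (use r in simp)
  moreover have "a x = c x * b x" if x: "x \<in> ball 0 \<delta>" for x
  proof -
    have "\<exists>h. h holomorphic_on cball 0 r \<and> (\<forall>z\<in>cball 0 r. a (x + z *s v) = h z * b (x + z *s v))"
    proof (rule quotient_1d[OF r(1,3)])
      show "(\<lambda>z. a (x + z *s v)) holomorphic_on ball 0 r1" "(\<lambda>z. b (x + z *s v)) holomorphic_on ball 0 r1"
        using *[OF x] by (auto intro!: line_holomorphic)
      show "b (x + z *s v) \<noteq> 0" if "cmod z = r" for z using *[OF x] that by simp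
      fix z assume z: "cmod z < r"
      have "\<forall>\<^sub>F w in nhds z. w \<in> ball 0 r" by (rule eventually_nhds_in_open) (use z in auto)
      then have "\<forall>\<^sub>F w in at z. w \<in> ball 0 r" unfolding eventually_at_filter by eventually_elim simp
      then show "(\<lambda>w. a (x + w *s v) / b (x + w *s v)) \<in> O[at z](\<lambda>_. 1)"
      proof (intro landau_o.bigI[of "\<bar>M\<bar> + 1"], simp, eventually_elim)
        case (elim w)
        then have "cmod (a (x + w *s v)) \<le> M * cmod (b (x + w *s v))" using *[OF x] r by auto
        also have "\<dots> \<le> (\<bar>M\<bar> + 1) * cmod (b (x + w *s v))" by (intro mult_right_mono) auto
        finally show ?case by (cases "b (x + w *s v) = 0") (simp_all add: norm_divide divide_le_eq)
      qed
    qed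
    then obtain h where h: "h holomorphic_on cball 0 r" "\<And>z. cmod z \<le> r \<Longrightarrow> a (x + z *s v) = h z * b (x + z *s v)"
      by auto
    have "c x = circle_mean r (\<lambda>\<zeta>. h \<zeta> * (\<zeta> / (\<zeta> - 0)))"
      unfolding c_def circle_mean_def
    proof (intro integral_cong)
      fix t :: real
      have "cmod (circle_point r t) = r" "circle_point r t \<noteq> 0" using r(1) circle_point_neq_0 by auto
      then show "a (x + circle_point r t *s v) / b (x + circle_point r t *s v) = h (circle_point r t) * (circle_point r t / (circle_point r t - 0))"
        using h(2)[of "circle_point r t"] *[OF x] by simp
    qed
    also have "\<dots> = h 0"
      using circle_mean_cauchy[OF holomorphic_on_imp_continuous_on[OF h(1)]
          holomorphic_on_subset[OF h(1) ball_subset_cball], of 0] r(1) by simp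
    finally show ?thesis using h(2)[of 0] r(1) by simp
  qed
  then have "\<forall>\<^sub>F x in nhds 0. a x = c x * b x"
    using \<delta> by (auto simp: eventually_nhds_metric dist_commute)
  ultimately show ?thesis unfolding germ_dvd_def by blast
qed

section \<open>Zeros, power sums and monic polynomials in one variable\<close>

lemma factor_1d:
  assumes "0 < r" "r < R" "g holomorphic_on ball 0 R" "\<And>z. cmod z = r \<Longrightarrow> g z \<noteq> 0"
  shows "\<exists>zs u. u holomorphic_on ball 0 R \<and> (\<forall>z\<in>cball 0 r. u z \<noteq> 0) \<and> set zs \<subseteq> ball 0 r \<and>
    (\<forall>z\<in>ball 0 R. g z = (\<Prod>a\<leftarrow>zs. z - a) * u z)"
proof -
  define Z where "Z g = {z\<in>cball (0::complex) r. g z = (0::complex)}" for g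
  have fin: "finite (Z g)" if "g holomorphic_on ball 0 R" "\<And>z. cmod z = r \<Longrightarrow> g z \<noteq> 0" for g
    unfolding Z_def by (rule finite_zeros_disc[OF assms(1,2) that])
  show ?thesis using assms(3,4)
  proof (induction "card (Z g)" arbitrary: g rule: less_induct)
    case less
    show ?case
    proof (cases "Z g = {}")
      case True
      then show ?thesis using less.prems by (intro exI[of _ "[]"] exI[of _ g]) (auto simp: Z_def)
    next
      case False
      then obtain a where a: "a \<in> Z g" by blast
      then have ab: "a \<in> ball 0 r" using less.prems(2)[of a] by (auto simp: Z_def less_le)
      then have aR: "a \<in> ball 0 R" using assms(2) by auto
      have nc: "\<not> g constant_on ball 0 R"
      proof
        assume "g constant_on ball 0 R"
        then obtain c where c: "\<And>z. z \<in> ball 0 R \<Longrightarrow> g z = c" by (auto simp: constant_on_def)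
        have "g (of_real r) \<noteq> 0" using assms(1) by (intro less.prems(2)) simp
        then show False using c[of "of_real r"] c[OF aR] a assms(1,2) by (auto simp: Z_def)
      qed
      have "\<exists>h s n. 0 < n \<and> 0 < s \<and> ball a s \<subseteq> ball 0 R \<and> h holomorphic_on ball a s \<and>
          (\<forall>w\<in>ball a s. g w = (w - a) ^ n * h w \<and> h w \<noteq> 0)"
      proof (rule holomorphic_factor_zero_nonconstant[OF less.prems(1) open_ball connected_ball aR _ nc])
        show "g a = 0" using a by (simp add: Z_def)
        fix h s n assume "0 < (n::nat)" "0 < s" "ball a s \<subseteq> ball 0 R" "h holomorphic_on ball a s"
          "\<And>w. w \<in> ball a s \<Longrightarrow> g w = (w - a) ^ n * h w" "\<And>w. w \<in> ball a s \<Longrightarrow> h w \<noteq> 0"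
        then show ?thesis by (intro exI[of _ h] exI[of _ s] exI[of _ n]) auto
      qed
      then obtain h s and n :: nat where h: "0 < n" "0 < s" "ball a s \<subseteq> ball 0 R" "h holomorphic_on ball a s"
        "\<And>w. w \<in> ball a s \<Longrightarrow> g w = (w - a) ^ n * h w" "\<And>w. w \<in> ball a s \<Longrightarrow> h w \<noteq> 0"
        by blast
      define k where "k w = (if w = a then h a else g w / (w - a) ^ n)" for w
      have kh: "k w = h w" if "w \<in> ball a s" for w using h(5)[OF that] by (auto simp: k_def)
      have k1: "k holomorphic_on ball a s" by (rule holomorphic_transform[OF h(4)]) (simp add: kh)
      have k2: "k holomorphic_on (ball 0 R - {a})"
      proof -
        have "(\<lambda>w. g w / (w - a) ^ n) holomorphic_on (ball 0 R - {a})"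
          by (intro holomorphic_intros holomorphic_on_subset[OF less.prems(1)]) auto
        then show ?thesis by (rule holomorphic_transform) (auto simp: k_def)
      qed
      have kR: "k holomorphic_on ball 0 R"
      proof -
        have "k holomorphic_on (ball a s \<union> (ball 0 R - {a}))"
          by (rule holomorphic_on_Un[OF k1 k2]) auto
        moreover have "ball a s \<union> (ball 0 R - {a}) = ball 0 R" using h(2,3) aR by auto
        ultimately show ?thesis by simp
      qed
      have gk: "g w = (w - a) ^ n * k w" if "w \<in> ball 0 R" for w
        using a h(1) by (auto simp: k_def Z_def)
      have k0: "k z \<noteq> 0" if "cmod z = r" for z using gk[of z] less.prems(2)[OF that] that assms(2) by auto
      have "k a \<noteq> 0" using h(2,6) by (simp add: k_def)
      then have "Z k \<subseteq> Z g - {a}" using gk assms(2) by (auto simp: Z_def)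
      then have "card (Z k) < card (Z g)"
        using fin[OF less.prems] a by (intro psubset_card_mono) auto
      from less.hyps[OF this kR k0] obtain zs u where u: "u holomorphic_on ball 0 R" "\<forall>z\<in>cball 0 r. u z \<noteq> 0"
        "set zs \<subseteq> ball 0 r" "\<forall>z\<in>ball 0 R. k z = (\<Prod>a\<leftarrow>zs. z - a) * u z" by blast
      show ?thesis
        by (rule exI[of _ "replicate n a @ zs"], rule exI[of _ u]) (use u ab gk in \<open>auto simp: prod_list_replicate\<close>)
    qed
  qed
qed

text \<open>The argument principle with weight \<open>\<zeta>\<^sup>k\<close>. The logarithmic derivative of \<open>g\<close> is \<open>\<Sum>a. 1/(\<zeta> - a)\<close> plus
  the holomorphic \<open>u'/u\<close>; one more factor \<open>\<zeta>\<close> appears since circle means carry \<open>d\<zeta>/\<zeta>\<close>.\<close>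
lemma power_sums_1d:
  assumes "0 < r" "r < R" "u holomorphic_on ball 0 R" "\<And>z. z \<in> cball 0 r \<Longrightarrow> u z \<noteq> 0"
    and zs: "set zs \<subseteq> ball 0 r" and g: "\<And>z. z \<in> ball 0 R \<Longrightarrow> g z = (\<Prod>a\<leftarrow>zs. z - a) * u z"
  shows "circle_mean r (\<lambda>\<zeta>. \<zeta> ^ Suc k * deriv g \<zeta> / g \<zeta>) = (\<Sum>a\<leftarrow>zs. a ^ k)"
proof -
  have du: "(u has_field_derivative deriv u z) (at z)" if "z \<in> ball 0 R" for z
    using holomorphic_derivI[OF assms(3) open_ball that] .
  have cont_frac: "continuous_on (sphere 0 r) (\<lambda>\<zeta>. \<Sum>a\<leftarrow>as. \<zeta> ^ k * (\<zeta> / (\<zeta> - a)))"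
    if "set as \<subseteq> ball 0 r" for as :: "complex list"
    using that
  proof (induction as)
    case (Cons a as)
    have "continuous_on (sphere 0 r) (\<lambda>\<zeta>. \<zeta> ^ k * (\<zeta> / (\<zeta> - a)))"
      using Cons.prems by (auto intro!: continuous_intros)
    moreover have "continuous_on (sphere 0 r) (\<lambda>\<zeta>. \<Sum>a\<leftarrow>as. \<zeta> ^ k * (\<zeta> / (\<zeta> - a)))"
      using Cons by simp
    ultimately show ?case unfolding list.map sum_list.Cons by (rule continuous_on_add)
  qed simp
  have log: "deriv g \<zeta> / g \<zeta> = (\<Sum>a\<leftarrow>zs. 1 / (\<zeta> - a)) + deriv u \<zeta> / u \<zeta>" if z: "cmod \<zeta> = r" for \<zeta>
  proof -
    have zR: "\<zeta> \<in> ball 0 R" using z assms(2) by simp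
    have nz: "a \<noteq> \<zeta>" if "a \<in> set zs" for a using zs that z by auto
    have u0: "u \<zeta> \<noteq> 0" using assms(4) z by simp
    have "((\<lambda>z. (\<Prod>a\<leftarrow>as. z - a) * u z) has_field_derivative
        ((\<Sum>a\<leftarrow>as. 1 / (\<zeta> - a)) + deriv u \<zeta> / u \<zeta>) * ((\<Prod>a\<leftarrow>as. \<zeta> - a) * u \<zeta>)) (at \<zeta>)"
      if "set as \<subseteq> set zs" for as
      using that
    proof (induction as)
      case Nil
      then show ?case using du[OF zR] u0 by simp
    next
      case (Cons a as)
      have "((\<lambda>z. (z - a) * ((\<Prod>a\<leftarrow>as. z - a) * u z)) has_field_derivative
        (\<zeta> - a) * (((\<Sum>a\<leftarrow>as. 1 / (\<zeta> - a)) + deriv u \<zeta> / u \<zeta>) * ((\<Prod>a\<leftarrow>as. \<zeta> - a) * u \<zeta>))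
        + 1 * ((\<Prod>a\<leftarrow>as. \<zeta> - a) * u \<zeta>)) (at \<zeta>)"
        by (rule DERIV_mult') (use Cons in \<open>auto intro!: derivative_eq_intros\<close>)
      moreover have "\<zeta> - a \<noteq> 0" using nz Cons.prems by auto
      then have "(\<zeta> - a) * (S * P) + 1 * P = (1 / (\<zeta> - a) + S) * ((\<zeta> - a) * P)" for S P
        by (simp add: field_simps)
      ultimately show ?case by (simp only: list.map sum_list.Cons prod_list.Cons mult.assoc add.assoc)
    qed
    from this[of zs] have "((\<lambda>z. (\<Prod>a\<leftarrow>zs. z - a) * u z) has_field_derivative
        ((\<Sum>a\<leftarrow>zs. 1 / (\<zeta> - a)) + deriv u \<zeta> / u \<zeta>) * g \<zeta>) (at \<zeta>)" using g[OF zR] by simp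
    moreover have "\<forall>\<^sub>F z in nhds \<zeta>. (\<Prod>a\<leftarrow>zs. z - a) * u z = g z"
      using eventually_nhds_in_open[OF open_ball zR] by eventually_elim (use g in auto)
    ultimately have "(g has_field_derivative ((\<Sum>a\<leftarrow>zs. 1 / (\<zeta> - a)) + deriv u \<zeta> / u \<zeta>) * g \<zeta>) (at \<zeta>)"
      by (simp only: DERIV_cong_ev[OF refl _ refl])
    moreover have "g \<zeta> \<noteq> 0" using g[OF zR] u0 nz[of \<zeta>] by (auto simp: prod_list_zero_iff)
    ultimately show ?thesis by (simp add: DERIV_imp_deriv)
  qed
  have hu: "(\<lambda>\<zeta>. \<zeta> ^ Suc k * (deriv u \<zeta> / u \<zeta>)) holomorphic_on cball 0 r"
    using assms by (intro holomorphic_intros holomorphic_on_subset[OF assms(3)]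
        holomorphic_on_subset[OF holomorphic_deriv[OF assms(3) open_ball]]) auto
  have "circle_mean r (\<lambda>\<zeta>. \<zeta> ^ Suc k * deriv g \<zeta> / g \<zeta>)
     = circle_mean r (\<lambda>\<zeta>. (\<Sum>a\<leftarrow>zs. \<zeta> ^ k * (\<zeta> / (\<zeta> - a))) + \<zeta> ^ Suc k * (deriv u \<zeta> / u \<zeta>))"
  proof (rule circle_mean_cong)
    fix z assume z: "cmod z = r"
    have "z ^ Suc k * deriv g z / g z = z ^ Suc k * (deriv g z / g z)" by simp
    also have "\<dots> = z ^ Suc k * (\<Sum>a\<leftarrow>zs. 1 / (z - a)) + z ^ Suc k * (deriv u z / u z)"
      unfolding log[OF z] by (rule distrib_left)
    also have "z ^ Suc k * (\<Sum>a\<leftarrow>zs. 1 / (z - a)) = (\<Sum>a\<leftarrow>zs. z ^ k * (z / (z - a)))"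
      by (induction zs) (simp_all add: algebra_simps)
    finally show "z ^ Suc k * deriv g z / g z = (\<Sum>a\<leftarrow>zs. z ^ k * (z / (z - a))) + z ^ Suc k * (deriv u z / u z)" .
  qed (use assms in simp)
  also have "\<dots> = circle_mean r (\<lambda>\<zeta>. (\<Sum>a\<leftarrow>zs. \<zeta> ^ k * (\<zeta> / (\<zeta> - a)))) + circle_mean r (\<lambda>\<zeta>. \<zeta> ^ Suc k * (deriv u \<zeta> / u \<zeta>))"
    using assms cont_frac[OF zs]
    by (intro circle_mean_add continuous_on_subset[OF holomorphic_on_imp_continuous_on[OF hu]]) auto
  also have "circle_mean r (\<lambda>\<zeta>. \<zeta> ^ Suc k * (deriv u \<zeta> / u \<zeta>))
      = circle_mean r (\<lambda>\<zeta>. (\<zeta> ^ Suc k * (deriv u \<zeta> / u \<zeta>)) * (\<zeta> / (\<zeta> - 0)))"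
    by (rule circle_mean_cong) (use assms in auto)
  also have "\<dots> = 0"
    using circle_mean_cauchy[OF holomorphic_on_imp_continuous_on[OF hu] holomorphic_on_subset[OF hu ball_subset_cball], of 0]
      assms(1) by simp
  also have "circle_mean r (\<lambda>\<zeta>. (\<Sum>a\<leftarrow>zs. \<zeta> ^ k * (\<zeta> / (\<zeta> - a)))) = (\<Sum>a\<leftarrow>zs. a ^ k)"
    using zs
  proof (induction zs)
    case Nil
    then show ?case by (simp add: circle_mean_def)
  next
    case (Cons a zs)
    have "circle_mean r (\<lambda>\<zeta>. \<zeta> ^ k * (\<zeta> / (\<zeta> - a)) + (\<Sum>a\<leftarrow>zs. \<zeta> ^ k * (\<zeta> / (\<zeta> - a))))
       = circle_mean r (\<lambda>\<zeta>. \<zeta> ^ k * (\<zeta> / (\<zeta> - a))) + circle_mean r (\<lambda>\<zeta>. (\<Sum>a\<leftarrow>zs. \<zeta> ^ k * (\<zeta> / (\<zeta> - a))))"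
      using Cons.prems assms(1) cont_frac[of zs] cont_frac[of "[a]"] by (intro circle_mean_add) auto
    moreover have "circle_mean r (\<lambda>\<zeta>. \<zeta> ^ k * (\<zeta> / (\<zeta> - a))) = a ^ k"
      using Cons.prems by (intro circle_mean_cauchy) (auto intro!: continuous_intros holomorphic_intros)
    ultimately show ?case using Cons by simp
  qed
  finally show ?thesis by simp
qed

definition root_poly :: "complex list \<Rightarrow> complex poly" where
  "root_poly zs = (\<Prod>a\<leftarrow>zs. [:- a, 1:])"

lemma root_poly_basic: "degree (root_poly zs) = length zs" "coeff (root_poly zs) (length zs) = 1"
  "poly (root_poly zs) T = (\<Prod>a\<leftarrow>zs. T - a)"
proof -
  have "degree (root_poly zs) = length zs \<and> root_poly zs \<noteq> 0"
    unfolding root_poly_def by (induction zs) (auto simp: degree_mult_eq simp del: mult_pCons_left)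
  then show d: "degree (root_poly zs) = length zs" by blast
  have "lead_coeff (root_poly zs) = 1"
    unfolding root_poly_def by (induction zs) (auto simp: lead_coeff_mult simp del: mult_pCons_left)
  then show "coeff (root_poly zs) (length zs) = 1" using d by simp
  show "poly (root_poly zs) T = (\<Prod>a\<leftarrow>zs. T - a)"
    unfolding root_poly_def by (induction zs) (auto simp: algebra_simps)
qed

text \<open>Newton's identities as a formula for the logarithmic derivative of \<open>\<Prod>a. 1 - a X\<close>, the reversed
  polynomial with roots \<open>a\<close>.\<close>
lemma newton_identity:
  "fps_deriv (\<Prod>a\<leftarrow>zs. 1 - fps_const a * fps_X) =
     - (\<Prod>a\<leftarrow>zs. 1 - fps_const a * fps_X) * Abs_fps (\<lambda>k. \<Sum>a\<leftarrow>zs. (a :: complex) ^ Suc k)"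
proof (induction zs)
  case Nil
  then show ?case by (simp add: fps_zero_def[symmetric])
next
  case (Cons a zs)
  define V where "V = (\<Prod>a\<leftarrow>zs. 1 - fps_const a * fps_X)"
  define P where "P = Abs_fps (\<lambda>k. \<Sum>a\<leftarrow>zs. (a :: complex) ^ Suc k)"
  define A where "A = Abs_fps (\<lambda>k. a ^ Suc k)"
  have A: "(1 - fps_const a * fps_X) * A = fps_const a"
  proof (rule fps_ext)
    fix n show "fps_nth ((1 - fps_const a * fps_X) * A) n = fps_nth (fps_const a) n"
      by (cases n) (simp_all add: A_def algebra_simps fps_mult_fps_X_commute[symmetric] mult.assoc)
  qed
  have "Abs_fps (\<lambda>k. \<Sum>a\<leftarrow>a # zs. a ^ Suc k) = A + P" by (rule fps_ext) (simp add: A_def P_def)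
  moreover have "fps_deriv ((1 - fps_const a * fps_X) * V) = - ((1 - fps_const a * fps_X) * V) * (A + P)"
  proof -
    have "fps_deriv ((1 - fps_const a * fps_X) * V) = (1 - fps_const a * fps_X) * (- V * P) - fps_const a * V"
      using Cons unfolding V_def P_def by (simp add: fps_const_neg[symmetric] del: fps_const_neg)
    also have "\<dots> = - ((1 - fps_const a * fps_X) * V) * P - ((1 - fps_const a * fps_X) * A) * V"
      unfolding A by (simp add: algebra_simps)
    finally show ?thesis by (simp add: algebra_simps)
  qed
  ultimately show ?case by (simp add: V_def)
qed

lemma reflect_root_poly: "fps_of_poly (reflect_poly (root_poly zs)) = (\<Prod>a\<leftarrow>zs. 1 - fps_const a * fps_X)"
proof (induction zs)
  case Nil
  then show ?case by (simp add: root_poly_def)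
next
  case (Cons a zs)
  have "reflect_poly [:- a, 1:] = [:1, - a:]" by (simp add: reflect_poly_def)
  moreover have "fps_of_poly [:1, - a:] = 1 - fps_const a * fps_X"
    by (simp add: fps_of_poly_pCons algebra_simps)
  ultimately show ?case using Cons by (simp add: root_poly_def reflect_poly_mult fps_of_poly_mult del: mult_pCons_left)
qed

text \<open>Counting coefficients from the leading one makes Newton's identities a recursion starting
  from \<open>1\<close> that does not mention the degree.\<close>
definition top_coeff :: "complex list \<Rightarrow> nat \<Rightarrow> complex" where
  "top_coeff zs k = coeff (reflect_poly (root_poly zs)) k"

lemma top_coeff_0: "top_coeff zs 0 = 1"
  unfolding top_coeff_def using root_poly_basic(1,2)[of zs] by (simp add: coeff_reflect_poly)

lemma top_coeff_Suc: "of_nat (Suc n) * top_coeff zs (Suc n) = - (\<Sum>i=0..n. top_coeff zs i * (\<Sum>a\<leftarrow>zs. a ^ Suc (n - i)))"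
proof -
  have t: "fps_nth (\<Prod>a\<leftarrow>zs. 1 - fps_const a * fps_X) k = top_coeff zs k" for k
    unfolding top_coeff_def reflect_root_poly[symmetric] by simp
  have "fps_nth (fps_deriv (\<Prod>a\<leftarrow>zs. 1 - fps_const a * fps_X)) n
     = fps_nth (- (\<Prod>a\<leftarrow>zs. 1 - fps_const a * fps_X) * Abs_fps (\<lambda>k. \<Sum>a\<leftarrow>zs. (a :: complex) ^ Suc k)) n"
    by (simp only: newton_identity)
  then show ?thesis by (simp add: fps_mult_nth t sum_negf)
qed

lemma coeff_root_poly: "k \<le> length zs \<Longrightarrow> coeff (root_poly zs) k = top_coeff zs (length zs - k)"
  unfolding top_coeff_def by (simp add: coeff_reflect_poly root_poly_basic)

text \<open>Split off one linear factor at a time: each multiplies the bound by at most \<open>1 + r\<close>.\<close>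
lemma monic_coeff_bound:
  fixes p :: "complex poly"
  assumes "degree p = e" "lead_coeff p = 1" "\<And>z. poly p z = 0 \<Longrightarrow> cmod z \<le> r" "0 \<le> r"
  shows "cmod (coeff p k) \<le> (1 + r) ^ e"
  using assms
proof (induction e arbitrary: p k)
  case 0
  then have "p = 1" by (auto elim!: degree_eq_zeroE)
  then show ?case by (simp add: coeff_1)
next
  case (Suc e)
  have "\<not> constant (poly p)" using Suc.prems(1) by (simp add: constant_degree)
  from Fundamental_Theorem_Algebra.fundamental_theorem_of_algebra[OF this] obtain z where z: "poly p z = 0" by blast
  then obtain p' where p: "p = [:- z, 1:] * p'" by (auto simp: poly_eq_0_iff_dvd)
  have p'0: "p' \<noteq> 0" using p Suc.prems(1) by auto
  have d: "degree p' = e" using Suc.prems(1) p'0 unfolding p by (simp add: degree_mult_eq del: mult_pCons_left)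
  have l: "lead_coeff p' = 1" using Suc.prems(2) unfolding p by (simp add: lead_coeff_mult del: mult_pCons_left)
  have b: "cmod (coeff p' j) \<le> (1 + r) ^ e" for j
    using Suc.IH[OF d l] Suc.prems(3,4) unfolding p by simp
  have zr: "cmod z \<le> r" using Suc.prems(3)[OF z] .
  have "coeff p k = - z * coeff p' k + (if k = 0 then 0 else coeff p' (k - 1))"
    unfolding p by (cases k) (simp_all add: coeff_pCons)
  also have "cmod \<dots> \<le> cmod z * cmod (coeff p' k) + cmod (if k = 0 then 0 else coeff p' (k - 1))"
    by (rule order_trans[OF norm_triangle_ineq]) (simp add: norm_mult)
  also have "\<dots> \<le> r * (1 + r) ^ e + (1 + r) ^ e"
    using b Suc.prems(4) zr by (intro add_mono mult_mono) auto
  finally show ?case by (simp add: algebra_simps)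
qed

section \<open>Weierstrass polynomials along a line\<close>

lemma eventually_near_compact:
  fixes F :: "'a::metric_space \<times> complex \<Rightarrow> real"
  assumes "compact K" "\<And>T. T \<in> K \<Longrightarrow> isCont F (x0, T)" "\<And>T. T \<in> K \<Longrightarrow> c < F (x0, T)"
  shows "\<forall>\<^sub>F x in nhds x0. \<forall>T\<in>K. c < F (x, T)"
proof (rule eventually_tube[OF assms(1)])
  fix T assume "T \<in> K"
  from order_tendstoD(1)[OF isCont_nhds[OF assms(2)[OF this]] assms(3)[OF this]]
  show "\<forall>\<^sub>F z in nhds (x0, T). c < F z" .
qed

lemma eventually_bounded_germ:
  assumes "isCont f x"
  shows "\<forall>\<^sub>F y in nhds x. cmod (f y) < cmod (f x) + 1"
  by (rule order_tendstoD(2)[OF isCont_nhds]) (use assms in \<open>auto intro!: continuous_intros\<close>)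

lemma holo_at_congI:
  "holo_at g x \<Longrightarrow> \<forall>\<^sub>F y in nhds x. f y = g y \<Longrightarrow> holo_at f x"
  by (simp add: holo_at_cong)

lemma poly_below:
  assumes "\<And>k. k \<ge> m \<Longrightarrow> coeff (p :: complex poly) k = 0"
  shows "poly p T = (\<Sum>k<m. coeff p k * T ^ k)"
proof -
  have "p = (\<Sum>k<m. monom (coeff p k) k)"
    by (rule poly_eqI) (use assms in \<open>auto simp: coeff_sum not_less\<close>)
  then have "poly p T = poly (\<Sum>k<m. monom (coeff p k) k) T" by simp
  then show ?thesis by (simp add: poly_sum poly_monom)
qed

text \<open>A polynomial in one variable \<open>T\<close> whose coefficients are germs is a family of polynomials over \<open>\<complex>\<close>
  indexed by points. The degree may drop at particular points, hence a bound \<open>degree_less\<close> in place of a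
  degree.\<close>
definition holo_coefficients :: "(complex^'n \<Rightarrow> complex poly) \<Rightarrow> bool" where
  "holo_coefficients P \<longleftrightarrow> (\<forall>k. holo_at (\<lambda>x. coeff (P x) k) 0)"

definition degree_less :: "nat \<Rightarrow> (complex^'n \<Rightarrow> complex poly) \<Rightarrow> bool" where
  "degree_less m P \<longleftrightarrow> (\<forall>\<^sub>F x in nhds 0. \<forall>k\<ge>m. coeff (P x) k = 0)"

lemma holo_coefficients_bounded:
  assumes "holo_coefficients P" "degree_less m P" "0 \<le> \<rho>"
  shows "\<exists>M>0. \<forall>\<^sub>F x in nhds 0. \<forall>T. cmod T \<le> \<rho> \<longrightarrow> cmod (poly (P x) T) \<le> M"
proof -
  define M where "M = (\<Sum>k<m. (cmod (coeff (P 0) k) + 1) * \<rho> ^ k) + 1"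
  have "\<forall>\<^sub>F x in nhds 0. \<forall>k\<in>{..<m}. cmod (coeff (P x) k) < cmod (coeff (P 0) k) + 1"
    by (rule eventually_ball_finite)
       (use assms(1) in \<open>auto simp: holo_coefficients_def intro!: eventually_bounded_germ holo_at_isCont\<close>)
  with assms(2)[unfolded degree_less_def]
  have "\<forall>\<^sub>F x in nhds 0. \<forall>T. cmod T \<le> \<rho> \<longrightarrow> cmod (poly (P x) T) \<le> M"
  proof eventually_elim
    case (elim x)
    show ?case
    proof (intro allI impI)
      fix T assume T: "cmod T \<le> \<rho>"
      have "cmod (poly (P x) T) = cmod (\<Sum>k<m. coeff (P x) k * T ^ k)"
        using elim(1) by (subst poly_below[of m]) auto
      also have "\<dots> \<le> (\<Sum>k<m. (cmod (coeff (P 0) k) + 1) * \<rho> ^ k)"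
      proof (rule sum_norm_le)
        fix k assume "k \<in> {..<m}"
        then show "cmod (coeff (P x) k * T ^ k) \<le> (cmod (coeff (P 0) k) + 1) * \<rho> ^ k"
          unfolding norm_mult norm_power using elim(2) T by (intro mult_mono power_mono) (auto intro: less_imp_le)
      qed
      finally show "cmod (poly (P x) T) \<le> M" by (simp add: M_def)
    qed
  qed
  moreover have "M > 0" unfolding M_def using assms(3) by (intro add_nonneg_pos sum_nonneg) auto
  ultimately show ?thesis by blast
qed

text \<open>The functions whose denominators are studied are \<open>p/q\<close> for \<open>p \<in> S\<close>, restricted to the lines
  \<open>T \<mapsto> x + T v\<close> with \<open>x\<close> near \<open>0\<close>. On the line through \<open>0\<close> the denominator \<open>q\<close> has no zero with
  \<open>0 < |T| \<le> r\<close>, so on nearby lines its zeros with \<open>|T| \<le> r\<close> stay away from the circle \<open>|T| = r\<close>. The radius \<open>R\<close>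
  leaves room to treat the closed disc by statements about open ones.\<close>
locale weierstrass_setup =
  fixes q :: "complex^'n \<Rightarrow> complex" and S :: "(complex^'n \<Rightarrow> complex) set" and v :: "complex^'n" and r R :: real
  assumes finS: "finite S" and r: "0 < r" and rR: "r < R"
    and hol: "\<forall>\<^sub>F x in nhds 0. \<forall>T. cmod T \<le> R \<longrightarrow> (\<forall>p\<in>insert q S. holo_at p (x + T *s v))"
    and nz: "\<And>T. 0 < cmod T \<Longrightarrow> cmod T \<le> r \<Longrightarrow> q (T *s v) \<noteq> 0"
begin

lemma hol0: "cmod T \<le> R \<Longrightarrow> p \<in> insert q S \<Longrightarrow> holo_at p (0 + T *s v)"
  using eventually_nhds_x_imp_x[OF hol] by blast

lemma hol_germ: "p \<in> insert q S \<Longrightarrow> holo_at p 0"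
  using hol0[of 0 p] r rR by simp

lemma nonzero_q: "\<not> zero_germ q"
proof
  assume "zero_germ q"
  then have "\<forall>\<^sub>F x in nhds 0. q x = 0" by (simp add: zero_germ_def)
  from line_eventually[OF this, of v] obtain \<rho> where \<rho>: "0 < \<rho>"
    "\<forall>\<^sub>F x in nhds 0. \<forall>T. cmod T \<le> \<rho> \<longrightarrow> q (x + T *s v) = 0" by blast
  define T where "T = complex_of_real (min \<rho> r)"
  have "cmod T = min \<rho> r" using \<rho>(1) r by (simp add: T_def)
  then have T: "0 < cmod T" "cmod T \<le> \<rho>" "cmod T \<le> r" using \<rho>(1) r by auto
  have "q (0 + T *s v) = 0" using eventually_nhds_x_imp_x[OF \<rho>(2)] T by blast
  with nz[OF T(1,3)] show False by simp
qed

lemma cont_line0: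
  assumes "cmod T \<le> R" "p \<in> insert q S"
  shows "isCont (\<lambda>z. cmod (p (fst z + snd z *s v))) (0, T)"
  by (intro continuous_norm isCont_along_line holo_at_isCont hol0 assms)

lemma q_lower:
  assumes "0 < \<rho>" "\<rho> \<le> r"
  shows "\<exists>m>0. \<forall>\<^sub>F x in nhds 0. \<forall>T. \<rho> \<le> cmod T \<longrightarrow> cmod T \<le> r \<longrightarrow> m \<le> cmod (q (x + T *s v))"
proof -
  define K where "K = cball 0 r - ball (0::complex) \<rho>"
  have K: "compact K" unfolding K_def by (intro compact_diff) auto
  have "of_real \<rho> \<in> K" using assms by (simp add: K_def)
  then have ne: "K \<noteq> {}" by blast
  have "continuous_on K (\<lambda>T. cmod (q (0 + T *s v)))"
    using rR hol0 by (intro continuous_at_imp_continuous_on ballI continuous_norm DERIV_isCont[OF cdiff_line]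
        holo_at_imp_cdiff) (auto simp: K_def)
  from continuous_attains_inf[OF K ne this] obtain T0 where T0: "T0 \<in> K"
    "\<And>T. T \<in> K \<Longrightarrow> cmod (q (0 + T0 *s v)) \<le> cmod (q (0 + T *s v))" by blast
  define m where "m = cmod (q (0 + T0 *s v)) / 2"
  have "cmod T0 > 0" "cmod T0 \<le> r" using T0(1) assms(1) by (auto simp: K_def not_less simp del: zero_less_norm_iff)
  from nz[OF this] have m: "m > 0" by (simp add: m_def)
  have "\<forall>\<^sub>F x in nhds 0. \<forall>T\<in>K. m < cmod (q (fst (x, T) + snd (x, T) *s v))"
  proof (rule eventually_near_compact[OF K])
    fix T assume T: "T \<in> K"
    show "isCont (\<lambda>z. cmod (q (fst z + snd z *s v))) (0, T)"
      by (rule cont_line0) (use T rR in \<open>auto simp: K_def\<close>)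
    show "m < cmod (q (fst (0, T) + snd (0, T) *s v))"
    proof -
      have "2 * m \<le> cmod (q (0 + T *s v))" using T0(2)[OF T] by (simp add: m_def)
      then show ?thesis using m by simp
    qed
  qed
  then have "\<forall>\<^sub>F x in nhds 0. \<forall>T. \<rho> \<le> cmod T \<longrightarrow> cmod T \<le> r \<longrightarrow> m \<le> cmod (q (x + T *s v))"
    by eventually_elim (force simp: K_def intro: less_imp_le)
  with m show ?thesis by blast
qed

lemma q_circle: "\<forall>\<^sub>F x in nhds 0. \<forall>T. cmod T = r \<longrightarrow> q (x + T *s v) \<noteq> 0"
proof -
  obtain m where "m > 0" "\<forall>\<^sub>F x in nhds 0. \<forall>T. r \<le> cmod T \<longrightarrow> cmod T \<le> r \<longrightarrow> m \<le> cmod (q (x + T *s v))"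
    using q_lower[OF r order_refl] by blast
  from this(2) show ?thesis by eventually_elim (use \<open>m > 0\<close> in force)
qed

lemma p_upper:
  assumes "p \<in> insert q S"
  shows "\<exists>C>0. \<forall>\<^sub>F x in nhds 0. \<forall>T. cmod T \<le> r \<longrightarrow> cmod (p (x + T *s v)) \<le> C"
proof -
  define K where "K = cball (0::complex) r"
  have K: "compact K" unfolding K_def by auto
  have ne: "K \<noteq> {}" using r by (auto simp: K_def)
  have "continuous_on K (\<lambda>T. cmod (p (0 + T *s v)))"
    using rR hol0 assms by (intro continuous_at_imp_continuous_on ballI continuous_norm DERIV_isCont[OF cdiff_line]
        holo_at_imp_cdiff) (auto simp: K_def)
  from continuous_attains_sup[OF K ne this] obtain T0 where T0: "T0 \<in> K"
    "\<And>T. T \<in> K \<Longrightarrow> cmod (p (0 + T *s v)) \<le> cmod (p (0 + T0 *s v))" by blast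
  define C where "C = cmod (p (0 + T0 *s v)) + 1"
  have "\<forall>\<^sub>F x in nhds 0. \<forall>T\<in>K. - C < - cmod (p (fst (x, T) + snd (x, T) *s v))"
  proof (rule eventually_near_compact[OF K])
    fix T assume T: "T \<in> K"
    show "isCont (\<lambda>z. - cmod (p (fst z + snd z *s v))) (0, T)"
      by (intro continuous_minus cont_line0) (use T rR assms in \<open>auto simp: K_def\<close>)
    show "- C < - cmod (p (fst (0, T) + snd (0, T) *s v))"
      using T0(2)[OF T] unfolding C_def by simp
  qed
  then have "\<forall>\<^sub>F x in nhds 0. \<forall>T. cmod T \<le> r \<longrightarrow> cmod (p (x + T *s v)) \<le> C"
    by eventually_elim (force simp: K_def intro: less_imp_le)
  moreover have "C > 0" unfolding C_def by (simp add: add_nonneg_pos)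
  ultimately show ?thesis by blast
qed

text \<open>These are the polynomials \<open>P(x, T)\<close> for which \<open>P(x, T) p(x + T v)/q(x + T v)\<close> is holomorphic. The
  condition is phrased as a uniform bound on the fixed disc \<open>|T| \<le> r\<close>: a bound is inherited by
  combinations of polynomials, can be checked on a dense set of \<open>x\<close>, and at \<open>T = 0\<close> gives divisibility
  back.\<close>
definition admissible :: "(complex^'n \<Rightarrow> complex poly) \<Rightarrow> bool" where
  "admissible P \<longleftrightarrow> holo_coefficients P \<and> (\<exists>m. degree_less m P) \<and>
    (\<forall>p\<in>S. \<exists>M. \<forall>\<^sub>F x in nhds 0. \<forall>T. cmod T \<le> r \<longrightarrow> cmod (poly (P x) T * p (x + T *s v)) \<le> M * cmod (q (x + T *s v)))"

text \<open>The power sums of the zeros of \<open>q\<close> on the line through \<open>x\<close>, by the argument principle.\<close>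
definition power_sum :: "nat \<Rightarrow> complex^'n \<Rightarrow> complex" where
  "power_sum k x = circle_mean r (\<lambda>\<zeta>. \<zeta> ^ Suc k * fd q (x + \<zeta> *s v) v / q (x + \<zeta> *s v))"

lemma holo_power_sum: "holo_at (power_sum k) 0"
proof -
  have "\<forall>\<^sub>F x in nhds 0. (\<forall>T. cmod T \<le> R \<longrightarrow> (\<forall>p\<in>insert q S. holo_at p (x + T *s v))) \<and> (\<forall>T. cmod T = r \<longrightarrow> q (x + T *s v) \<noteq> 0)"
    using eventually_conj[OF hol q_circle] .
  then obtain \<delta> where \<delta>: "0 < \<delta>" "\<And>x. x \<in> ball 0 \<delta> \<Longrightarrow> (\<forall>T. cmod T \<le> R \<longrightarrow> holo_at q (x + T *s v)) \<and> (\<forall>T. cmod T = r \<longrightarrow> q (x + T *s v) \<noteq> 0)"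
    unfolding eventually_nhds_metric by (auto simp: dist_commute)
  let ?A = "{z. holo_at q z}"
  have c1: "continuous_on ?A q" "continuous_on ?A (\<lambda>z. fd q z v)"
    by (auto intro!: continuous_at_imp_continuous_on holo_at_isCont holo_at_fd)
  have c2: "continuous_on (ball 0 \<delta> \<times> sphere 0 r) (\<lambda>p. fst p + snd p *s v)"
    by (intro continuous_intros)
  have c3: "(\<lambda>p. fst p + snd p *s v) ` (ball 0 \<delta> \<times> sphere 0 r) \<subseteq> ?A"
    using \<delta>(2) rR by auto
  show ?thesis unfolding power_sum_def
  proof (rule holo_at_param_mean[OF \<delta>(1)])
    show "continuous_on (ball 0 \<delta> \<times> sphere 0 r) (\<lambda>(x, \<zeta>). \<zeta> ^ Suc k * fd q (x + \<zeta> *s v) v / q (x + \<zeta> *s v))"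
      unfolding case_prod_beta
    proof (rule continuous_on_divide[OF continuous_on_mult])
      show "continuous_on (ball 0 \<delta> \<times> sphere 0 r) (\<lambda>p. fd q (fst p + snd p *s v) v)"
        by (rule continuous_on_compose2[OF c1(2) c2 c3])
      show "continuous_on (ball 0 \<delta> \<times> sphere 0 r) (\<lambda>p. q (fst p + snd p *s v))"
        by (rule continuous_on_compose2[OF c1(1) c2 c3])
      show "\<forall>p\<in>ball 0 \<delta> \<times> sphere 0 r. q (fst p + snd p *s v) \<noteq> 0" using \<delta>(2) by auto
    qed (intro continuous_intros)
    show "cdiff (\<lambda>x. \<zeta> ^ Suc k * fd q (x + \<zeta> *s v) v / q (x + \<zeta> *s v)) x" if "x \<in> ball 0 \<delta>" "cmod \<zeta> = r" for x \<zeta>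
      using \<delta>(2)[OF that(1)] that(2) rR
      by (intro cdiff_divide cdiff_mult cdiff_const cdiff_shift(1)[of "\<lambda>z. fd q z v"] cdiff_shift(1)[of q]
          holo_at_imp_cdiff holo_at_fd) auto
  qed (use r in simp)
qed

definition regular_fibre :: "complex^'n \<Rightarrow> bool" where
  "regular_fibre x \<longleftrightarrow> (\<forall>T. cmod T \<le> R \<longrightarrow> holo_at q (x + T *s v)) \<and> (\<forall>T. cmod T = r \<longrightarrow> q (x + T *s v) \<noteq> 0)"

lemma eventually_regular_fibre: "\<forall>\<^sub>F x in nhds 0. regular_fibre x"
  using hol q_circle by eventually_elim (auto simp: regular_fibre_def)

text \<open>The zeros in the disc, with multiplicities. The order of the list is arbitrary and only
  symmetric functions of it are holomorphic in \<open>x\<close>.\<close>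
definition fibre_zeros :: "complex^'n \<Rightarrow> complex list" where
  "fibre_zeros x = (SOME zs. \<exists>u. u holomorphic_on ball 0 R \<and> (\<forall>z\<in>cball 0 r. u z \<noteq> 0) \<and> set zs \<subseteq> ball 0 r \<and>
    (\<forall>z\<in>ball 0 R. q (x + z *s v) = (\<Prod>a\<leftarrow>zs. z - a) * u z))"

lemma fibre_zeros:
  assumes "regular_fibre x"
  shows "\<exists>u. u holomorphic_on ball 0 R \<and> (\<forall>z\<in>cball 0 r. u z \<noteq> 0) \<and> set (fibre_zeros x) \<subseteq> ball 0 r \<and>
    (\<forall>z\<in>ball 0 R. q (x + z *s v) = (\<Prod>a\<leftarrow>fibre_zeros x. z - a) * u z)"
  unfolding fibre_zeros_def
  by (rule someI_ex[OF factor_1d[OF r rR line_holomorphic]])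
     (use assms in \<open>auto simp: regular_fibre_def intro: holo_at_imp_cdiff\<close>)

lemma power_sum_fibre_zeros:
  assumes "regular_fibre x"
  shows "power_sum k x = (\<Sum>a\<leftarrow>fibre_zeros x. a ^ k)"
proof -
  obtain u where u: "u holomorphic_on ball 0 R" "\<And>z. z \<in> cball 0 r \<Longrightarrow> u z \<noteq> 0" "set (fibre_zeros x) \<subseteq> ball 0 r"
    "\<And>z. z \<in> ball 0 R \<Longrightarrow> q (x + z *s v) = (\<Prod>a\<leftarrow>fibre_zeros x. z - a) * u z" using fibre_zeros[OF assms] by blast
  have "power_sum k x = circle_mean r (\<lambda>\<zeta>. \<zeta> ^ Suc k * deriv (\<lambda>T. q (x + T *s v)) \<zeta> / q (x + \<zeta> *s v))"
    unfolding power_sum_def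
  proof (rule circle_mean_cong)
    fix z assume "cmod z = r"
    then have "cdiff q (x + z *s v)" using assms rR by (auto simp: regular_fibre_def intro: holo_at_imp_cdiff)
    from DERIV_imp_deriv[OF cdiff_line[OF this]]
    show "z ^ Suc k * fd q (x + z *s v) v / q (x + z *s v) = z ^ Suc k * deriv (\<lambda>T. q (x + T *s v)) z / q (x + z *s v)"
      by simp
  qed (use r in simp)
  also have "\<dots> = (\<Sum>a\<leftarrow>fibre_zeros x. a ^ k)" by (rule power_sums_1d[OF r rR u])
  finally show ?thesis .
qed

text \<open>The number of zeros is the power sum of exponent \<open>0\<close>: continuous and integer-valued.\<close>
lemma length_fibre_zeros: "\<exists>N. \<forall>\<^sub>F x in nhds 0. length (fibre_zeros x) = N"
proof -
  have p0: "power_sum 0 x = of_nat (length (fibre_zeros x))" if "regular_fibre x" for x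
    using power_sum_fibre_zeros[OF that, of 0] by (simp add: sum_list_triv)
  have g0: "regular_fibre 0" using eventually_nhds_x_imp_x[OF eventually_regular_fibre] .
  have "\<forall>\<^sub>F x in nhds 0. dist (power_sum 0 x) (power_sum 0 0) < 1"
    using tendstoD[OF isCont_nhds[OF holo_at_isCont[OF holo_power_sum]], of 1 0] by simp
  with eventually_regular_fibre have "\<forall>\<^sub>F x in nhds 0. length (fibre_zeros x) = length (fibre_zeros 0)"
  proof eventually_elim
    case (elim x)
    then have "cmod (of_nat (length (fibre_zeros x)) - of_nat (length (fibre_zeros 0))) < 1"
      by (simp add: p0 g0 dist_norm)
    also have "of_nat (length (fibre_zeros x)) - of_nat (length (fibre_zeros 0)) =
        complex_of_real (of_int (int (length (fibre_zeros x)) - int (length (fibre_zeros 0))))" by simp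
    finally have "\<bar>of_int (int (length (fibre_zeros x)) - int (length (fibre_zeros 0)))\<bar> < (1::real)"
      by (simp only: norm_of_real)
    then show ?case by linarith
  qed
  then show ?thesis by blast
qed

text \<open>Newton's identities express the coefficients by power sums.\<close>
lemma holo_top_coeff: "holo_at (\<lambda>x. top_coeff (fibre_zeros x) k) 0"
proof (induction k rule: less_induct)
  case (less k)
  show ?case
  proof (cases k)
    case 0
    then show ?thesis by (simp add: top_coeff_0 holo_at_const)
  next
    case (Suc n)
    have "\<forall>\<^sub>F x in nhds 0. top_coeff (fibre_zeros x) k =
       - (\<Sum>i=0..n. top_coeff (fibre_zeros x) i * power_sum (Suc (n - i)) x) / of_nat (Suc n)"
      using eventually_regular_fibre
    proof eventually_elim
      case (elim x)
      show ?case using top_coeff_Suc[of n "fibre_zeros x"] unfolding Suc power_sum_fibre_zeros[OF elim]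
        by (simp add: field_simps del: of_nat_Suc)
    qed
    moreover have "holo_at (\<lambda>x. - (\<Sum>i=0..n. top_coeff (fibre_zeros x) i * power_sum (Suc (n - i)) x) / of_nat (Suc n)) 0"
      by (intro holo_at_divide holo_intros less.IH holo_power_sum) (auto simp: Suc simp del: of_nat_Suc)
    ultimately show ?thesis by (rule holo_at_congI[rotated])
  qed
qed

text \<open>The Weierstrass polynomial \<open>W\<close> of \<open>q\<close>. On each line \<open>q = W u\<close> with \<open>u\<close> free of zeros, so \<open>W/q = 1/u\<close> is
  controlled by its values on the circle, where \<open>W\<close> is bounded and \<open>q\<close> is bounded below.\<close>
lemma exists_monic:
  "\<exists>N W. admissible W \<and> degree_less (Suc N) W \<and> (\<forall>\<^sub>F x in nhds 0. coeff (W x) N = 1 \<and> (\<forall>z. poly (W x) z = 0 \<longrightarrow> cmod z \<le> r))"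
proof -
  obtain N where N: "\<forall>\<^sub>F x in nhds 0. length (fibre_zeros x) = N" using length_fibre_zeros by blast
  define W where "W x = root_poly (fibre_zeros x)" for x
  have bW: "degree_less (Suc N) W"
    unfolding degree_less_def using N by eventually_elim (auto simp: W_def root_poly_basic intro!: coeff_eq_0)
  have hW: "holo_coefficients W" unfolding holo_coefficients_def
  proof
    fix k
    show "holo_at (\<lambda>x. coeff (W x) k) 0"
    proof (cases "k \<le> N")
      case True
      have "\<forall>\<^sub>F x in nhds 0. coeff (W x) k = top_coeff (fibre_zeros x) (N - k)"
        using N by eventually_elim (use True in \<open>simp add: W_def coeff_root_poly\<close>)
      then show ?thesis by (rule holo_at_congI[OF holo_top_coeff])
    next
      case False
      have "\<forall>\<^sub>F x in nhds 0. coeff (W x) k = 0"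
        using bW[unfolded degree_less_def] by eventually_elim (use False in simp)
      then show ?thesis by (rule holo_at_congI[OF holo_at_const])
    qed
  qed
  obtain B where B: "B > 0" "\<forall>\<^sub>F x in nhds 0. \<forall>T. cmod T \<le> r \<longrightarrow> cmod (poly (W x) T) \<le> B"
    using holo_coefficients_bounded[OF hW bW less_imp_le[OF r]] by blast
  obtain m where m: "m > 0" "\<forall>\<^sub>F x in nhds 0. \<forall>T. r \<le> cmod T \<longrightarrow> cmod T \<le> r \<longrightarrow> m \<le> cmod (q (x + T *s v))"
    using q_lower[OF r order_refl] by blast
  have Wq: "\<forall>\<^sub>F x in nhds 0. \<forall>T. cmod T \<le> r \<longrightarrow> cmod (poly (W x) T) \<le> B / m * cmod (q (x + T *s v))"
    using B(2) m(2) eventually_regular_fibre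
  proof eventually_elim
    case (elim x)
    obtain u where u: "u holomorphic_on ball 0 R" "\<And>z. z \<in> cball 0 r \<Longrightarrow> u z \<noteq> 0" "set (fibre_zeros x) \<subseteq> ball 0 r"
      "\<And>z. z \<in> ball 0 R \<Longrightarrow> q (x + z *s v) = (\<Prod>a\<leftarrow>fibre_zeros x. z - a) * u z" using fibre_zeros[OF elim(3)] by blast
    have qW: "q (x + z *s v) = poly (W x) z * u z" if "cmod z \<le> r" for z
      using u(4)[of z] that rR by (simp add: W_def root_poly_basic)
    show ?case
    proof (intro allI impI)
      fix T assume T: "cmod T \<le> r"
      have "cmod 1 \<le> B / m * cmod (u T)"
      proof (rule quotient_1d_bound[OF r rR _ u(1) _ _ _ T, of "\<lambda>_. 1"])
        fix z assume z: "cmod z = r"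
        have "m \<le> cmod (poly (W x) z) * cmod (u z)" using elim(2)[rule_format, of z] z qW[of z] by (simp add: norm_mult)
        also have "\<dots> \<le> B * cmod (u z)" using elim(1) z by (intro mult_right_mono) auto
        finally show "cmod 1 \<le> B / m * cmod (u z)" using m(1) by (simp add: field_simps)
        show "u z \<noteq> 0" using u(2)[of z] z by simp
      next
        fix z assume "cmod z < r" "u z = 0"
        then show "(\<lambda>w. 1 / u w) \<in> O[at z](\<lambda>_. 1)" using u(2)[of z] by simp
      qed (intro holomorphic_intros)
      then have "cmod (poly (W x) T) * 1 \<le> cmod (poly (W x) T) * (B / m * cmod (u T))"
        by (intro mult_left_mono) auto
      then show "cmod (poly (W x) T) \<le> B / m * cmod (q (x + T *s v))"
        using qW[OF T] by (simp add: norm_mult mult_ac)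
    qed
  qed
  have "\<exists>M. \<forall>\<^sub>F x in nhds 0. \<forall>T. cmod T \<le> r \<longrightarrow> cmod (poly (W x) T * p (x + T *s v)) \<le> M * cmod (q (x + T *s v))"
    if p: "p \<in> S" for p
  proof -
    obtain C where C: "C > 0" "\<forall>\<^sub>F x in nhds 0. \<forall>T. cmod T \<le> r \<longrightarrow> cmod (p (x + T *s v)) \<le> C"
      using p_upper[of p] p by blast
    show ?thesis
    proof (rule exI[of _ "B / m * C"], use Wq C(2) in eventually_elim, intro allI impI)
      fix x T assume a: "\<forall>T. cmod T \<le> r \<longrightarrow> cmod (poly (W x) T) \<le> B / m * cmod (q (x + T *s v))"
        "\<forall>T. cmod T \<le> r \<longrightarrow> cmod (p (x + T *s v)) \<le> C" "cmod T \<le> r"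
      have "cmod (poly (W x) T * p (x + T *s v)) \<le> (B / m * cmod (q (x + T *s v))) * C"
        unfolding norm_mult using a B(1) m(1) by (intro mult_mono) auto
      then show "cmod (poly (W x) T * p (x + T *s v)) \<le> B / m * C * cmod (q (x + T *s v))" by (simp add: mult_ac)
    qed
  qed
  then have "admissible W" unfolding admissible_def using hW bW by blast
  moreover have "\<forall>\<^sub>F x in nhds 0. coeff (W x) N = 1 \<and> (\<forall>z. poly (W x) z = 0 \<longrightarrow> cmod z \<le> r)"
    using N eventually_regular_fibre
  proof eventually_elim
    case (elim x)
    have "set (fibre_zeros x) \<subseteq> ball 0 r" using fibre_zeros[OF elim(2)] by blast
    then show ?case using elim(1) by (auto simp: W_def root_poly_basic prod_list_zero_iff intro: less_imp_le)
  qed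
  ultimately show ?thesis using bW by blast
qed

text \<open>One step of pseudo-division of \<open>P\<close> by \<open>s\<close>, where \<open>c\<close> and \<open>l\<close> are the leading coefficients of \<open>s\<close> and \<open>P\<close>.\<close>
lemma admissible_step:
  assumes "admissible P" "admissible s" "holo_at c 0" "holo_at l 0"
  shows "admissible (\<lambda>x. smult (c x) (P x) - monom (l x) j * s x)"
  unfolding admissible_def
proof (intro conjI ballI)
  show "holo_coefficients (\<lambda>x. smult (c x) (P x) - monom (l x) j * s x)"
    unfolding holo_coefficients_def
  proof
    fix k
    have "holo_at (\<lambda>x. coeff (P x) k) 0" "holo_at (\<lambda>x. coeff (s x) (k - j)) 0"
      using assms(1,2) unfolding admissible_def holo_coefficients_def by blast+
    then show "holo_at (\<lambda>x. coeff (smult (c x) (P x) - monom (l x) j * s x) k) 0"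
      by (cases "k < j") (auto simp: coeff_monom_mult intro!: holo_intros assms)
  qed
  obtain m m' where "degree_less m P" "degree_less m' s" using assms(1,2) unfolding admissible_def by blast
  then have "degree_less (m + m' + j) (\<lambda>x. smult (c x) (P x) - monom (l x) j * s x)"
    unfolding degree_less_def by eventually_elim (auto simp: coeff_monom_mult)
  then show "\<exists>m. degree_less m (\<lambda>x. smult (c x) (P x) - monom (l x) j * s x)" by blast
  fix p assume "p \<in> S"
  then obtain M M' where M:
    "\<forall>\<^sub>F x in nhds 0. \<forall>T. cmod T \<le> r \<longrightarrow> cmod (poly (P x) T * p (x + T *s v)) \<le> M * cmod (q (x + T *s v))"
    "\<forall>\<^sub>F x in nhds 0. \<forall>T. cmod T \<le> r \<longrightarrow> cmod (poly (s x) T * p (x + T *s v)) \<le> M' * cmod (q (x + T *s v))"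
    using assms(1,2) unfolding admissible_def by blast
  let ?C = "cmod (c 0) + 1" and ?L = "(cmod (l 0) + 1) * r ^ j"
  show "\<exists>M. \<forall>\<^sub>F x in nhds 0. \<forall>T. cmod T \<le> r \<longrightarrow>
     cmod (poly (smult (c x) (P x) - monom (l x) j * s x) T * p (x + T *s v)) \<le> M * cmod (q (x + T *s v))"
  proof (rule exI[of _ "?C * \<bar>M\<bar> + ?L * \<bar>M'\<bar>"], use M eventually_bounded_germ[OF holo_at_isCont[OF assms(3)]]
      eventually_bounded_germ[OF holo_at_isCont[OF assms(4)]] in eventually_elim, intro allI impI)
    fix x T
    let ?q = "cmod (q (x + T *s v))" and ?p = "p (x + T *s v)"
    assume a: "\<forall>T. cmod T \<le> r \<longrightarrow> cmod (poly (P x) T * p (x + T *s v)) \<le> M * cmod (q (x + T *s v))"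
      "\<forall>T. cmod T \<le> r \<longrightarrow> cmod (poly (s x) T * p (x + T *s v)) \<le> M' * cmod (q (x + T *s v))"
      "cmod (c x) < cmod (c 0) + 1" "cmod (l x) < cmod (l 0) + 1" and T: "cmod T \<le> r"
    have 1: "cmod (poly (P x) T * ?p) \<le> \<bar>M\<bar> * ?q" using a(1) T
      by (meson abs_ge_self mult_right_mono norm_ge_zero order_trans)
    have 2: "cmod (poly (s x) T * ?p) \<le> \<bar>M'\<bar> * ?q" using a(2) T
      by (meson abs_ge_self mult_right_mono norm_ge_zero order_trans)
    have "poly (smult (c x) (P x) - monom (l x) j * s x) T * ?p
       = c x * (poly (P x) T * ?p) - (l x * T ^ j) * (poly (s x) T * ?p)"
      by (simp add: poly_monom algebra_simps)
    also have "cmod \<dots> \<le> cmod (c x) * cmod (poly (P x) T * ?p) + (cmod (l x) * cmod T ^ j) * cmod (poly (s x) T * ?p)"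
      by (rule order_trans[OF norm_triangle_ineq4]) (simp add: norm_mult norm_power)
    also have "\<dots> \<le> ?C * (\<bar>M\<bar> * ?q) + ?L * (\<bar>M'\<bar> * ?q)"
      using a(3,4) T 1 2 r by (intro add_mono mult_mono power_mono) auto
    finally show "cmod (poly (smult (c x) (P x) - monom (l x) j * s x) T * ?p) \<le> (?C * \<bar>M\<bar> + ?L * \<bar>M'\<bar>) * ?q"
      by (simp add: algebra_simps)
  qed
qed

text \<open>The polynomial of \<open>exists_monic\<close> makes the set of possible degrees non-empty. The degree \<open>e\<close> of the minimal one
  is generic: its leading coefficient is a non-zero germ, but may vanish at some points.\<close>
lemma minimal_element:
  "\<exists>s e. admissible s \<and> degree_less (Suc e) s \<and> \<not> zero_germ (\<lambda>x. coeff (s x) e) \<and>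
     (\<forall>P. admissible P \<longrightarrow> degree_less e P \<longrightarrow> (\<forall>\<^sub>F x in nhds 0. P x = 0))"
proof -
  define Q where "Q m \<longleftrightarrow> (\<exists>P. admissible P \<and> degree_less m P \<and> \<not> (\<forall>\<^sub>F x in nhds 0. P x = 0))" for m
  obtain N W where W: "admissible W" "degree_less (Suc N) W"
    "\<forall>\<^sub>F x in nhds 0. coeff (W x) N = 1 \<and> (\<forall>z. poly (W x) z = 0 \<longrightarrow> cmod z \<le> r)"
    using exists_monic by blast
  have "\<not> (\<forall>\<^sub>F x in nhds 0. W x = 0)"
  proof
    assume "\<forall>\<^sub>F x in nhds 0. W x = 0"
    from eventually_nhds_x_imp_x[OF eventually_conj[OF this W(3)]] show False by auto
  qed
  then have "Q (Suc N)" unfolding Q_def using W by blast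
  define m where "m = (LEAST m. Q m)"
  have Qm: "Q m" unfolding m_def using \<open>Q (Suc N)\<close> by (rule LeastI)
  have min: "\<not> Q k" if "k < m" for k using that unfolding m_def by (rule not_less_Least)
  have "\<not> Q 0"
  proof
    assume "Q 0"
    then obtain P where "admissible P" and P: "degree_less 0 P" "\<not> (\<forall>\<^sub>F x in nhds 0. P x = 0)" unfolding Q_def by blast
    from P(1) have "\<forall>\<^sub>F x in nhds 0. P x = 0" unfolding degree_less_def by eventually_elim (auto intro: poly_eqI)
    with P(2) show False by blast
  qed
  then have "m \<noteq> 0" using Qm by metis
  then obtain e where e: "m = Suc e" by (cases m) auto
  obtain s where s: "admissible s" "degree_less (Suc e) s" "\<not> (\<forall>\<^sub>F x in nhds 0. s x = 0)" using Qm unfolding Q_def e by blast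
  have min: "\<forall>\<^sub>F x in nhds 0. P x = 0" if "admissible P" "degree_less e P" for P using min[of e] that unfolding Q_def e by blast
  have "\<not> zero_germ (\<lambda>x. coeff (s x) e)"
  proof
    assume "zero_germ (\<lambda>x. coeff (s x) e)"
    with s(2) have "degree_less e s" unfolding degree_less_def zero_germ_def
      by eventually_elim (metis Suc_leI le_neq_implies_less)
    with s min show False by blast
  qed
  with s min show ?thesis by blast
qed

text \<open>Division by \<open>s\<close> without inverting its leading coefficient. Each remainder is admissible, so the last
  one is zero by minimality.\<close>
lemma pseudo_division:
  assumes "admissible s" "degree_less (Suc e) s" and min: "\<And>P. admissible P \<Longrightarrow> degree_less e P \<Longrightarrow> \<forall>\<^sub>F x in nhds 0. P x = 0"
    and "admissible P" "degree_less m P"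
  shows "\<exists>k t. \<forall>\<^sub>F x in nhds 0. smult (coeff (s x) e ^ k) (P x) = s x * t x"
  using assms(4,5)
proof (induction m arbitrary: P)
  case 0
  then have "degree_less e P" unfolding degree_less_def by (auto elim: eventually_mono)
  from min[OF 0(1) this] have "\<forall>\<^sub>F x in nhds 0. smult (coeff (s x) e ^ 0) (P x) = s x * 0"
    by eventually_elim simp
  then show ?case by (intro exI[of _ 0] exI[of _ "\<lambda>_. 0"])
next
  case (Suc m P)
  show ?case
  proof (cases "Suc m \<le> e")
    case True
    then have "degree_less e P" using Suc.prems(2) unfolding degree_less_def by (auto elim: eventually_mono)
    from min[OF Suc.prems(1) this] have "\<forall>\<^sub>F x in nhds 0. smult (coeff (s x) e ^ 0) (P x) = s x * 0"
      by eventually_elim simp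
    then show ?thesis by (intro exI[of _ 0] exI[of _ "\<lambda>_. 0"])
  next
    case False
    define P' where "P' x = smult (coeff (s x) e) (P x) - monom (coeff (P x) m) (m - e) * s x" for x
    have h: "holo_at (\<lambda>x. coeff (s x) e) 0" "holo_at (\<lambda>x. coeff (P x) m) 0"
      using assms(1) Suc.prems(1) unfolding admissible_def holo_coefficients_def by blast+
    have "admissible P'" unfolding P'_def by (rule admissible_step[OF Suc.prems(1) assms(1) h])
    moreover have "degree_less m P'"
      using Suc.prems(2) assms(2) unfolding degree_less_def
    proof eventually_elim
      case (elim x)
      show ?case
      proof (intro allI impI)
        fix k assume k: "m \<le> k"
        show "coeff (P' x) k = 0"
          using elim k False by (cases "k = m") (auto simp: P'_def coeff_monom_mult)
      qed
    qed
    ultimately obtain k t where "\<forall>\<^sub>F x in nhds 0. smult (coeff (s x) e ^ k) (P' x) = s x * t x"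
      using Suc.IH by blast
    then have "\<forall>\<^sub>F x in nhds 0. smult (coeff (s x) e ^ Suc k) (P x) =
        s x * (t x + smult (coeff (s x) e ^ k) (monom (coeff (P x) m) (m - e)))"
    proof eventually_elim
      case (elim x)
      have "smult (coeff (s x) e) (P x) = P' x + monom (coeff (P x) m) (m - e) * s x"
        by (simp add: P'_def)
      then have "smult (coeff (s x) e ^ Suc k) (P x) =
          smult (coeff (s x) e ^ k) (P' x) + smult (coeff (s x) e ^ k) (monom (coeff (P x) m) (m - e) * s x)"
        by (metis power_Suc2 smult_add_right smult_smult)
      then show ?case unfolding elim by (simp add: algebra_simps)
    qed
    then show ?thesis by (intro exI)
  qed
qed

text \<open>By pseudo-division the polynomial \<open>s\<close> of least degree divides \<open>c\<^sup>k W\<close>, with \<open>c\<close> its leading coefficient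
  and \<open>W\<close> the Weierstrass polynomial. Where \<open>c \<noteq> 0\<close> its roots are roots of \<open>W\<close> and lie in the disc, hence
  its coefficients are bounded by a constant times \<open>|c|\<close>. By density this bound holds everywhere, and \<open>c\<close>
  divides each coefficient. The quotient \<open>D = s/c\<close> is again admissible: its bounds on the circle \<open>|T| = r\<close>
  extend inside by the maximum principle.\<close>
lemma monic_generator:
  "\<exists>D e. admissible D \<and> degree_less (Suc e) D \<and> (\<forall>\<^sub>F x in nhds 0. coeff (D x) e = 1) \<and>
     (\<forall>P. admissible P \<longrightarrow> degree_less e P \<longrightarrow> (\<forall>\<^sub>F x in nhds 0. P x = 0))"
proof -
  obtain s e where s: "admissible s" "degree_less (Suc e) s" "\<not> zero_germ (\<lambda>x. coeff (s x) e)"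
    and min: "\<And>P. admissible P \<Longrightarrow> degree_less e P \<Longrightarrow> \<forall>\<^sub>F x in nhds 0. P x = 0"
    using minimal_element by blast
  define c where "c x = coeff (s x) e" for x
  have hs: "holo_at (\<lambda>x. coeff (s x) k) 0" for k using s(1) unfolding admissible_def holo_coefficients_def by blast
  have hc: "holo_at c 0" and nc: "\<not> zero_germ c" unfolding c_def using hs s(3) by auto
  obtain N W where W: "admissible W" "degree_less (Suc N) W"
    "\<forall>\<^sub>F x in nhds 0. coeff (W x) N = 1 \<and> (\<forall>z. poly (W x) z = 0 \<longrightarrow> cmod z \<le> r)"
    using exists_monic by blast
  obtain k t where kt: "\<forall>\<^sub>F x in nhds 0. smult (c x ^ k) (W x) = s x * t x"
    using pseudo_division[OF s(1,2) min W(1,2)] unfolding c_def by blast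
  have roots: "\<forall>\<^sub>F x in nhds 0. c x \<noteq> 0 \<longrightarrow> (\<forall>j. cmod (coeff (s x) j) \<le> (1 + r) ^ e * cmod (c x))"
    using kt W(3) s(2)[unfolded degree_less_def]
  proof eventually_elim
    case (elim x)
    show ?case
    proof (intro impI allI)
      fix j assume c: "c x \<noteq> 0"
      define p where "p = smult (1 / c x) (s x)"
      have "degree p = e"
      proof (rule antisym)
        show "degree p \<le> e" using elim(3) by (intro degree_le) (auto simp: p_def)
        show "e \<le> degree p" using c by (intro le_degree) (simp add: p_def c_def)
      qed
      moreover from this have "lead_coeff p = 1" using c by (simp add: p_def c_def)
      moreover have "cmod z \<le> r" if "poly p z = 0" for z
      proof -
        have "poly (s x) z = 0" using that c by (simp add: p_def)
        then have "poly (smult (c x ^ k) (W x)) z = 0" unfolding elim(1) by simp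
        then show ?thesis using elim(2) c by simp
      qed
      ultimately have "cmod (coeff p j) \<le> (1 + r) ^ e" using r by (intro monic_coeff_bound) auto
      then show "cmod (coeff (s x) j) \<le> (1 + r) ^ e * cmod (c x)"
        using c by (simp add: p_def norm_divide divide_le_eq)
    qed
  qed
  have "germ_dvd c (\<lambda>x. coeff (s x) j)" for j
  proof (rule germ_dvd_if_bounded[OF hs hc nc])
    show "\<forall>\<^sub>F x in nhds 0. cmod (coeff (s x) j) \<le> (1 + r) ^ e * cmod (c x)"
      using nonzero_dense_on[OF hc nc roots] holo_at_eventually[OF hc] holo_at_eventually[OF hs[of j]]
    proof eventually_elim
      case (elim x)
      show ?case
      proof (rule dense_le[where F = "\<lambda>x. cmod (coeff (s x) j)" and G = "\<lambda>x. (1 + r) ^ e * cmod (c x)"])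
        show "isCont (\<lambda>x. cmod (coeff (s x) j)) x" "isCont (\<lambda>x. (1 + r) ^ e * cmod (c x)) x"
          using elim(2,3) by (auto intro!: continuous_intros holo_at_isCont)
        show "\<exists>\<^sub>F y in nhds x. cmod (coeff (s y) j) \<le> (1 + r) ^ e * cmod (c y)"
          using elim(1) by (rule frequently_elim1) blast
      qed
    qed
  qed
  then have "\<forall>j. \<exists>dj. holo_at dj 0 \<and> (\<forall>\<^sub>F x in nhds 0. coeff (s x) j = dj x * c x)"
    unfolding germ_dvd_def by blast
  from choice[OF this] obtain d where d: "\<And>j. holo_at (d j) 0" "\<And>j. \<forall>\<^sub>F x in nhds 0. coeff (s x) j = d j x * c x"
    by blast
  define D where "D x = (\<Sum>j<e. monom (d j x) j) + monom 1 e" for x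
  have cD: "coeff (D x) j = (if j < e then d j x else if j = e then 1 else 0)" for x j
    by (auto simp: D_def coeff_sum)
  have pD: "poly (D x) T = (\<Sum>j<e. d j x * T ^ j) + T ^ e" for x T
    by (simp add: D_def poly_sum poly_monom)
  have hD: "holo_coefficients D" unfolding holo_coefficients_def cD
  proof
    fix j show "holo_at (\<lambda>x. if j < e then d j x else if j = e then 1 else 0) 0"
      by (cases "j < e"; cases "j = e") (auto intro: holo_intros d)
  qed
  have bD: "degree_less (Suc e) D" unfolding degree_less_def cD by simp
  have sD: "\<forall>\<^sub>F x in nhds 0. s x = smult (c x) (D x)"
  proof -
    have "\<forall>\<^sub>F x in nhds 0. \<forall>j\<in>{..<e}. coeff (s x) j = d j x * c x"
      by (rule eventually_ball_finite) (use d in auto)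
    with s(2)[unfolded degree_less_def] show ?thesis
    proof eventually_elim
      case (elim x)
      show ?case
        by (rule poly_eqI) (use elim in \<open>auto simp: cD c_def\<close>)
    qed
  qed
  obtain B where B: "B > 0" "\<forall>\<^sub>F x in nhds 0. \<forall>T. cmod T \<le> r \<longrightarrow> cmod (poly (D x) T) \<le> B"
    using holo_coefficients_bounded[OF hD bD less_imp_le[OF r]] by blast
  obtain m where m: "m > 0" "\<forall>\<^sub>F x in nhds 0. \<forall>T. r \<le> cmod T \<longrightarrow> cmod T \<le> r \<longrightarrow> m \<le> cmod (q (x + T *s v))"
    using q_lower[OF r order_refl] by blast
  have "\<exists>M. \<forall>\<^sub>F x in nhds 0. \<forall>T. cmod T \<le> r \<longrightarrow> cmod (poly (D x) T * p (x + T *s v)) \<le> M * cmod (q (x + T *s v))"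
    if p: "p \<in> S" for p
  proof -
    obtain C where C: "C > 0" "\<forall>\<^sub>F x in nhds 0. \<forall>T. cmod T \<le> r \<longrightarrow> cmod (p (x + T *s v)) \<le> C"
      using p_upper[of p] p by blast
    obtain Ms where Ms: "\<forall>\<^sub>F x in nhds 0. \<forall>T. cmod T \<le> r \<longrightarrow> cmod (poly (s x) T * p (x + T *s v)) \<le> Ms * cmod (q (x + T *s v))"
      using s(1) p unfolding admissible_def by blast
    \<comment> \<open>On the circle \<open>|D| \<le> B\<close>, \<open>|p| \<le> C\<close> and \<open>|q| \<ge> m\<close>. This constant does not involve \<open>c\<close>, in contrast to
      the bound for \<open>D p/q\<close> that comes from \<open>s = c D\<close>; the latter serves only to remove singularities.\<close>
    define M where "M = B * C / m"
    have gen: "\<forall>\<^sub>F x in nhds 0. c x \<noteq> 0 \<longrightarrow> (\<forall>T. cmod T \<le> r \<longrightarrow> cmod (poly (D x) T * p (x + T *s v)) \<le> M * cmod (q (x + T *s v)))"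
      using B(2) m(2) C(2) Ms sD hol
    proof eventually_elim
      case (elim x)
      show ?case
      proof (intro impI allI)
        fix T assume c: "c x \<noteq> 0" and T: "cmod T \<le> r"
        show "cmod (poly (D x) T * p (x + T *s v)) \<le> M * cmod (q (x + T *s v))"
        proof (rule quotient_1d_bound[OF r rR _ _ _ _ _ T, of "\<lambda>T. poly (D x) T * p (x + T *s v)"])
          show "(\<lambda>T. poly (D x) T * p (x + T *s v)) holomorphic_on ball 0 R" "(\<lambda>T. q (x + T *s v)) holomorphic_on ball 0 R"
            using elim(6) p by (auto intro!: holomorphic_intros line_holomorphic holo_at_imp_cdiff)
          fix z assume z: "cmod z = r"
          then have mz: "m \<le> cmod (q (x + z *s v))" using elim(2) by simp
          then show "q (x + z *s v) \<noteq> 0" using m(1) by auto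
          have "cmod (poly (D x) z * p (x + z *s v)) \<le> B * C"
            unfolding norm_mult using elim(1,3) z B(1) by (intro mult_mono) auto
          also have "\<dots> = M * m" using m(1) by (simp add: M_def)
          also have "\<dots> \<le> M * cmod (q (x + z *s v))"
            using mz B(1) C(1) m(1) by (intro mult_left_mono) (auto simp: M_def)
          finally show "cmod (poly (D x) z * p (x + z *s v)) \<le> M * cmod (q (x + z *s v))" .
        next
          fix z assume z: "cmod z < r"
          have "\<forall>\<^sub>F w in nhds z. w \<in> ball 0 r" by (rule eventually_nhds_in_open) (use z in auto)
          then have "\<forall>\<^sub>F w in at z. w \<in> ball 0 r" unfolding eventually_at_filter by eventually_elim simp
          then show "(\<lambda>w. poly (D x) w * p (x + w *s v) / q (x + w *s v)) \<in> O[at z](\<lambda>_. 1)"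
          proof (intro landau_o.bigI[of "(\<bar>Ms\<bar> + 1) / cmod (c x)"], goal_cases)
            case 1
            then show ?case using c by (simp add: add_nonneg_pos)
          next
            case 2
            then show ?case
            proof eventually_elim
              case (elim w)
              have sw: "poly (s x) w = c x * poly (D x) w" using \<open>s x = smult (c x) (D x)\<close> by simp
              have "cmod (poly (s x) w * p (x + w *s v)) \<le> Ms * cmod (q (x + w *s v))"
                using elim \<open>\<forall>T. cmod T \<le> r \<longrightarrow> cmod (poly (s x) T * p (x + T *s v)) \<le> Ms * cmod (q (x + T *s v))\<close> by simp
              also have "\<dots> \<le> (\<bar>Ms\<bar> + 1) * cmod (q (x + w *s v))" by (intro mult_right_mono) auto
              finally have "cmod (c x) * cmod (poly (D x) w * p (x + w *s v)) \<le> (\<bar>Ms\<bar> + 1) * cmod (q (x + w *s v))"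
                unfolding sw norm_mult by (simp add: mult_ac)
              then have le: "cmod (poly (D x) w * p (x + w *s v)) \<le> (\<bar>Ms\<bar> + 1) / cmod (c x) * cmod (q (x + w *s v))"
                using c by (simp add: field_simps)
              show ?case
              proof (cases "q (x + w *s v) = 0")
                case True
                then show ?thesis by (simp add: divide_nonneg_nonneg)
              next
                case False
                then show ?thesis using le by (simp add: norm_divide pos_divide_le_eq)
              qed
            qed
          qed
        qed
      qed
    qed
    have hd: "\<forall>\<^sub>F x in nhds 0. \<forall>j\<in>{..<e}. holo_at (d j) x"
      by (rule eventually_ball_finite) (use d in \<open>auto intro: holo_at_eventually\<close>)
    have "\<forall>\<^sub>F x in nhds 0. \<forall>T. cmod T \<le> r \<longrightarrow> cmod (poly (D x) T * p (x + T *s v)) \<le> M * cmod (q (x + T *s v))"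
      using nonzero_dense_on[OF hc nc gen] hol hd
    proof eventually_elim
      case (elim x)
      show ?case
      proof (intro allI impI)
        fix T assume T: "cmod T \<le> r"
        then have hp: "holo_at (\<lambda>y. p (y + T *s v)) x" "holo_at (\<lambda>y. q (y + T *s v)) x"
          using elim(2) p rR by (auto intro!: holo_at_along_line)
        have hDT: "holo_at (\<lambda>y. poly (D y) T) x"
          unfolding pD using elim(3) by (intro holo_intros) auto
        show "cmod (poly (D x) T * p (x + T *s v)) \<le> M * cmod (q (x + T *s v))"
        proof (rule dense_le[where F = "\<lambda>x. cmod (poly (D x) T * p (x + T *s v))" and G = "\<lambda>x. M * cmod (q (x + T *s v))"])
          show "isCont (\<lambda>x. cmod (poly (D x) T * p (x + T *s v))) x" "isCont (\<lambda>x. M * cmod (q (x + T *s v))) x"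
            using hp by (auto intro!: continuous_norm continuous_mult holo_at_isCont holo_at_mult[OF hDT])
          show "\<exists>\<^sub>F y in nhds x. cmod (poly (D y) T * p (y + T *s v)) \<le> M * cmod (q (y + T *s v))"
            using elim(1) by (rule frequently_elim1) (use T in blast)
        qed
      qed
    qed
    then show ?thesis by blast
  qed
  then have "admissible D" unfolding admissible_def using hD bD by blast
  then show ?thesis using bD min by (intro exI[of _ D] exI[of _ e]) (auto simp: cD)
qed

end

section \<open>Weierstrass division and ideals of denominators\<close>

text \<open>The divided difference of a polynomial, arranged by powers of \<open>T\<close>. It splits \<open>1/(\<zeta> - T)\<close> in
  Weierstrass division into a multiple of the divisor and a polynomial of degree less than \<open>e\<close>.\<close>
lemma divided_difference:
  fixes c :: "nat \<Rightarrow> complex"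
  shows "(\<Sum>k\<le>e. c k * \<zeta> ^ k) - (\<Sum>k\<le>e. c k * T ^ k)
    = (\<zeta> - T) * (\<Sum>i<e. T ^ i * (\<Sum>k=Suc i..e. c k * \<zeta> ^ (k - Suc i)))"
proof -
  have "(\<Sum>k\<le>e. c k * \<zeta> ^ k) - (\<Sum>k\<le>e. c k * T ^ k) = - (\<Sum>k\<le>e. c k * (T ^ k - \<zeta> ^ k))"
    by (simp add: sum_subtractf right_diff_distrib)
  also have "\<dots> = (\<zeta> - T) * (\<Sum>k\<le>e. \<Sum>i<k. T ^ i * (c k * \<zeta> ^ (k - Suc i)))"
    unfolding power_diff_sumr2[of T] sum_distrib_left sum_negf[symmetric]
    by (intro sum.cong refl) (simp add: algebra_simps)
  also have "(\<Sum>k\<le>e. \<Sum>i<k. T ^ i * (c k * \<zeta> ^ (k - Suc i))) = (\<Sum>i<e. \<Sum>k=Suc i..e. T ^ i * (c k * \<zeta> ^ (k - Suc i)))"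
    by (rule sum.nested_swap')
  finally show ?thesis by (simp add: sum_distrib_left)
qed

context weierstrass_setup
begin

lemma admissible_value:
  assumes "admissible D" "p \<in> S"
  shows "germ_dvd q (\<lambda>x. coeff (D x) 0 * p x)"
proof -
  obtain M where M: "\<forall>\<^sub>F x in nhds 0. \<forall>T. cmod T \<le> r \<longrightarrow> cmod (poly (D x) T * p (x + T *s v)) \<le> M * cmod (q (x + T *s v))"
    using assms unfolding admissible_def by blast
  show ?thesis
  proof (rule germ_dvd_if_bounded)
    show "holo_at (\<lambda>x. coeff (D x) 0 * p x) 0"
      using assms hol_germ by (intro holo_at_mult) (auto simp: admissible_def holo_coefficients_def)
    show "holo_at q 0" using hol_germ by blast
    show "\<not> zero_germ q" by (rule nonzero_q)
    show "\<forall>\<^sub>F x in nhds 0. cmod (coeff (D x) 0 * p x) \<le> M * cmod (q x)"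
      using M
    proof eventually_elim
      case (elim x)
      from elim[rule_format, of 0] r show ?case by (simp add: poly_0_coeff_0)
    qed
  qed
qed

text \<open>Weierstrass division of \<open>a(x + T v)\<close> by \<open>D\<close>. In Cauchy's formula for \<open>a\<close> on a circle where \<open>D\<close> has no
  zeros, write \<open>D(\<zeta>) = D(T) + (\<zeta> - T) Q(\<zeta>, T)\<close>; this gives \<open>a = b D + Rem\<close> with \<open>Rem\<close> of degree less than
  \<open>e\<close> in \<open>T\<close>. As \<open>a p/q\<close> is holomorphic and \<open>D\<close> is admissible, \<open>Rem\<close> is admissible, hence zero by minimality,
  and \<open>T = 0\<close> yields \<open>a(x) = b(x) D(x, 0)\<close> with \<open>b\<close> bounded.\<close>
lemma division_bound:
  assumes D: "admissible D" "degree_less (Suc e) D" "\<forall>\<^sub>F x in nhds 0. coeff (D x) e = 1"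
    and min: "\<And>P. admissible P \<Longrightarrow> degree_less e P \<Longrightarrow> \<forall>\<^sub>F x in nhds 0. P x = 0"
    and a: "holo_at a 0" "\<And>p. p \<in> S \<Longrightarrow> germ_dvd q (\<lambda>x. a x * p x)"
  shows "\<exists>B. \<forall>\<^sub>F x in nhds 0. cmod (a x) \<le> B * cmod (coeff (D x) 0)"
proof -
  have hD: "holo_at (\<lambda>x. coeff (D x) k) 0" for k using D(1) by (auto simp: admissible_def holo_coefficients_def)
  define pD where "pD x T = (\<Sum>k\<le>e. coeff (D x) k * T ^ k)" for x T
  have pD: "\<forall>\<^sub>F x in nhds 0. \<forall>T. poly (D x) T = pD x T"
    using D(2)[unfolded degree_less_def]
    by eventually_elim (unfold pD_def lessThan_Suc_atMost[symmetric], auto intro: poly_below simp del: sum.lessThan_Suc)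
  have "\<forall>p\<in>S. \<exists>k. holo_at k 0 \<and> (\<forall>\<^sub>F x in nhds 0. a x * p x = k x * q x)"
    using a(2) unfolding germ_dvd_def by blast
  from bchoice[OF this] obtain k where k: "\<And>p. p \<in> S \<Longrightarrow> holo_at (k p) 0"
    "\<And>p. p \<in> S \<Longrightarrow> \<forall>\<^sub>F x in nhds 0. a x * p x = k p x * q x" by blast
  define K where "K p = cmod (k p 0) + 1" for p
  define A where "A = cmod (a 0) + 1"
  have "\<forall>\<^sub>F x in nhds 0. \<forall>p\<in>S. a x * p x = k p x * q x \<and> cmod (k p x) < K p"
    by (rule eventually_ball_finite[OF finS])
       (auto intro!: eventually_conj k eventually_bounded_germ holo_at_isCont simp: K_def)
  then have "\<forall>\<^sub>F x in nhds 0. holo_at a x \<and> cmod (a x) < A \<and> (\<forall>p\<in>S. a x * p x = k p x * q x \<and> cmod (k p x) < K p)"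
    using holo_at_eventually[OF a(1)] eventually_bounded_germ[OF holo_at_isCont[OF a(1)]]
    unfolding A_def by eventually_elim blast
  from line_eventually[OF this, of v] obtain r2 where r2: "0 < r2"
    "\<forall>\<^sub>F x in nhds 0. \<forall>T. cmod T \<le> r2 \<longrightarrow> holo_at a (x + T *s v) \<and> cmod (a (x + T *s v)) < A \<and>
      (\<forall>p\<in>S. a (x + T *s v) * p (x + T *s v) = k p (x + T *s v) * q (x + T *s v) \<and> cmod (k p (x + T *s v)) < K p)"
    by blast
  have D0: "D 0 \<noteq> 0" using eventually_nhds_x_imp_x[OF D(3)] by auto
  \<comment> \<open>The circle of integration has to lie where \<open>a\<close> is controlled and must avoid the zeros of \<open>D\<close> at \<open>x = 0\<close>;
    finitely many moduli are excluded.\<close>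
  have "infinite ({0<..<min r r2} - cmod ` {z. poly (D 0) z = 0})"
    using r r2(1) poly_roots_finite[OF D0] by (intro Diff_infinite_finite infinite_Ioo) auto
  then obtain r1 where "r1 \<in> {0<..<min r r2} - cmod ` {z. poly (D 0) z = 0}"
    by (meson finite.emptyI finite_subset subset_eq ex_in_conv)
  then have r1: "0 < r1" "r1 < r" "r1 < r2" and D0z: "\<And>z. cmod z = r1 \<Longrightarrow> poly (D 0) z \<noteq> 0" by auto
  have "continuous_on (sphere 0 r1) (\<lambda>z. cmod (poly (D 0) z))" by (intro continuous_intros)
  moreover have "sphere 0 r1 \<noteq> ({} :: complex set)" using r1(1) by simp
  ultimately obtain z0 where z0: "z0 \<in> sphere 0 r1" "\<And>z. z \<in> sphere 0 r1 \<Longrightarrow> cmod (poly (D 0) z0) \<le> cmod (poly (D 0) z)"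
    using continuous_attains_inf[OF compact_sphere] by blast
  define m where "m = cmod (poly (D 0) z0) / 2"
  have m: "m > 0" using D0z z0(1) by (simp add: m_def)
  have pD0: "poly (D 0) T = pD 0 T" for T using eventually_nhds_x_imp_x[OF pD] by blast
  have contD: "isCont (\<lambda>z. pD (fst z) (snd z)) (0, T)" for T
  proof -
    have "isCont (\<lambda>z. coeff (D (fst z)) k) (0, T)" for k
      by (rule isCont_o2[where g = "\<lambda>x. coeff (D x) k"]) (use holo_at_isCont[OF hD] in \<open>auto intro!: continuous_intros\<close>)
    then show ?thesis unfolding pD_def by (intro continuous_sum continuous_mult continuous_power continuous_snd continuous_ident)
  qed
  have "\<forall>\<^sub>F x in nhds 0. \<forall>T\<in>sphere 0 r1. m < cmod (pD (fst (x, T)) (snd (x, T)))"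
  proof (rule eventually_near_compact)
    fix T :: complex assume T: "T \<in> sphere 0 r1"
    show "isCont (\<lambda>z. cmod (pD (fst z) (snd z))) (0, T)" by (intro continuous_norm contD)
    have "2 * m \<le> cmod (poly (D 0) T)" using z0(2)[OF T] by (simp add: m_def)
    then show "m < cmod (pD (fst (0, T)) (snd (0, T)))" using m by (simp add: pD0)
  qed simp
  then have low: "\<forall>\<^sub>F x in nhds 0. \<forall>T\<in>sphere 0 r1. m < cmod (pD x T)" by simp
  have "\<forall>\<^sub>F x in nhds 0. \<forall>k\<in>{..e}. holo_at (\<lambda>x. coeff (D x) k) x"
    by (rule eventually_ball_finite) (auto intro: holo_at_eventually hD)
  with low r2(2) have "\<forall>\<^sub>F x in nhds 0. (\<forall>T\<in>sphere 0 r1. m < cmod (pD x T)) \<and>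
      (\<forall>k\<in>{..e}. holo_at (\<lambda>x. coeff (D x) k) x) \<and> (\<forall>T. cmod T \<le> r2 \<longrightarrow> holo_at a (x + T *s v) \<and> cmod (a (x + T *s v)) < A)"
    by eventually_elim blast
  then obtain \<delta> where \<delta>: "0 < \<delta>" and *: "\<And>x. x \<in> ball 0 \<delta> \<Longrightarrow> (\<forall>T\<in>sphere 0 r1. m < cmod (pD x T)) \<and>
      (\<forall>k\<in>{..e}. holo_at (\<lambda>x. coeff (D x) k) x) \<and> (\<forall>T. cmod T \<le> r2 \<longrightarrow> holo_at a (x + T *s v) \<and> cmod (a (x + T *s v)) < A)"
    unfolding eventually_nhds_metric by (auto simp: dist_commute)
  have low': "pD x \<zeta> \<noteq> 0" "m < cmod (pD x \<zeta>)" if "x \<in> ball 0 \<delta>" "cmod \<zeta> = r1" for x \<zeta>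
    using *[OF that(1)] that(2) m by force+
  define Q where "Q i x \<zeta> = (\<Sum>k=Suc i..e. coeff (D x) k * \<zeta> ^ (k - Suc i))" for i x \<zeta>
  define G where "G i x \<zeta> = a (x + \<zeta> *s v) / pD x \<zeta> * \<zeta> * Q i x \<zeta>" for i x \<zeta>
  define b where "b x T = circle_mean r1 (\<lambda>\<zeta>. a (x + \<zeta> *s v) / pD x \<zeta> * (\<zeta> / (\<zeta> - T)))" for x T
  define Rem where "Rem x = (\<Sum>i<e. monom (circle_mean r1 (G i x)) i)" for x
  let ?B = "ball (0 :: complex^'n) \<delta> \<times> sphere (0::complex) r1"
  have ca: "continuous_on ?B (\<lambda>z. a (fst z + snd z *s v))"
  proof (rule continuous_on_compose2[of "{z. holo_at a z}" a])
    show "continuous_on {z. holo_at a z} a" by (auto intro!: continuous_at_imp_continuous_on holo_at_isCont)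
    show "continuous_on ?B (\<lambda>z. fst z + snd z *s v)" by (intro continuous_intros)
    show "(\<lambda>z. fst z + snd z *s v) ` ?B \<subseteq> {z. holo_at a z}" using * r1 by force
  qed
  have cc: "continuous_on ?B (\<lambda>z. coeff (D (fst z)) k)" if "k \<le> e" for k
  proof (rule continuous_on_compose2[of "ball 0 \<delta>" "\<lambda>x. coeff (D x) k"])
    show "continuous_on (ball 0 \<delta>) (\<lambda>x. coeff (D x) k)"
      using * that by (intro continuous_at_imp_continuous_on ballI holo_at_isCont) blast
  qed (auto intro!: continuous_intros)
  have cp: "continuous_on ?B (\<lambda>z. pD (fst z) (snd z))"
    unfolding pD_def by (intro continuous_on_sum continuous_on_mult cc continuous_on_power continuous_on_snd continuous_on_id) auto
  have cQ: "continuous_on ?B (\<lambda>z. Q i (fst z) (snd z))" for i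
    unfolding Q_def by (intro continuous_on_sum continuous_on_mult cc continuous_on_power continuous_on_snd continuous_on_id) auto
  have cG: "continuous_on ?B (\<lambda>z. G i (fst z) (snd z))" for i
    unfolding G_def using low' by (intro continuous_on_mult continuous_on_divide ca cp cQ continuous_on_snd continuous_on_id) auto
  have slice: "continuous_on (sphere 0 r1) (F x)" if "continuous_on ?B (\<lambda>z. F (fst z) (snd z))" "x \<in> ball 0 \<delta>"
    for F :: "complex^'n \<Rightarrow> complex \<Rightarrow> complex" and x
  proof -
    have "Pair x ` sphere 0 r1 \<subseteq> ?B" using that(2) by auto
    moreover have "continuous_on (sphere (0 :: complex) r1) (Pair x)"
      by (rule continuous_on_Pair[OF continuous_on_const continuous_on_id])
    ultimately have "continuous_on (sphere 0 r1) (\<lambda>\<zeta>. F (fst (x, \<zeta>)) (snd (x, \<zeta>)))"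
      using continuous_on_compose2[OF that(1), of "sphere 0 r1" "Pair x"] by blast
    then show ?thesis by simp
  qed
  have hG: "holo_at (\<lambda>x. circle_mean r1 (G i x)) 0" if "i < e" for i
  proof (rule holo_at_param_mean[OF \<delta>])
    show "continuous_on ?B (\<lambda>(x, \<zeta>). G i x \<zeta>)" using cG by (simp add: case_prod_beta)
    show "cdiff (\<lambda>x. G i x \<zeta>) x" if x: "x \<in> ball 0 \<delta>" "cmod \<zeta> = r1" for x \<zeta>
    proof -
      have hk: "holo_at (\<lambda>x. coeff (D x) k) x" if "k \<le> e" for k using *[OF x(1)] that by blast
      have "holo_at (\<lambda>x. pD x \<zeta>) x" unfolding pD_def by (intro holo_intros hk) auto
      moreover have "holo_at (\<lambda>x. Q i x \<zeta>) x" unfolding Q_def by (intro holo_intros hk) auto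
      moreover have "holo_at (\<lambda>x. a (x + \<zeta> *s v)) x" using *[OF x(1)] x(2) r1 by (intro holo_at_along_line) auto
      ultimately show ?thesis unfolding G_def
        using low'[OF x] by (intro holo_at_imp_cdiff holo_at_mult holo_at_divide holo_at_const) auto
    qed
  qed (use r1 in simp)
  have pR: "poly (Rem x) T = (\<Sum>i<e. T ^ i * circle_mean r1 (G i x))" for x T
    by (simp add: Rem_def poly_sum poly_monom mult_ac)
  have id: "a (x + T *s v) = b x T * pD x T + poly (Rem x) T" if x: "x \<in> ball 0 \<delta>" and T: "cmod T < r1" for x T
  proof -
    have ha: "(\<lambda>\<zeta>. a (x + \<zeta> *s v)) holomorphic_on cball 0 r1"
      by (rule line_holomorphic) (use *[OF x] r1 in \<open>auto intro: holo_at_imp_cdiff\<close>)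
    have nT: "\<zeta> \<noteq> T" if "cmod \<zeta> = r1" for \<zeta> using T that by auto
    have c1: "continuous_on (sphere 0 r1) (\<lambda>\<zeta>. a (x + \<zeta> *s v) / pD x \<zeta> * (\<zeta> / (\<zeta> - T)))"
      using low'[OF x] nT slice[where F = "\<lambda>x \<zeta>. a (x + \<zeta> *s v)", OF ca x] slice[where F = pD, OF cp x]
      by (intro continuous_intros) auto
    have c2: "continuous_on (sphere 0 r1) (\<lambda>\<zeta>. T ^ i * G i x \<zeta>)" for i
      by (intro continuous_on_mult continuous_on_const slice[where F = "G i", OF cG x])
    have "a (x + T *s v) = circle_mean r1 (\<lambda>\<zeta>. a (x + \<zeta> *s v) * (\<zeta> / (\<zeta> - T)))"
      using circle_mean_cauchy[OF holomorphic_on_imp_continuous_on[OF ha] holomorphic_on_subset[OF ha ball_subset_cball] T] by simp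
    also have "\<dots> = circle_mean r1 (\<lambda>\<zeta>. pD x T * (a (x + \<zeta> *s v) / pD x \<zeta> * (\<zeta> / (\<zeta> - T))) + (\<Sum>i<e. T ^ i * G i x \<zeta>))"
    proof (rule circle_mean_cong)
      fix \<zeta> assume z: "cmod \<zeta> = r1"
      define s where "s = (\<Sum>i<e. T ^ i * Q i x \<zeta>)"
      have dd: "pD x \<zeta> = pD x T + (\<zeta> - T) * s"
        using divided_difference[where c = "\<lambda>k. coeff (D x) k" and e = e and \<zeta> = \<zeta> and T = T] unfolding pD_def Q_def s_def by (simp add: algebra_simps)
      have "(\<Sum>i<e. T ^ i * G i x \<zeta>) = a (x + \<zeta> *s v) / pD x \<zeta> * \<zeta> * s"
        unfolding G_def s_def sum_distrib_left by (intro sum.cong refl) (simp add: mult_ac)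
      moreover have "\<alpha> * (\<zeta> / w) = P * (\<alpha> / p * (\<zeta> / w)) + \<alpha> / p * \<zeta> * s"
        if "p \<noteq> 0" "w \<noteq> 0" "p = P + w * s" for \<alpha> p P w :: complex
      proof -
        have "P * (\<alpha> / p * (\<zeta> / w)) + \<alpha> / p * \<zeta> * s = \<alpha> * \<zeta> / (p * w) * (P + w * s)"
          using that(1,2) by (simp add: field_simps)
        then show ?thesis using that by simp
      qed
      from this[OF low'(1)[OF x z] _ dd] nT[OF z]
      have "a (x + \<zeta> *s v) * (\<zeta> / (\<zeta> - T)) = pD x T * (a (x + \<zeta> *s v) / pD x \<zeta> * (\<zeta> / (\<zeta> - T)))
          + a (x + \<zeta> *s v) / pD x \<zeta> * \<zeta> * s" by simp
      ultimately show "a (x + \<zeta> *s v) * (\<zeta> / (\<zeta> - T)) = pD x T * (a (x + \<zeta> *s v) / pD x \<zeta> * (\<zeta> / (\<zeta> - T))) + (\<Sum>i<e. T ^ i * G i x \<zeta>)"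
        by (simp only:)
    qed (use r1 in simp)
    also have "\<dots> = circle_mean r1 (\<lambda>\<zeta>. pD x T * (a (x + \<zeta> *s v) / pD x \<zeta> * (\<zeta> / (\<zeta> - T)))) + circle_mean r1 (\<lambda>\<zeta>. \<Sum>i<e. T ^ i * G i x \<zeta>)"
      using r1 by (intro circle_mean_add continuous_on_mult[OF continuous_on_const c1] continuous_on_sum c2) auto
    also have "circle_mean r1 (\<lambda>\<zeta>. \<Sum>i<e. T ^ i * G i x \<zeta>) = poly (Rem x) T"
      unfolding pR using r1 c2 by (subst circle_mean_sum) (auto simp: circle_mean_cmult)
    finally show ?thesis unfolding circle_mean_cmult b_def[symmetric] by (simp only: mult.commute)
  qed
  have A: "A > 0" unfolding A_def by (simp add: add_nonneg_pos)
  have bb: "cmod (b x T) \<le> 2 * A / m" if x: "x \<in> ball 0 \<delta>" and T: "cmod T \<le> r1 / 2" for x T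
    unfolding b_def
  proof (rule circle_mean_bound[OF r1(1)])
    have nT: "\<zeta> \<noteq> T" if "cmod \<zeta> = r1" for \<zeta> using T that r1 by auto
    show "continuous_on (sphere 0 r1) (\<lambda>\<zeta>. a (x + \<zeta> *s v) / pD x \<zeta> * (\<zeta> / (\<zeta> - T)))"
      using low'[OF x] nT slice[where F = "\<lambda>x \<zeta>. a (x + \<zeta> *s v)", OF ca x] slice[where F = pD, OF cp x]
      by (intro continuous_intros) auto
    fix z assume z: "cmod z = r1"
    have "r1 / 2 \<le> cmod (z - T)" using norm_triangle_ineq2[of z T] z T by simp
    then have "cmod (z / (z - T)) \<le> 2" using z r1 nT[OF z] by (simp add: norm_divide divide_le_eq)
    moreover have "cmod (a (x + z *s v) / pD x z) \<le> A / m"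
      unfolding norm_divide using *[OF x] low'[OF x z] z r1 A m by (intro frac_le) (auto intro: less_imp_le)
    ultimately have "cmod (a (x + z *s v) / pD x z) * cmod (z / (z - T)) \<le> A / m * 2"
      using A m by (intro mult_mono) auto
    also have "\<dots> = 2 * A / m" by simp
    finally show "cmod (a (x + z *s v) / pD x z * (z / (z - T))) \<le> 2 * A / m"
      by (simp only: norm_mult)
  qed
  have inB: "\<forall>\<^sub>F x in nhds 0. x \<in> ball 0 \<delta>" using \<delta> by (intro eventually_nhds_in_open) auto
  have cR: "coeff (Rem x) j = (if j < e then circle_mean r1 (G j x) else 0)" for x j
    by (auto simp: Rem_def coeff_sum)
  have hR: "holo_coefficients Rem" unfolding holo_coefficients_def cR
  proof
    fix j show "holo_at (\<lambda>x. if j < e then circle_mean r1 (G j x) else 0) 0"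
      by (cases "j < e") (auto intro: hG holo_at_const)
  qed
  have bR: "degree_less e Rem" unfolding degree_less_def cR by simp
  obtain BR where BR: "BR > 0" "\<forall>\<^sub>F x in nhds 0. \<forall>T. cmod T \<le> r \<longrightarrow> cmod (poly (Rem x) T) \<le> BR"
    using holo_coefficients_bounded[OF hR bR less_imp_le[OF r]] by blast
  obtain m' where m': "m' > 0" "\<forall>\<^sub>F x in nhds 0. \<forall>T. r1 / 2 \<le> cmod T \<longrightarrow> cmod T \<le> r \<longrightarrow> m' \<le> cmod (q (x + T *s v))"
    using q_lower[of "r1 / 2"] r1 by auto
  have "\<exists>M. \<forall>\<^sub>F x in nhds 0. \<forall>T. cmod T \<le> r \<longrightarrow> cmod (poly (Rem x) T * p (x + T *s v)) \<le> M * cmod (q (x + T *s v))"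
    if p: "p \<in> S" for p
  proof -
    obtain C where C: "C > 0" "\<forall>\<^sub>F x in nhds 0. \<forall>T. cmod T \<le> r \<longrightarrow> cmod (p (x + T *s v)) \<le> C"
      using p_upper[of p] p by blast
    obtain M where M: "\<forall>\<^sub>F x in nhds 0. \<forall>T. cmod T \<le> r \<longrightarrow> cmod (poly (D x) T * p (x + T *s v)) \<le> M * cmod (q (x + T *s v))"
      using D(1) p unfolding admissible_def by blast
    define M1 where "M1 = K p + 2 * A / m * \<bar>M\<bar>"
    have "\<forall>\<^sub>F x in nhds 0. \<forall>T. cmod T \<le> r \<longrightarrow>
        cmod (poly (Rem x) T * p (x + T *s v)) \<le> (M1 + BR * C / m') * cmod (q (x + T *s v))"
      using C(2) M r2(2) BR(2) m'(2) inB pD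
    proof eventually_elim
      case (elim x)
      show ?case
      proof (intro allI impI)
        fix T assume T: "cmod T \<le> r"
        let ?p = "p (x + T *s v)" and ?q = "cmod (q (x + T *s v))" and ?a = "a (x + T *s v)"
        have M1: "M1 \<ge> 0" unfolding M1_def K_def using A m by auto
        have M2: "BR * C / m' \<ge> 0" using BR(1) C(1) m'(1) by auto
        \<comment> \<open>Near the centre use \<open>Rem = a - b D\<close>; further out, where this formula is not available, \<open>q\<close> is bounded
          below.\<close>
        show "cmod (poly (Rem x) T * ?p) \<le> (M1 + BR * C / m') * ?q"
        proof (cases "cmod T \<le> r1 / 2")
          case True
          have kp: "?a * ?p = k p (x + T *s v) * q (x + T *s v)" "cmod (k p (x + T *s v)) < K p"
            using elim(3) True r1 p by auto
          have 1: "cmod (?a * ?p) \<le> K p * ?q"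
            unfolding kp(1) norm_mult using kp(2) by (intro mult_right_mono) auto
          have "cmod (pD x T * ?p) \<le> M * ?q" using elim(2) T elim(7) by auto
          also have "\<dots> \<le> \<bar>M\<bar> * ?q" by (intro mult_right_mono) auto
          finally have "cmod (b x T) * cmod (pD x T * ?p) \<le> 2 * A / m * (\<bar>M\<bar> * ?q)"
            using bb[OF elim(6) True] A m by (intro mult_mono) auto
          then have 2: "cmod (b x T * pD x T * ?p) \<le> 2 * A / m * (\<bar>M\<bar> * ?q)" by (simp add: norm_mult mult_ac)
          have "poly (Rem x) T * ?p = ?a * ?p - b x T * pD x T * ?p"
            using id[OF elim(6), of T] True r1 by (simp add: algebra_simps)
          also have "cmod \<dots> \<le> K p * ?q + 2 * A / m * (\<bar>M\<bar> * ?q)"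
            by (rule order_trans[OF norm_triangle_ineq4 add_mono[OF 1 2]])
          also have "\<dots> = M1 * ?q" by (simp add: M1_def algebra_simps)
          also have "\<dots> \<le> (M1 + BR * C / m') * ?q" using M2 by (intro mult_right_mono) auto
          finally show ?thesis .
        next
          case False
          have "cmod (poly (Rem x) T * ?p) \<le> BR * C"
            unfolding norm_mult using elim(1,4) T BR(1) by (intro mult_mono) auto
          also have "\<dots> = BR * C / m' * m'" using m'(1) by simp
          also have "\<dots> \<le> (M1 + BR * C / m') * ?q"
            using elim(5) T False M1 M2 m'(1) by (intro mult_mono) auto
          finally show ?thesis .
        qed
      qed
    qed
    then show ?thesis by blast
  qed
  then have "admissible Rem" unfolding admissible_def using hR bR by blast
  from min[OF this bR] inB have "\<forall>\<^sub>F x in nhds 0. cmod (a x) \<le> 2 * A / m * cmod (coeff (D x) 0)"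
  proof eventually_elim
    case (elim x)
    have "pD x 0 = coeff (D x) 0" unfolding pD_def by (simp add: power_0_left sum.delta' if_distrib cong: if_cong)
    then have "a x = b x 0 * coeff (D x) 0" using id[OF elim(2), of 0] r1 elim(1) by simp
    moreover have "cmod (b x 0) \<le> 2 * A / m" using bb[OF elim(2), of 0] r1 by simp
    then have "cmod (b x 0) * cmod (coeff (D x) 0) \<le> 2 * A / m * cmod (coeff (D x) 0)"
      by (rule mult_right_mono) simp
    ultimately show ?case by (simp only: norm_mult)
  qed
  then show ?thesis by blast
qed

lemma denominators_principal_in_setup:
  "\<exists>d. holo_at d 0 \<and> \<not> zero_germ d \<and> (\<forall>a. holo_at a 0 \<longrightarrow> ((\<forall>p\<in>S. germ_dvd q (\<lambda>x. a x * p x)) \<longleftrightarrow> germ_dvd d a))"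
proof -
  obtain D e where D: "admissible D" "degree_less (Suc e) D" "\<forall>\<^sub>F x in nhds 0. coeff (D x) e = 1"
    and min: "\<And>P. admissible P \<Longrightarrow> degree_less e P \<Longrightarrow> \<forall>\<^sub>F x in nhds 0. P x = 0"
    using monic_generator by blast
  define d where "d x = coeff (D x) 0" for x
  have hd: "holo_at d 0" unfolding d_def using D(1) by (auto simp: admissible_def holo_coefficients_def)
  have bound: "\<exists>B. \<forall>\<^sub>F x in nhds 0. cmod (a x) \<le> B * cmod (d x)"
    if "holo_at a 0" "\<And>p. p \<in> S \<Longrightarrow> germ_dvd q (\<lambda>x. a x * p x)" for a
    unfolding d_def by (rule division_bound[OF D min that])
  have hq: "holo_at q 0" using hol_germ by blast
  have "germ_dvd q (\<lambda>x. q x * p x)" if "p \<in> S" for p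
    unfolding germ_dvd_def using hol_germ[of p] that by (auto simp: mult.commute)
  from bound[OF hq this] obtain B where B: "\<forall>\<^sub>F x in nhds 0. cmod (q x) \<le> B * cmod (d x)" by blast
  have nd: "\<not> zero_germ d"
  proof
    assume "zero_germ d"
    then have "zero_germ q" using B unfolding zero_germ_def by eventually_elim simp
    with nonzero_q show False by blast
  qed
  have "(\<forall>p\<in>S. germ_dvd q (\<lambda>x. a x * p x)) \<longleftrightarrow> germ_dvd d a" if ha: "holo_at a 0" for a
  proof
    assume "\<forall>p\<in>S. germ_dvd q (\<lambda>x. a x * p x)"
    then obtain B where "\<forall>\<^sub>F x in nhds 0. cmod (a x) \<le> B * cmod (d x)" using bound[OF ha] by blast
    then show "germ_dvd d a" by (rule germ_dvd_if_bounded[OF ha hd nd])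
  next
    assume "germ_dvd d a"
    then obtain c where c: "holo_at c 0" "\<forall>\<^sub>F x in nhds 0. a x = c x * d x" unfolding germ_dvd_def by blast
    show "\<forall>p\<in>S. germ_dvd q (\<lambda>x. a x * p x)"
    proof
      fix p assume "p \<in> S"
      then obtain k where k: "holo_at k 0" "\<forall>\<^sub>F x in nhds 0. d x * p x = k x * q x"
        using admissible_value[OF D(1)] unfolding germ_dvd_def d_def by blast
      from c(2) k(2) have "\<forall>\<^sub>F x in nhds 0. a x * p x = (c x * k x) * q x"
        by eventually_elim (simp add: mult.assoc)
      then show "germ_dvd q (\<lambda>x. a x * p x)" unfolding germ_dvd_def using holo_at_mult[OF c(1) k(1)] by blast
    qed
  qed
  with hd nd show ?thesis by blast
qed

end

text \<open>A substitute for unique factorisation of germs. With \<open>S = {p}\<close> the generator is the reduced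
  denominator of \<open>p/q\<close>, and for larger \<open>S\<close> it is a least common denominator.\<close>
theorem denominators_principal:
  fixes q :: "complex^'n \<Rightarrow> complex"
  assumes "holo_at q 0" "\<not> zero_germ q" "finite S" "\<And>p. p \<in> S \<Longrightarrow> holo_at p 0"
  shows "\<exists>d. holo_at d 0 \<and> \<not> zero_germ d \<and> (\<forall>a. holo_at a 0 \<longrightarrow> ((\<forall>p\<in>S. germ_dvd q (\<lambda>x. a x * p x)) \<longleftrightarrow> germ_dvd d a))"
proof -
  obtain v r0 where r0: "0 < r0" "\<And>T. 0 < cmod T \<Longrightarrow> cmod T \<le> r0 \<Longrightarrow> q (T *s v) \<noteq> 0"
    using regular_direction[OF assms(1,2)] by blast
  have "\<forall>\<^sub>F x in nhds 0. \<forall>p\<in>insert q S. holo_at p x"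
    by (rule eventually_ball_finite) (use assms in \<open>auto intro: holo_at_eventually\<close>)
  from line_eventually[OF this, of v] obtain R where R: "0 < R"
    "\<forall>\<^sub>F x in nhds 0. \<forall>T. cmod T \<le> R \<longrightarrow> (\<forall>p\<in>insert q S. holo_at p (x + T *s v))" by blast
  interpret weierstrass_setup q S v "min r0 (R / 2)" R
    by unfold_locales (use assms r0 R in auto)
  show ?thesis by (rule denominators_principal_in_setup)
qed

section \<open>Differential forms in coordinates\<close>

abbreviation pdiff where "pdiff \<equiv> partial_deriv"

lemma pdiff_cong: "\<forall>\<^sub>F y in nhds x. f y = g y \<Longrightarrow> pdiff k f x = pdiff k g x"
  unfolding partial_deriv_def by (simp add: fd_cong)

lemma
  assumes "cdiff f x" "cdiff g x"
  shows pdiff_add: "pdiff k (\<lambda>x. f x + g x) x = pdiff k f x + pdiff k g x"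
    and pdiff_diff: "pdiff k (\<lambda>x. f x - g x) x = pdiff k f x - pdiff k g x"
    and pdiff_mult: "pdiff k (\<lambda>x. f x * g x) x = pdiff k f x * g x + f x * pdiff k g x"
    and pdiff_divide: "g x \<noteq> 0 \<Longrightarrow> pdiff k (\<lambda>x. f x / g x) x = (pdiff k f x * g x - f x * pdiff k g x) / (g x)\<^sup>2"
  unfolding partial_deriv_def using assms by (simp_all add: fd_add fd_diff fd_mult fd_divide)

lemma pdiff_const: "pdiff k (\<lambda>x. c) x = 0"
  unfolding partial_deriv_def by (simp add: fd_const)

lemma cdiff_sum: "(\<And>i. i \<in> I \<Longrightarrow> cdiff (f i) x) \<Longrightarrow> cdiff (\<lambda>x. \<Sum>i\<in>I. f i x) x"
  by (induction I rule: infinite_finite_induct) (simp_all add: cdiff_const cdiff_add)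

lemma pdiff_sum: "(\<And>i. i \<in> I \<Longrightarrow> cdiff (f i) x) \<Longrightarrow> pdiff k (\<lambda>x. \<Sum>i\<in>I. f i x) x = (\<Sum>i\<in>I. pdiff k (f i) x)"
proof (induction I rule: infinite_finite_induct)
  case (insert i I)
  then show ?case using pdiff_add[of "f i" x "\<lambda>x. \<Sum>i\<in>I. f i x" k] cdiff_sum[of I f x] by simp
qed (simp_all add: pdiff_const)

lemma holo_at_pdiff: "holo_at f x \<Longrightarrow> holo_at (\<lambda>x. pdiff k f x) x"
  unfolding partial_deriv_def by (rule holo_at_fd)

lemma pdiff_commute: "holo_at f x \<Longrightarrow> pdiff k (\<lambda>y. pdiff l f y) x = pdiff l (\<lambda>y. pdiff k f y) x"
  unfolding partial_deriv_def by (rule fd_commute)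

lemma fd_expand:
  assumes "cdiff f x"
  shows "fd f x v = (\<Sum>k\<in>UNIV. v $ k * pdiff k f x)"
proof -
  have "fd f x v = fd f x (\<Sum>k\<in>UNIV. v $ k *s axis k 1)" by (simp add: basis_expansion)
  also have "\<dots> = (\<Sum>k\<in>UNIV. v $ k * pdiff k f x)"
    unfolding fd_linear(3)[OF assms] partial_deriv_def by (simp add: fd_linear(2)[OF assms])
  finally show ?thesis .
qed

definition pairing :: "complex^'n \<Rightarrow> complex^'n \<Rightarrow> complex" where
  "pairing \<alpha> v = (\<Sum>k\<in>UNIV. \<alpha> $ k * v $ k)"

lemma ext_deriv_nth: "ext_deriv \<omega> x $ k $ l = pdiff k (\<lambda>y. \<omega> y $ l) x - pdiff l (\<lambda>y. \<omega> y $ k) x"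
  by (simp add: ext_deriv_def)

lemma ext_deriv_cong: "\<forall>\<^sub>F y in nhds x. \<omega> y = \<eta> y \<Longrightarrow> ext_deriv \<omega> x = ext_deriv \<eta> x"
  unfolding ext_deriv_def by (simp add: vec_eq_iff, intro allI arg_cong2[where f = "(-)"] pdiff_cong; simp add: eventually_mono)

lemma holo_form1_nth: "holo_form1_at \<omega> x \<Longrightarrow> holo_at (\<lambda>y. \<omega> y $ k) x"
  unfolding holo_form1_at_def by blast

lemma eventually_all_fin: "(\<And>i. \<forall>\<^sub>F x in F. P (i :: 'a::finite) x) \<Longrightarrow> \<forall>\<^sub>F x in F. \<forall>i. P i x"
  by (simp add: eventually_all_finite)

lemma holo_form1_eventually: "holo_form1_at \<omega> x \<Longrightarrow> \<forall>\<^sub>F y in nhds x. holo_form1_at \<omega> y"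
  unfolding holo_form1_at_def by (intro eventually_all_fin holo_at_eventually) blast

lemma holo_fd_field:
  assumes "holo_at f x" "holo_form1_at X x"
  shows "holo_at (\<lambda>y. fd f y (X y)) x"
proof (rule holo_at_congI)
  show "holo_at (\<lambda>y. \<Sum>k\<in>UNIV. X y $ k * pdiff k f y) x"
    using assms by (intro holo_intros holo_at_pdiff holo_form1_nth)
  show "\<forall>\<^sub>F y in nhds x. fd f y (X y) = (\<Sum>k\<in>UNIV. X y $ k * pdiff k f y)"
    using holo_at_eventually[OF assms(1)] by eventually_elim (rule fd_expand[OF holo_at_imp_cdiff])
qed

lemma holo_pairing: "holo_form1_at \<omega> x \<Longrightarrow> holo_form1_at X x \<Longrightarrow> holo_at (\<lambda>y. pairing (\<omega> y) (X y)) x"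
  unfolding pairing_def by (intro holo_intros holo_form1_nth)

lemma ext_deriv_isCont: "holo_form1_at \<omega> x \<Longrightarrow> isCont (\<lambda>y. ext_deriv \<omega> y $ k $ l) x"
  unfolding ext_deriv_nth by (intro holo_at_isCont holo_at_diff holo_at_pdiff holo_form1_nth)

text \<open>Closedness of a meromorphic form, and in the next lemma the equation \<open>d\<omega> = \<theta> \<and> \<omega>\<close>, is required at all
  points where the form happens to be holomorphic, while computations take place off the zeros of a
  denominator. Continuity bridges the gap.\<close>
lemma closed_dense:
  assumes "holo_at q 0" "\<not> zero_germ q" "\<forall>\<^sub>F x in nhds 0. q x \<noteq> 0 \<longrightarrow> ext_deriv \<theta> x = 0"
  shows "\<forall>\<^sub>F x in nhds 0. holo_form1_at \<theta> x \<longrightarrow> ext_deriv \<theta> x = 0"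
  using nonzero_dense_on[OF assms]
proof eventually_elim
  case (elim x)
  show ?case
  proof
    assume h: "holo_form1_at \<theta> x"
    have "ext_deriv \<theta> x $ k $ l = 0" for k l
      by (rule dense_eq[where G = "\<lambda>_. 0", OF ext_deriv_isCont[OF h] continuous_const])
         (rule frequently_elim1[OF elim], simp)
    then show "ext_deriv \<theta> x = 0" by (simp add: vec_eq_iff)
  qed
qed

lemma twist_dense:
  assumes "holo_at q 0" "\<not> zero_germ q" "holo_form1_at \<omega> 0"
    "\<forall>\<^sub>F x in nhds 0. q x \<noteq> 0 \<longrightarrow> ext_deriv \<omega> x = wedge11 (\<theta> x) (\<omega> x)"
  shows "\<forall>\<^sub>F x in nhds 0. holo_form1_at \<theta> x \<longrightarrow> ext_deriv \<omega> x = wedge11 (\<theta> x) (\<omega> x)"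
  using nonzero_dense_on[OF assms(1,2,4)] holo_form1_eventually[OF assms(3)]
proof eventually_elim
  case (elim x)
  show ?case
  proof
    assume h: "holo_form1_at \<theta> x"
    have "ext_deriv \<omega> x $ k $ l = wedge11 (\<theta> x) (\<omega> x) $ k $ l" for k l
    proof (rule dense_eq[where F = "\<lambda>x. ext_deriv \<omega> x $ k $ l" and G = "\<lambda>x. wedge11 (\<theta> x) (\<omega> x) $ k $ l", OF ext_deriv_isCont[OF elim(2)]])
      show "isCont (\<lambda>x. wedge11 (\<theta> x) (\<omega> x) $ k $ l) x"
        unfolding wedge11_def using h elim(2) by (simp, intro holo_at_isCont holo_intros holo_form1_nth)
    qed (rule frequently_elim1[OF elim(1)], simp)
    then show "ext_deriv \<omega> x = wedge11 (\<theta> x) (\<omega> x)" by (simp add: vec_eq_iff)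
  qed
qed

lemma zero_germ_prod:
  fixes f :: "'i \<Rightarrow> complex^'n \<Rightarrow> complex"
  assumes "finite I" "\<And>i. i \<in> I \<Longrightarrow> holo_at (f i) 0" "\<And>i. i \<in> I \<Longrightarrow> \<not> zero_germ (f i)"
  shows "holo_at (\<lambda>x. \<Prod>i\<in>I. f i x) 0 \<and> \<not> zero_germ (\<lambda>x. \<Prod>i\<in>I. f i x)"
  using assms
proof (induction I)
  case empty
  have "\<not> (\<forall>\<^sub>F x in nhds (0 :: complex^'n). (1::complex) = 0)" by simp
  then show ?case by (simp add: holo_at_const zero_germ_def)
next
  case (insert i I)
  then show ?case using zero_germ_mult[of "f i" "\<lambda>x. \<Prod>i\<in>I. f i x"] by (simp add: holo_at_mult)
qed

lemma mero_form1_common_denominator: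
  fixes \<theta> :: "complex^'n \<Rightarrow> complex^'n"
  assumes "mero_form1 \<theta>"
  shows "\<exists>\<mu> q. holo_form1_at \<mu> 0 \<and> holo_at q 0 \<and> \<not> zero_germ q \<and>
    (\<forall>\<^sub>F x in nhds 0. q x \<noteq> 0 \<longrightarrow> holo_form1_at \<theta> x \<and> \<theta> x = (1 / q x) *s \<mu> x)"
proof -
  have "\<forall>i. \<exists>pq. holo_at (fst pq) 0 \<and> holo_at (snd pq) 0 \<and> \<not> zero_germ (snd pq) \<and>
     (\<forall>\<^sub>F x in nhds 0. snd pq x \<noteq> 0 \<longrightarrow> \<theta> x $ i = fst pq x / snd pq x)"
    using assms unfolding mero_form1_def mero_germ_def by simp
  from choice[OF this] obtain pq where pq: "\<And>i. holo_at (fst (pq i)) 0" "\<And>i. holo_at (snd (pq i)) 0"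
    "\<And>i. \<not> zero_germ (snd (pq i))" "\<And>i. \<forall>\<^sub>F x in nhds 0. snd (pq i) x \<noteq> 0 \<longrightarrow> \<theta> x $ i = fst (pq i) x / snd (pq i) x"
    by blast
  define q where "q x = (\<Prod>i\<in>UNIV. snd (pq i) x)" for x
  define \<mu> where "\<mu> x = (\<chi> i. fst (pq i) x * (\<Prod>j\<in>UNIV - {i}. snd (pq j) x))" for x
  have q: "holo_at q 0" "\<not> zero_germ q"
    unfolding q_def using zero_germ_prod[of UNIV "\<lambda>i. snd (pq i)"] pq by auto
  have \<mu>: "holo_form1_at \<mu> 0"
    unfolding holo_form1_at_def \<mu>_def
    using zero_germ_prod[of "UNIV - {_}" "\<lambda>i. snd (pq i)"] pq by (auto intro!: holo_at_mult)
  have *: "\<forall>\<^sub>F x in nhds 0. \<forall>i. holo_at (fst (pq i)) x \<and> holo_at (snd (pq i)) x \<and>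
     (snd (pq i) x \<noteq> 0 \<longrightarrow> \<theta> x $ i = fst (pq i) x / snd (pq i) x)"
    by (intro eventually_all_fin eventually_conj holo_at_eventually pq)
  have "\<forall>\<^sub>F x in nhds 0. q x \<noteq> 0 \<longrightarrow> holo_form1_at \<theta> x \<and> \<theta> x = (1 / q x) *s \<mu> x"
    using * *[THEN eventually_eventually[THEN iffD2]]
  proof eventually_elim
    case (elim x)
    show ?case
    proof
      assume "q x \<noteq> 0"
      then have nz: "snd (pq i) x \<noteq> 0" for i unfolding q_def by simp
      have "holo_at (\<lambda>y. \<theta> y $ i) x" for i
      proof (rule holo_at_congI)
        show "holo_at (\<lambda>y. fst (pq i) y / snd (pq i) y) x" using elim(1) nz by (intro holo_at_divide) auto
        have "isCont (snd (pq i)) x" using elim(1) holo_at_isCont by blast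
        from tendsto_imp_eventually_ne[OF isCont_nhds[OF this] nz] elim(2)
        show "\<forall>\<^sub>F y in nhds x. \<theta> y $ i = fst (pq i) y / snd (pq i) y" by eventually_elim blast
      qed
      moreover have "\<theta> x $ i = (1 / q x) * \<mu> x $ i" for i
      proof -
        have "q x = snd (pq i) x * (\<Prod>j\<in>UNIV - {i}. snd (pq j) x)"
          unfolding q_def by (rule prod.remove) auto
        moreover have "(\<Prod>j\<in>UNIV - {i}. snd (pq j) x) \<noteq> 0" using nz by simp
        ultimately show ?thesis using elim(1) nz by (simp add: \<mu>_def field_simps)
      qed
      ultimately show "holo_form1_at \<theta> x \<and> \<theta> x = (1 / q x) *s \<mu> x"
        by (simp add: holo_form1_at_def vec_eq_iff)
    qed
  qed
  with q \<mu> show ?thesis by blast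
qed

section \<open>The Poincare lemma and integrating factors\<close>

lemma
  assumes "cdiff f (s *s x)"
  shows cdiff_scale: "cdiff (\<lambda>y. f (s *s y)) x" and fd_scale: "fd (\<lambda>y. f (s *s y)) x v = s * fd f (s *s x) v"
proof -
  have "((\<lambda>y. s *s y) has_derivative (\<lambda>v. s *s v)) (at x)"
    by (rule bounded_linear_imp_has_derivative[OF bounded_bilinear.bounded_linear_right[OF bounded_bilinear_vsmult]])
  from has_derivative_compose[OF this cdiff_has_derivative(1)[OF assms]]
  have 1: "((\<lambda>y. f (s *s y)) has_derivative (\<lambda>v. fd f (s *s x) (s *s v))) (at x)" .
  show "cdiff (\<lambda>y. f (s *s y)) x"
    by (rule cdiffI[OF 1]) (simp add: cdiff_has_derivative(2)[OF assms])
  show "fd (\<lambda>y. f (s *s y)) x v = s * fd f (s *s x) v"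
    by (simp add: fd_eqI[OF 1] cdiff_has_derivative(2)[OF assms])
qed

text \<open>The primitive is \<open>g(x) = \<integral> \<Sum>i. \<eta>\<^sub>i(t x) x\<^sub>i dt\<close> over \<open>[0, 1]\<close>. By closedness the \<open>k\<close>-th partial derivative of the
  integrand is the derivative of \<open>t \<eta>\<^sub>k(t x)\<close> with respect to \<open>t\<close>.\<close>
lemma poincare:
  fixes \<eta> :: "complex^'n \<Rightarrow> complex^'n"
  assumes "holo_form1_at \<eta> 0" "\<forall>\<^sub>F x in nhds 0. ext_deriv \<eta> x = 0"
  shows "\<exists>g. holo_at g 0 \<and> (\<forall>\<^sub>F x in nhds 0. \<forall>k. pdiff k g x = \<eta> x $ k)"
proof -
  have "\<forall>\<^sub>F x in nhds 0. holo_form1_at \<eta> x \<and> ext_deriv \<eta> x = 0"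
    using holo_form1_eventually[OF assms(1)] assms(2) by eventually_elim blast
  then obtain e where e: "0 < e" "\<And>x. x \<in> ball 0 e \<Longrightarrow> holo_form1_at \<eta> x" "\<And>x. x \<in> ball 0 e \<Longrightarrow> ext_deriv \<eta> x = 0"
    unfolding eventually_nhds_metric by (auto simp: dist_commute)
  define G where "G x t = (\<Sum>i\<in>UNIV. \<eta> (complex_of_real t *s x) $ i * x $ i)" for x :: "complex^'n" and t
  have tx: "complex_of_real t *s x \<in> ball 0 e" if "x \<in> ball 0 e" "t \<in> cbox 0 1" for x t
  proof -
    have "\<bar>t\<bar> * norm x \<le> 1 * norm x" using that by (intro mult_right_mono) auto
    then show ?thesis using that by (simp add: norm_vsmult)
  qed
  have c\<eta>: "cdiff (\<lambda>y. \<eta> y $ i) x" if "x \<in> ball 0 e" for i x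
    using holo_at_imp_cdiff[OF holo_form1_nth[OF e(2)[OF that]]] .
  have main: "cdiff (\<lambda>x. integral (cbox 0 1) (G x)) c \<and>
      fd (\<lambda>x. integral (cbox 0 1) (G x)) c v = integral (cbox 0 1) (\<lambda>t. fd (\<lambda>x. G x t) c v)"
    if c: "c \<in> ball 0 e" for c v
  proof -
    obtain R where R: "R > 0" "ball c R \<subseteq> ball 0 e" using c open_ball open_contains_ball by metis
    have tc: "complex_of_real t *s x \<in> ball 0 e" if "x \<in> ball c R" "t \<in> cbox 0 1" for x t
      using tx[OF subsetD[OF R(2) that(1)] that(2)] .
    have "continuous_on (ball c R \<times> cbox 0 1) (\<lambda>(x, t). G x t)"
      unfolding G_def case_prod_beta
    proof (intro continuous_on_sum continuous_on_mult)
      fix i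
      show "continuous_on (ball c R \<times> cbox 0 1) (\<lambda>p. \<eta> (complex_of_real (snd p) *s fst p) $ i)"
      proof (rule continuous_on_compose2[of "ball 0 e" "\<lambda>x. \<eta> x $ i"])
        show "continuous_on (ball 0 e) (\<lambda>x. \<eta> x $ i)"
          using c\<eta> by (intro continuous_at_imp_continuous_on ballI cdiff_isCont) blast
        show "continuous_on (ball c R \<times> cbox 0 1) (\<lambda>p. complex_of_real (snd p) *s fst p)"
          by (intro continuous_intros)
        show "(\<lambda>p. complex_of_real (snd p) *s fst p) ` (ball c R \<times> cbox 0 1) \<subseteq> ball 0 e"
          using tc by (auto simp del: mem_ball mem_box)
      qed
      show "continuous_on (ball c R \<times> cbox 0 1) (\<lambda>p. fst p $ i)" by (intro continuous_intros)
    qed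
    moreover have "cdiff (\<lambda>x. G x t) x" if "x \<in> ball c R" "t \<in> cbox 0 1" for x t
      unfolding G_def
      by (intro cdiff_sum cdiff_mult cdiff_nth cdiff_scale[of "\<lambda>y. \<eta> y $ _"] c\<eta> tc[OF that])
    ultimately show ?thesis using param_integral[OF R(1), of c G] by blast
  qed
  define g where "g x = integral (cbox 0 1) (G x)" for x
  have "holo_at g 0" unfolding holo_at_ball g_def using e(1) main by blast
  moreover have "pdiff k g x = \<eta> x $ k" if x: "x \<in> ball 0 e" for k x
  proof -
    have "pdiff k g x = integral (cbox 0 1) (\<lambda>t. fd (\<lambda>x. G x t) x (axis k 1))"
      unfolding partial_deriv_def g_def using main[OF x] by blast
    also have "\<dots> = integral (cbox 0 1) (\<lambda>t. \<eta> (complex_of_real t *s x) $ k + complex_of_real t * fd (\<lambda>y. \<eta> y $ k) (complex_of_real t *s x) x)"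
    proof (rule integral_cong)
      fix t :: real assume t: "t \<in> cbox 0 1"
      let ?s = "complex_of_real t" and ?y = "complex_of_real t *s x"
      have y: "?y \<in> ball 0 e" by (rule tx[OF x t])
      have cs: "cdiff (\<lambda>x. \<eta> (?s *s x) $ i) x" for i
        by (rule cdiff_scale[of "\<lambda>y. \<eta> y $ i"]) (rule c\<eta>[OF y])
      have "fd (\<lambda>x. G x t) x (axis k 1) = pdiff k (\<lambda>x. \<Sum>i\<in>UNIV. \<eta> (?s *s x) $ i * x $ i) x"
        by (simp add: partial_deriv_def G_def)
      also have "\<dots> = (\<Sum>i\<in>UNIV. pdiff k (\<lambda>x. \<eta> (?s *s x) $ i * x $ i) x)"
        by (intro pdiff_sum cdiff_mult cs cdiff_nth)
      also have "\<dots> = (\<Sum>i\<in>UNIV. ?s * pdiff k (\<lambda>y. \<eta> y $ i) ?y * x $ i + \<eta> ?y $ i * (axis k 1 $ i))"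
      proof (rule sum.cong[OF refl])
        fix i
        show "pdiff k (\<lambda>x. \<eta> (?s *s x) $ i * x $ i) x = ?s * pdiff k (\<lambda>y. \<eta> y $ i) ?y * x $ i + \<eta> ?y $ i * (axis k 1 $ i)"
          unfolding pdiff_mult[OF cs cdiff_nth] using fd_scale[OF c\<eta>[OF y], of i "axis k 1"]
          by (simp add: partial_deriv_def fd_nth)
      qed
      also have "\<dots> = (\<Sum>i\<in>UNIV. ?s * (x $ i * pdiff i (\<lambda>y. \<eta> y $ k) ?y)) + \<eta> ?y $ k"
      proof -
        have sym: "pdiff k (\<lambda>y. \<eta> y $ i) ?y = pdiff i (\<lambda>y. \<eta> y $ k) ?y" for i
          using e(3)[OF y] ext_deriv_nth[of \<eta> ?y k i] by simp
        have "(\<Sum>i\<in>UNIV. \<eta> ?y $ i * (axis k 1 $ i)) = (\<Sum>i\<in>UNIV. if i = k then \<eta> ?y $ k else 0)"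
          by (intro sum.cong) (auto simp: axis_def)
        then show ?thesis unfolding sum.distrib sym by (simp add: mult_ac)
      qed
      also have "\<dots> = \<eta> ?y $ k + ?s * fd (\<lambda>y. \<eta> y $ k) ?y x"
        unfolding fd_expand[OF c\<eta>[OF y]] by (simp add: sum_distrib_left)
      finally show "fd (\<lambda>x. G x t) x (axis k 1) = \<eta> ?y $ k + ?s * fd (\<lambda>y. \<eta> y $ k) ?y x" .
    qed
    also have "\<dots> = complex_of_real 1 * \<eta> (complex_of_real 1 *s x) $ k - complex_of_real 0 * \<eta> (complex_of_real 0 *s x) $ k"
    proof -
      have "((\<lambda>t. complex_of_real t * \<eta> (complex_of_real t *s x) $ k) has_vector_derivative
         (\<eta> (complex_of_real t *s x) $ k + complex_of_real t * fd (\<lambda>y. \<eta> y $ k) (complex_of_real t *s x) x)) (at t within {0..1})"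
        if t: "t \<in> {0..1}" for t
      proof (rule has_vector_derivative_real_field)
        have y: "complex_of_real t *s x \<in> ball 0 e" by (rule tx[OF x]) (use t in simp)
        have "((\<lambda>T. \<eta> (T *s x) $ k) has_field_derivative fd (\<lambda>y. \<eta> y $ k) (complex_of_real t *s x) x) (at (complex_of_real t))"
          using cdiff_line[of "\<lambda>y. \<eta> y $ k" 0 "complex_of_real t" x] c\<eta>[OF y] by simp
        from DERIV_mult[OF DERIV_ident this]
        show "((\<lambda>T. T * \<eta> (T *s x) $ k) has_field_derivative \<eta> (complex_of_real t *s x) $ k + complex_of_real t * fd (\<lambda>y. \<eta> y $ k) (complex_of_real t *s x) x) (at (complex_of_real t))"
          by (simp add: add.commute mult.commute)
      qed
      from fundamental_theorem_of_calculus[OF zero_le_one this] show ?thesis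
        by (simp add: integral_unique)
    qed
    finally show ?thesis by simp
  qed
  then have "\<forall>\<^sub>F x in nhds 0. \<forall>k. pdiff k g x = \<eta> x $ k"
    using e(1) by (auto simp: eventually_nhds_metric dist_commute)
  ultimately show ?thesis by blast
qed

lemma
  assumes "holo_at g x"
  shows holo_at_exp: "holo_at (\<lambda>x. exp (g x)) x" and pdiff_exp: "pdiff k (\<lambda>x. exp (g x)) x = exp (g x) * pdiff k g x"
proof -
  have "\<forall>\<^sub>F y in nhds x. cdiff g y" using assms by (simp add: holo_at_def)
  then show "holo_at (\<lambda>x. exp (g x)) x"
    unfolding holo_at_def by eventually_elim (rule cdiff_comp[OF _ DERIV_exp])
  show "pdiff k (\<lambda>x. exp (g x)) x = exp (g x) * pdiff k g x"
    unfolding partial_deriv_def by (rule fd_comp[OF holo_at_imp_cdiff[OF assms] DERIV_exp])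
qed

text \<open>With \<open>dg = \<eta>\<close> and \<open>u = e\<^sup>-\<^sup>g\<close> one has \<open>d(u \<omega>) = u (d\<omega> - \<eta> \<and> \<omega>) = 0\<close>.\<close>
lemma integrating_factor:
  fixes \<omega> \<eta> :: "complex^'n \<Rightarrow> complex^'n"
  assumes "holo_form1_at \<omega> 0" "holo_form1_at \<eta> 0" "\<forall>\<^sub>F x in nhds 0. ext_deriv \<eta> x = 0"
    and tw: "\<forall>\<^sub>F x in nhds 0. ext_deriv \<omega> x = wedge11 (\<eta> x) (\<omega> x)"
  shows "\<exists>u F. holo_at u 0 \<and> holo_at F 0 \<and> (\<forall>x. u x \<noteq> 0) \<and> (\<forall>\<^sub>F x in nhds 0. \<forall>k. pdiff k F x = u x * \<omega> x $ k)"
proof -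
  obtain g where g: "holo_at g 0" "\<forall>\<^sub>F x in nhds 0. \<forall>k. pdiff k g x = \<eta> x $ k"
    using poincare[OF assms(2,3)] by blast
  define u where "u x = exp (- g x)" for x
  have hu: "holo_at u x" if "holo_at g x" for x unfolding u_def by (intro holo_at_exp holo_at_uminus that)
  have pu: "pdiff k u x = - u x * pdiff k g x" if "holo_at g x" for k x
  proof -
    have "pdiff k (\<lambda>x. - g x) x = - pdiff k g x"
      using pdiff_diff[OF cdiff_const holo_at_imp_cdiff[OF that], of k 0] by (simp add: pdiff_const)
    then show ?thesis unfolding u_def pdiff_exp[OF holo_at_uminus[OF that]] by simp
  qed
  define \<zeta> where "\<zeta> x = u x *s \<omega> x" for x
  have h\<zeta>: "holo_form1_at \<zeta> 0" unfolding holo_form1_at_def \<zeta>_def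
    using hu[OF g(1)] assms(1) by (auto intro: holo_at_mult holo_form1_nth)
  have "\<forall>\<^sub>F x in nhds 0. ext_deriv \<zeta> x = 0"
    using holo_at_eventually[OF g(1)] g(2) tw holo_form1_eventually[OF assms(1)]
  proof eventually_elim
    case (elim x)
    have c: "cdiff u x" "cdiff (\<lambda>y. \<omega> y $ k) x" for k
      using hu[OF elim(1)] holo_form1_nth[OF elim(4)] holo_at_imp_cdiff by blast+
    have "ext_deriv \<zeta> x $ k $ l = 0" for k l
    proof -
      have "ext_deriv \<omega> x $ k $ l = \<eta> x $ k * \<omega> x $ l - \<eta> x $ l * \<omega> x $ k"
        unfolding elim(3) by (simp add: wedge11_def)
      then have d: "pdiff k (\<lambda>y. \<omega> y $ l) x = pdiff l (\<lambda>y. \<omega> y $ k) x + \<eta> x $ k * \<omega> x $ l - \<eta> x $ l * \<omega> x $ k"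
        unfolding ext_deriv_nth by (simp add: algebra_simps)
      have z: "pdiff k (\<lambda>y. \<zeta> y $ l) x = - u x * \<eta> x $ k * \<omega> x $ l + u x * pdiff k (\<lambda>y. \<omega> y $ l) x" for k l
        unfolding \<zeta>_def using pdiff_mult[OF c, of k l] pu[OF elim(1), of k] elim(2) by simp
      show ?thesis unfolding ext_deriv_nth z d by (simp add: algebra_simps)
    qed
    then show ?case by (simp add: vec_eq_iff)
  qed
  from poincare[OF h\<zeta> this] obtain F where "holo_at F 0" "\<forall>\<^sub>F x in nhds 0. \<forall>k. pdiff k F x = \<zeta> x $ k" by blast
  then show ?thesis using hu[OF g(1)]
    by (intro exI[of _ u] exI[of _ F]) (auto simp: \<zeta>_def u_def elim: eventually_mono)
qed

section \<open>Leaves and linear differential equations along them\<close>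

lemma path_chain:
  assumes "cdiff f (\<gamma> t)" "(\<gamma> has_vector_derivative \<gamma>') (at t within A)"
  shows "((\<lambda>t. f (\<gamma> t)) has_vector_derivative fd f (\<gamma> t) \<gamma>') (at t within A)"
proof -
  have "((\<lambda>t. f (\<gamma> t)) has_derivative (\<lambda>h. fd f (\<gamma> t) (h *\<^sub>R \<gamma>'))) (at t within A)"
    using has_derivative_compose[OF assms(2)[unfolded has_vector_derivative_def] cdiff_has_derivative(1)[OF assms(1)]] .
  moreover have "fd f (\<gamma> t) (h *\<^sub>R \<gamma>') = h *\<^sub>R fd f (\<gamma> t) \<gamma>'" for h
    using linear_cmul[OF has_derivative_linear[OF cdiff_has_derivative(1)[OF assms(1)]]] .
  ultimately show ?thesis unfolding has_vector_derivative_def by simp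
qed

lemma open_of_eventually:
  assumes "\<forall>\<^sub>F x in nhds 0. P x"
  shows "\<exists>U. open U \<and> 0 \<in> U \<and> (\<forall>x\<in>U. P x)"
  using assms unfolding eventually_nhds by blast

lemma first_integral_of_differential:
  assumes "holo_at F 0" "\<not> (\<exists>c. \<forall>\<^sub>F x in nhds 0. F x = c)"
    and "\<forall>\<^sub>F x in nhds 0. \<forall>v\<in>K (\<Theta> x). fd F x v = 0"
  shows "holo_first_integral K \<Theta> F"
proof -
  have ev: "\<forall>\<^sub>F x in nhds 0. cdiff F x \<and> (\<forall>v\<in>K (\<Theta> x). fd F x v = 0)"
    using assms(1,3) unfolding holo_at_def by eventually_elim blast
  then obtain U where U: "open U" "0 \<in> U" "\<And>x. x \<in> U \<Longrightarrow> cdiff F x" "\<And>x v. x \<in> U \<Longrightarrow> v \<in> K (\<Theta> x) \<Longrightarrow> fd F x v = 0"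
    using open_of_eventually[OF ev] by blast
  have "F q = F p" if leaf: "q \<in> leaf K \<Theta> U p" for p q
  proof -
    obtain \<gamma> \<gamma>' where g: "\<gamma> 0 = p" "\<gamma> 1 = q" "\<And>t. t \<in> {0..1::real} \<Longrightarrow> (\<gamma> has_vector_derivative \<gamma>' t) (at t within {0..1}) \<and>
       \<gamma> t \<in> U - sing \<Theta> \<and> \<gamma>' t \<in> K (\<Theta> (\<gamma> t))"
      using leaf unfolding leaf_def by blast
    have "((\<lambda>t. F (\<gamma> t)) has_vector_derivative 0) (at t within {0..1})" if t: "t \<in> {0..1}" for t
    proof -
      have "fd F (\<gamma> t) (\<gamma>' t) = 0" using g(3)[OF t] U(4) by blast
      then show ?thesis using path_chain[OF U(3), of \<gamma> t "\<gamma>' t" "{0..1}"] g(3)[OF t] by auto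
    qed
    then obtain c where "\<And>t. t \<in> {0..1} \<Longrightarrow> F (\<gamma> t) = c"
      using has_vector_derivative_zero_constant[of "{0..1::real}" "\<lambda>t. F (\<gamma> t)"] by (metis convex_real_interval(5))
    from this[of 0] this[of 1] g(1,2) show ?thesis by simp
  qed
  then show ?thesis unfolding holo_first_integral_def nonconstant_holo_germ_def using assms(1,2) U(1,2) by blast
qed

text \<open>The product of \<open>\<phi>\<close> with \<open>exp (- \<integral> c)\<close> is constant.\<close>
lemma linear_ode_zero:
  fixes \<phi> c :: "real \<Rightarrow> complex"
  assumes "\<And>t. t \<in> {0..1} \<Longrightarrow> (\<phi> has_vector_derivative c t * \<phi> t) (at t within {0..1})"
    and "continuous_on {0..1} c" "\<phi> 0 = 0"
  shows "\<phi> 1 = 0"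
proof -
  define C where "C t = integral {0..t} c" for t
  have C: "(C has_vector_derivative c t) (at t within {0..1})" if "t \<in> {0..1}" for t
    unfolding C_def using integral_has_vector_derivative[OF assms(2) that] .
  have E: "((\<lambda>t. exp (- C t)) has_vector_derivative - c t * exp (- C t)) (at t within {0..1})" if "t \<in> {0..1}" for t
  proof -
    have "((\<lambda>t. - C t) has_vector_derivative - c t) (at t within {0..1})"
      by (intro has_vector_derivative_minus C that)
    from field_vector_diff_chain_within[OF this, of exp "exp (- C t)"]
    show ?thesis by (simp add: o_def has_field_derivative_at_within)
  qed
  have "((\<lambda>t. exp (- C t) * \<phi> t) has_vector_derivative 0) (at t within {0..1})" if "t \<in> {0..1}" for t
    using has_vector_derivative_mult[OF E[OF that] assms(1)[OF that]] by (simp add: algebra_simps)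
  then obtain k where k: "\<And>t. t \<in> {0..1} \<Longrightarrow> exp (- C t) * \<phi> t = k"
    using has_vector_derivative_zero_constant[of "{0..1::real}" "\<lambda>t. exp (- C t) * \<phi> t"] by (metis convex_real_interval(5))
  from k[of 0] k[of 1] assms(3) show ?thesis by simp
qed

section \<open>Vector fields spanning the kernel of a 2-form\<close>

text \<open>For \<open>\<Omega> = \<alpha> \<and> \<beta>\<close> these are the fields \<open>(\<alpha>\<^sub>j\<beta>\<^sub>k - \<alpha>\<^sub>k\<beta>\<^sub>j) \<partial>\<^sub>i + \<dots>\<close> obtained by expanding a
  determinant with two equal rows, so \<open>\<alpha>\<close> and \<open>\<beta>\<close> kill them. They are holomorphic and, at points where
  \<open>\<Omega> \<noteq> 0\<close>, they span the kernel of \<open>\<Omega>\<close>.\<close>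
definition axis_field :: "complex^'n^'n \<Rightarrow> 'n \<Rightarrow> 'n \<Rightarrow> 'n \<Rightarrow> complex^'n" where
  "axis_field \<Omega> i j k = \<Omega> $ j $ k *s axis i 1 - \<Omega> $ i $ k *s axis j 1 + \<Omega> $ i $ j *s axis k 1"

lemma pairing_linear: "pairing \<alpha> (u + v) = pairing \<alpha> u + pairing \<alpha> v" "pairing \<alpha> (u - v) = pairing \<alpha> u - pairing \<alpha> v" "pairing \<alpha> (c *s v) = c * pairing \<alpha> v"
  unfolding pairing_def by (simp_all add: algebra_simps sum.distrib sum_subtractf sum_distrib_left)

lemma pairing_axis: "pairing \<alpha> (axis k 1) = \<alpha> $ k"
  unfolding pairing_def axis_def by (simp add: if_distrib cong: if_cong)

lemma pairing_axis_field: "pairing \<alpha> (axis_field \<Omega> i j k) = \<alpha> $ i * \<Omega> $ j $ k - \<alpha> $ j * \<Omega> $ i $ k + \<alpha> $ k * \<Omega> $ i $ j"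
  unfolding axis_field_def by (simp add: pairing_linear pairing_axis mult.commute)

text \<open>For \<open>v\<close> in the kernel, \<open>\<Sum>k. v\<^sub>k axis_field i j k = \<Omega>\<^sub>i\<^sub>j v\<close>. The weights \<open>cnj \<Omega>\<^sub>i\<^sub>j\<close> turn the factors on the right
  into \<open>|\<Omega>|\<^sup>2\<close>, which is non-zero wherever \<open>\<Omega>\<close> is; a single formula with continuous coefficients thus
  serves along a whole leaf.\<close>
lemma kernel_span:
  fixes \<Omega> :: "complex^'n^'n"
  assumes "\<And>i j. \<Omega> $ i $ j = - \<Omega> $ j $ i" "v \<in> ker2 \<Omega>"
  shows "(\<Sum>i\<in>UNIV. \<Sum>j\<in>UNIV. cnj (\<Omega> $ i $ j) * \<Omega> $ i $ j) *s v =
     (\<Sum>i\<in>UNIV. \<Sum>j\<in>UNIV. \<Sum>k\<in>UNIV. (cnj (\<Omega> $ i $ j) * v $ k) *s axis_field \<Omega> i j k)"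
proof -
  have z: "(\<Sum>k\<in>UNIV. v $ k * \<Omega> $ j $ k) = 0" for j
  proof -
    have "(\<Sum>k\<in>UNIV. v $ k * \<Omega> $ j $ k) = - (\<Sum>k\<in>UNIV. v $ k * \<Omega> $ k $ j)"
      unfolding assms(1)[of j] by (simp add: sum_negf)
    then show ?thesis using assms(2) by (simp add: ker2_def)
  qed
  have "(\<Sum>k\<in>UNIV. v $ k *s axis_field \<Omega> i j k) = \<Omega> $ i $ j *s v" for i j
  proof -
    have "(\<Sum>k\<in>UNIV. v $ k *s axis_field \<Omega> i j k) = (\<Sum>k\<in>UNIV. v $ k * \<Omega> $ j $ k) *s axis i 1
       - (\<Sum>k\<in>UNIV. v $ k * \<Omega> $ i $ k) *s axis j 1 + \<Omega> $ i $ j *s (\<Sum>k\<in>UNIV. v $ k *s axis k 1)"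
      unfolding axis_field_def
      by (simp add: vec_eq_iff algebra_simps sum.distrib sum_subtractf sum_distrib_left sum_distrib_right)
    then show ?thesis unfolding z by (simp add: basis_expansion)
  qed
  then have *: "\<Omega> $ i $ j *s v = (\<Sum>k\<in>UNIV. v $ k *s axis_field \<Omega> i j k)" for i j by simp
  have "(\<Sum>i\<in>UNIV. \<Sum>j\<in>UNIV. cnj (\<Omega> $ i $ j) * \<Omega> $ i $ j) *s v = (\<Sum>i\<in>UNIV. \<Sum>j\<in>UNIV. cnj (\<Omega> $ i $ j) *s (\<Omega> $ i $ j *s v))"
    by (simp add: vec_eq_iff sum_distrib_right mult.assoc)
  also have "\<dots> = (\<Sum>i\<in>UNIV. \<Sum>j\<in>UNIV. \<Sum>k\<in>UNIV. (cnj (\<Omega> $ i $ j) * v $ k) *s axis_field \<Omega> i j k)"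
    unfolding * by (simp add: vec_eq_iff sum_distrib_left mult.assoc)
  finally show ?thesis .
qed

section \<open>The twisting form of a pencil\<close>

lemma wedge11_nth: "wedge11 \<alpha> \<beta> $ k $ l = \<alpha> $ k * \<beta> $ l - \<alpha> $ l * \<beta> $ k"
  by (simp add: wedge11_def)

text \<open>Pointwise linear algebra behind \<open>d\<alpha> = \<theta> \<and> \<alpha>\<close>, \<open>d\<beta> = \<theta> \<and> \<beta>\<close>. Here \<open>A\<close>, \<open>B\<close> stand for \<open>d\<alpha>\<close>, \<open>d\<beta>\<close>; the assumptions
  are \<open>\<alpha> \<and> A = 0\<close>, \<open>\<beta> \<and> B = 0\<close> and the mixed condition, and \<open>\<mu>\<close> is \<open>\<theta>\<close> multiplied by the minor
  \<open>\<alpha>\<^sub>i\<beta>\<^sub>j - \<alpha>\<^sub>j\<beta>\<^sub>i\<close>.\<close>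
lemma twist_algebra:
  fixes \<alpha> \<beta> :: "'n \<Rightarrow> complex" and A B :: "'n \<Rightarrow> 'n \<Rightarrow> complex"
  assumes a: "\<And>i j k. \<alpha> i * A j k - \<alpha> j * A i k + \<alpha> k * A i j = 0"
    and b: "\<And>i j k. \<beta> i * B j k - \<beta> j * B i k + \<beta> k * B i j = 0"
    and m: "\<And>i j k. \<alpha> i * B j k - \<alpha> j * B i k + \<alpha> k * B i j + (\<beta> i * A j k - \<beta> j * A i k + \<beta> k * A i j) = 0"
    and \<mu>: "\<And>k. \<mu> k = B i j * \<alpha> k - \<beta> j * A i k + \<beta> i * A j k"
  shows "(\<alpha> i * \<beta> j - \<alpha> j * \<beta> i) * A k l = \<mu> k * \<alpha> l - \<mu> l * \<alpha> k"
    and "(\<alpha> i * \<beta> j - \<alpha> j * \<beta> i) * B k l = \<mu> k * \<beta> l - \<mu> l * \<beta> k"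
proof -
  show "(\<alpha> i * \<beta> j - \<alpha> j * \<beta> i) * A k l = \<mu> k * \<alpha> l - \<mu> l * \<alpha> k"
    using a[of i k l] a[of j k l] unfolding \<mu> by algebra
  show "(\<alpha> i * \<beta> j - \<alpha> j * \<beta> i) * B k l = \<mu> k * \<beta> l - \<mu> l * \<beta> k"
    using m[of i k l] m[of j k l] b[of i j k] b[of i j l] unfolding \<mu> by algebra
qed

text \<open>The assumptions say \<open>\<Theta> \<and> \<alpha> = \<Theta> \<and> \<beta> = 0\<close>. In a basis of 1-forms that begins with \<open>\<alpha>, \<beta>\<close>, only the term
  \<open>\<alpha> \<and> \<beta>\<close> of \<open>\<Theta>\<close> survives; its coefficient is read off from the minor with indices \<open>i, j\<close>.\<close>
lemma decomposable_algebra: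
  fixes \<alpha> \<beta> :: "'n \<Rightarrow> complex" and \<Theta> :: "'n \<Rightarrow> 'n \<Rightarrow> complex"
  assumes a: "\<And>m k l. \<Theta> m k * \<alpha> l + \<Theta> k l * \<alpha> m + \<Theta> l m * \<alpha> k = 0"
    and b: "\<And>m k l. \<Theta> m k * \<beta> l + \<Theta> k l * \<beta> m + \<Theta> l m * \<beta> k = 0"
    and nz: "\<alpha> i * \<beta> j - \<alpha> j * \<beta> i \<noteq> 0"
  shows "(\<alpha> i * \<beta> j - \<alpha> j * \<beta> i) * \<Theta> k l = \<Theta> i j * (\<alpha> k * \<beta> l - \<alpha> l * \<beta> k)"
proof -
  let ?D = "\<alpha> i * \<beta> j - \<alpha> j * \<beta> i"
  have s: "?D * \<Theta> k i = - (\<alpha> i * \<beta> k - \<alpha> k * \<beta> i) * \<Theta> i j" for k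
    using a[of i j k] b[of i j k] by algebra
  have ii: "\<Theta> i i = 0"
    using a[of i i j] b[of i i j] a[of i i i] b[of i i i] nz by algebra
  have ik: "\<Theta> i k = - \<Theta> k i" for k
    using a[of i k i] b[of i k i] ii nz by algebra
  have "?D * (?D * \<Theta> k l) = ?D * (\<Theta> i j * (\<alpha> k * \<beta> l - \<alpha> l * \<beta> k))"
    using a[of i k l] b[of i k l] s[of k] s[of l] ik[of k] by algebra
  then show ?thesis using nz by simp
qed

lemma dd_zero:
  assumes "holo_form1_at \<omega> x"
  shows "pdiff m (\<lambda>y. ext_deriv \<omega> y $ k $ l) x + pdiff k (\<lambda>y. ext_deriv \<omega> y $ l $ m) x + pdiff l (\<lambda>y. ext_deriv \<omega> y $ m $ k) x = 0"
proof -
  have h: "holo_at (\<lambda>y. \<omega> y $ k) x" for k using assms by (rule holo_form1_nth)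
  have c: "cdiff (\<lambda>y. pdiff k (\<lambda>y. \<omega> y $ l) y) x" for k l using holo_at_imp_cdiff[OF holo_at_pdiff[OF h]] .
  show ?thesis
    unfolding ext_deriv_nth pdiff_diff[OF c c]
    using pdiff_commute[OF h, of m k l] pdiff_commute[OF h, of k l m] pdiff_commute[OF h, of l m k] by simp
qed

lemma twist_nth: "ext_deriv \<omega> y = wedge11 t (\<omega> y) \<Longrightarrow>
  pdiff k (\<lambda>y. \<omega> y $ l) y - pdiff l (\<lambda>y. \<omega> y $ k) y = t $ k * \<omega> y $ l - t $ l * \<omega> y $ k"
  by (simp add: ext_deriv_nth[symmetric] wedge11_nth)

text \<open>Applying \<open>d\<close> to \<open>d\<omega> = t \<and> \<omega>\<close> gives \<open>0 = dt \<and> \<omega> - t \<and> d\<omega>\<close>, and \<open>t \<and> d\<omega> = t \<and> t \<and> \<omega> = 0\<close>.\<close>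
lemma dtheta_wedge_zero:
  assumes "holo_form1_at \<omega> x" "holo_form1_at t x"
    and tw: "\<forall>\<^sub>F y in nhds x. ext_deriv \<omega> y = wedge11 (t y) (\<omega> y)"
  shows "ext_deriv t x $ m $ k * \<omega> x $ l + ext_deriv t x $ k $ l * \<omega> x $ m + ext_deriv t x $ l $ m * \<omega> x $ k = 0"
proof -
  note c = holo_at_imp_cdiff[OF holo_form1_nth[OF assms(1)]] holo_at_imp_cdiff[OF holo_form1_nth[OF assms(2)]]
  have e: "pdiff m (\<lambda>y. ext_deriv \<omega> y $ k $ l) x =
     (pdiff m (\<lambda>y. t y $ k) x * \<omega> x $ l + t x $ k * pdiff m (\<lambda>y. \<omega> y $ l) x) -
     (pdiff m (\<lambda>y. t y $ l) x * \<omega> x $ k + t x $ l * pdiff m (\<lambda>y. \<omega> y $ k) x)" for m k l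
  proof -
    have "\<forall>\<^sub>F y in nhds x. ext_deriv \<omega> y $ k $ l = t y $ k * \<omega> y $ l - t y $ l * \<omega> y $ k"
      using tw by eventually_elim (simp add: wedge11_nth)
    from pdiff_cong[OF this] show ?thesis
      by (simp only: pdiff_diff[OF cdiff_mult cdiff_mult] pdiff_mult c)
  qed
  note t0 = eventually_nhds_x_imp_x[OF tw]
  show ?thesis
    using dd_zero[OF assms(1), of m k l] twist_nth[OF t0, of m l] twist_nth[OF t0, of k m] twist_nth[OF t0, of l k]
    unfolding e unfolding ext_deriv_nth by algebra
qed

section \<open>The case where the twisting form is not closed\<close>

text \<open>A point near which \<open>\<alpha>, \<beta>\<close> are independent, as seen by the minor with indices \<open>i, j\<close>, share the twisting
  form \<open>t\<close>, and \<open>dt = \<kappa> \<alpha> \<and> \<beta>\<close> with \<open>\<kappa> \<noteq> 0\<close>. At such points everything is holomorphic, and the computation for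
  the case of a non-closed twisting form takes place there.\<close>
definition framed where
  "framed \<alpha> \<beta> t \<kappa> i j x \<longleftrightarrow> holo_form1_at \<alpha> x \<and> holo_form1_at \<beta> x \<and> holo_form1_at t x \<and> holo_at \<kappa> x \<and>
    (\<forall>\<^sub>F y in nhds x. ext_deriv \<alpha> y = wedge11 (t y) (\<alpha> y)) \<and>
    (\<forall>\<^sub>F y in nhds x. ext_deriv \<beta> y = wedge11 (t y) (\<beta> y)) \<and>
    (\<forall>\<^sub>F y in nhds x. \<forall>k l. ext_deriv t y $ k $ l = \<kappa> y * (\<alpha> y $ k * \<beta> y $ l - \<alpha> y $ l * \<beta> y $ k)) \<and>
    \<alpha> x $ i * \<beta> x $ j - \<alpha> x $ j * \<beta> x $ i \<noteq> 0 \<and> \<kappa> x \<noteq> 0"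

lemma eventually_neq: "holo_at f x \<Longrightarrow> f x \<noteq> 0 \<Longrightarrow> \<forall>\<^sub>F y in nhds x. f y \<noteq> 0"
  using tendsto_imp_eventually_ne[OF isCont_nhds[OF holo_at_isCont]] .

lemma framed_eventually:
  assumes "framed \<alpha> \<beta> t \<kappa> i j x"
  shows "\<forall>\<^sub>F y in nhds x. framed \<alpha> \<beta> t \<kappa> i j y"
proof -
  have h: "holo_form1_at \<alpha> x" "holo_form1_at \<beta> x" "holo_form1_at t x" "holo_at \<kappa> x"
    "\<kappa> x \<noteq> 0" "\<alpha> x $ i * \<beta> x $ j - \<alpha> x $ j * \<beta> x $ i \<noteq> 0" using assms unfolding framed_def by blast+
  have 1: "\<forall>\<^sub>F y in nhds x. \<alpha> y $ i * \<beta> y $ j - \<alpha> y $ j * \<beta> y $ i \<noteq> 0"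
    using h(6) by (intro eventually_neq holo_intros holo_form1_nth h(1,2)) auto
  show ?thesis
    using assms unfolding framed_def
    by (intro eventually_conj holo_form1_eventually holo_at_eventually eventually_eventually[THEN iffD2]
        1 eventually_neq[OF h(4,5)]) auto
qed

text \<open>The coefficients of \<open>\<sigma> = d\<kappa> / 2\<kappa>\<close>, formally the logarithmic differential of a square root
  of \<open>\<kappa>\<close>.\<close>
definition half_dlog where "half_dlog \<kappa> l y = pdiff l \<kappa> y / (2 * \<kappa> y)"

text \<open>The coefficients in \<open>t + \<sigma> = P \<alpha> + R \<beta>\<close>, by Cramer's rule for the components \<open>i\<close> and \<open>j\<close>.\<close>
definition coframe_fst where
  "coframe_fst \<alpha> \<beta> t \<kappa> i j y = ((t y $ i + half_dlog \<kappa> i y) * \<beta> y $ j - (t y $ j + half_dlog \<kappa> j y) * \<beta> y $ i) /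
     (\<alpha> y $ i * \<beta> y $ j - \<alpha> y $ j * \<beta> y $ i)"

definition coframe_snd where
  "coframe_snd \<alpha> \<beta> t \<kappa> i j y = (\<alpha> y $ i * (t y $ j + half_dlog \<kappa> j y) - \<alpha> y $ j * (t y $ i + half_dlog \<kappa> i y)) /
     (\<alpha> y $ i * \<beta> y $ j - \<alpha> y $ j * \<beta> y $ i)"

text \<open>Applying \<open>d\<close> to \<open>dt = \<kappa> \<alpha> \<and> \<beta>\<close> gives \<open>0 = (d\<kappa> + 2\<kappa> t) \<and> \<alpha> \<and> \<beta>\<close>, because
  \<open>d(\<alpha> \<and> \<beta>) = 2 t \<and> \<alpha> \<and> \<beta>\<close>. So \<open>t + \<sigma>\<close> is a combination of \<open>\<alpha>\<close> and \<open>\<beta>\<close>.\<close>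
lemma framed_theta:
  assumes "framed \<alpha> \<beta> t \<kappa> i j x"
  shows "t x $ l = coframe_fst \<alpha> \<beta> t \<kappa> i j x * \<alpha> x $ l + coframe_snd \<alpha> \<beta> t \<kappa> i j x * \<beta> x $ l - half_dlog \<kappa> l x"
proof -
  have h: "holo_form1_at \<alpha> x" "holo_form1_at \<beta> x" "holo_form1_at t x" "holo_at \<kappa> x"
    "\<forall>\<^sub>F y in nhds x. ext_deriv \<alpha> y = wedge11 (t y) (\<alpha> y)" "\<forall>\<^sub>F y in nhds x. ext_deriv \<beta> y = wedge11 (t y) (\<beta> y)"
    "\<forall>\<^sub>F y in nhds x. \<forall>k l. ext_deriv t y $ k $ l = \<kappa> y * (\<alpha> y $ k * \<beta> y $ l - \<alpha> y $ l * \<beta> y $ k)"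
    "\<kappa> x \<noteq> 0" "\<alpha> x $ i * \<beta> x $ j - \<alpha> x $ j * \<beta> x $ i \<noteq> 0" using assms unfolding framed_def by blast+
  note c = holo_at_imp_cdiff[OF holo_form1_nth[OF h(1)]] holo_at_imp_cdiff[OF holo_form1_nth[OF h(2)]] holo_at_imp_cdiff[OF h(4)]
  let ?W = "\<lambda>k l. \<alpha> x $ k * \<beta> x $ l - \<alpha> x $ l * \<beta> x $ k"
  have e: "pdiff m (\<lambda>y. ext_deriv t y $ k $ l) x = pdiff m \<kappa> x * ?W k l + \<kappa> x *
      ((pdiff m (\<lambda>y. \<alpha> y $ k) x * \<beta> x $ l + \<alpha> x $ k * pdiff m (\<lambda>y. \<beta> y $ l) x) -
       (pdiff m (\<lambda>y. \<alpha> y $ l) x * \<beta> x $ k + \<alpha> x $ l * pdiff m (\<lambda>y. \<beta> y $ k) x))" for m k l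
  proof -
    have "\<forall>\<^sub>F y in nhds x. ext_deriv t y $ k $ l = \<kappa> y * (\<alpha> y $ k * \<beta> y $ l - \<alpha> y $ l * \<beta> y $ k)"
      using h(7) by eventually_elim blast
    from pdiff_cong[OF this] show ?thesis
      by (simp only: pdiff_mult[OF c(3) cdiff_diff[OF cdiff_mult cdiff_mult]] pdiff_diff[OF cdiff_mult cdiff_mult] pdiff_mult c)
  qed
  note a0 = eventually_nhds_x_imp_x[OF h(5)] and b0 = eventually_nhds_x_imp_x[OF h(6)]
  have cyc: "(pdiff m \<kappa> x + 2 * \<kappa> x * t x $ m) * ?W k l + (pdiff k \<kappa> x + 2 * \<kappa> x * t x $ k) * ?W l m
     + (pdiff l \<kappa> x + 2 * \<kappa> x * t x $ l) * ?W m k = 0" for m k l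
    using dd_zero[OF h(3), of m k l] twist_nth[OF a0, of m k] twist_nth[OF a0, of k l] twist_nth[OF a0, of l m]
      twist_nth[OF b0, of m k] twist_nth[OF b0, of k l] twist_nth[OF b0, of l m]
    unfolding e by algebra
  define T where "T l = t x $ l + half_dlog \<kappa> l x" for l
  have TT: "pdiff l \<kappa> x + 2 * \<kappa> x * t x $ l = 2 * \<kappa> x * T l" for l
    using h(8) by (simp add: T_def half_dlog_def field_simps)
  have "2 * \<kappa> x * (T i * ?W j l + T j * ?W l i + T l * ?W i j) = 0"
    using cyc[of i j l] unfolding TT by algebra
  then have z: "T i * ?W j l + T j * ?W l i + T l * ?W i j = 0" using h(8) by simp
  have "(coframe_fst \<alpha> \<beta> t \<kappa> i j x * \<alpha> x $ l + coframe_snd \<alpha> \<beta> t \<kappa> i j x * \<beta> x $ l) * ?W i j =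
      (T i * \<beta> x $ j - T j * \<beta> x $ i) * \<alpha> x $ l + (\<alpha> x $ i * T j - \<alpha> x $ j * T i) * \<beta> x $ l"
    unfolding coframe_fst_def coframe_snd_def T_def using h(9) by (simp add: distrib_right)
  also have "\<dots> = T l * ?W i j" using z by algebra
  finally have "coframe_fst \<alpha> \<beta> t \<kappa> i j x * \<alpha> x $ l + coframe_snd \<alpha> \<beta> t \<kappa> i j x * \<beta> x $ l = T l" using h(9) by simp
  then show ?thesis unfolding T_def by simp
qed

lemma holo_half_dlog: "holo_at \<kappa> x \<Longrightarrow> \<kappa> x \<noteq> 0 \<Longrightarrow> holo_at (half_dlog \<kappa> l) x"
  unfolding half_dlog_def by (intro holo_at_divide holo_intros holo_at_pdiff) auto

lemma holo_coframe:
  assumes "framed \<alpha> \<beta> t \<kappa> i j x"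
  shows "holo_at (coframe_fst \<alpha> \<beta> t \<kappa> i j) x" "holo_at (coframe_snd \<alpha> \<beta> t \<kappa> i j) x"
  using assms unfolding framed_def coframe_fst_def coframe_snd_def
  by (auto intro!: holo_at_divide holo_intros holo_half_dlog holo_form1_nth)

text \<open>Apply \<open>d\<close> to \<open>t + \<sigma> = P \<alpha> + R \<beta>\<close>, where \<open>\<sigma>\<close> is closed:
  \<open>dt = dP \<and> \<alpha> + dR \<and> \<beta> + t \<and> (P \<alpha> + R \<beta>)\<close>. The last term equals \<open>- \<sigma> \<and> (P \<alpha> + R \<beta>)\<close>, since
  \<open>t + \<sigma>\<close> is itself \<open>P \<alpha> + R \<beta>\<close>.\<close>
lemma framed_coframe:
  assumes "framed \<alpha> \<beta> t \<kappa> i j x"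
  defines "P \<equiv> coframe_fst \<alpha> \<beta> t \<kappa> i j" and "R \<equiv> coframe_snd \<alpha> \<beta> t \<kappa> i j"
  shows "\<kappa> x * (\<alpha> x $ m * \<beta> x $ l - \<alpha> x $ l * \<beta> x $ m) =
     (pdiff m P x - P x * half_dlog \<kappa> m x) * \<alpha> x $ l - (pdiff l P x - P x * half_dlog \<kappa> l x) * \<alpha> x $ m +
     ((pdiff m R x - R x * half_dlog \<kappa> m x) * \<beta> x $ l - (pdiff l R x - R x * half_dlog \<kappa> l x) * \<beta> x $ m)"
proof -
  have h: "holo_form1_at \<alpha> x" "holo_form1_at \<beta> x" "holo_form1_at t x" "holo_at \<kappa> x"
    "\<forall>\<^sub>F y in nhds x. ext_deriv \<alpha> y = wedge11 (t y) (\<alpha> y)" "\<forall>\<^sub>F y in nhds x. ext_deriv \<beta> y = wedge11 (t y) (\<beta> y)"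
    "\<forall>\<^sub>F y in nhds x. \<forall>k l. ext_deriv t y $ k $ l = \<kappa> y * (\<alpha> y $ k * \<beta> y $ l - \<alpha> y $ l * \<beta> y $ k)"
    "\<kappa> x \<noteq> 0" using assms(1) unfolding framed_def by blast+
  note hc = holo_coframe[OF assms(1), folded P_def R_def]
  note c = holo_at_imp_cdiff[OF holo_form1_nth[OF h(1)]] holo_at_imp_cdiff[OF holo_form1_nth[OF h(2)]] holo_at_imp_cdiff[OF h(4)]
    holo_at_imp_cdiff[OF hc(1)] holo_at_imp_cdiff[OF hc(2)] holo_at_imp_cdiff[OF holo_half_dlog[OF h(4,8)]]
  have e: "pdiff m (\<lambda>y. t y $ l) x = pdiff m P x * \<alpha> x $ l + P x * pdiff m (\<lambda>y. \<alpha> y $ l) x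
     + (pdiff m R x * \<beta> x $ l + R x * pdiff m (\<lambda>y. \<beta> y $ l) x) - pdiff m (half_dlog \<kappa> l) x" for m l
  proof -
    have "\<forall>\<^sub>F y in nhds x. t y $ l = (P y * \<alpha> y $ l + R y * \<beta> y $ l) - half_dlog \<kappa> l y"
      using framed_eventually[OF assms(1)] unfolding P_def R_def by eventually_elim (rule framed_theta)
    from pdiff_cong[OF this] show ?thesis
      by (simp only: pdiff_diff[OF cdiff_add[OF cdiff_mult cdiff_mult]] pdiff_add[OF cdiff_mult cdiff_mult] pdiff_mult c)
  qed
  have s: "pdiff m (half_dlog \<kappa> l) x = pdiff l (half_dlog \<kappa> m) x" for m l
  proof -
    have cc: "cdiff (\<lambda>y. pdiff l \<kappa> y) x" for l by (rule holo_at_imp_cdiff[OF holo_at_pdiff[OF h(4)]])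
    have "pdiff m (half_dlog \<kappa> l) x = (pdiff m (\<lambda>y. pdiff l \<kappa> y) x * (2 * \<kappa> x) - pdiff l \<kappa> x * (2 * pdiff m \<kappa> x)) / (2 * \<kappa> x)\<^sup>2" for m l
      unfolding half_dlog_def using pdiff_divide[OF cc cdiff_mult[OF cdiff_const c(3)], of 2 m l] h(8)
      by (simp add: pdiff_mult[OF cdiff_const c(3)] pdiff_const)
    then show ?thesis using pdiff_commute[OF h(4), of m l] by simp
  qed
  note a0 = eventually_nhds_x_imp_x[OF h(5)] and b0 = eventually_nhds_x_imp_x[OF h(6)]
  have t0: "t x $ l = P x * \<alpha> x $ l + R x * \<beta> x $ l - half_dlog \<kappa> l x" for l
    unfolding P_def R_def by (rule framed_theta[OF assms(1)])
  have "ext_deriv t x $ m $ l = \<kappa> x * (\<alpha> x $ m * \<beta> x $ l - \<alpha> x $ l * \<beta> x $ m)"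
    using eventually_nhds_x_imp_x[OF h(7)] by blast
  then show ?thesis
    using twist_nth[OF a0, of m l] twist_nth[OF b0, of m l] s[of m l] t0[of m] t0[of l]
    unfolding ext_deriv_nth e[of m l] e[of l m] by algebra
qed

lemma two_by_two:
  fixes a b c d u w :: complex
  assumes "u * a + w * b = 0" "u * c + w * d = 0" "a * d - c * b \<noteq> 0"
  shows "u = 0" "w = 0"
proof -
  have "u * (a * d - c * b) = 0" "w * (a * d - c * b) = 0" using assms(1,2) by algebra+
  with assms(3) show "u = 0" "w = 0" by auto
qed

text \<open>Contract the identity of \<open>framed_coframe\<close> with \<open>v\<close>. The left-hand side and the terms containing \<open>\<alpha>(v)\<close> or
  \<open>\<beta>(v)\<close> vanish, and independence of \<open>\<alpha>, \<beta>\<close> leaves \<open>dP(v) = P \<sigma>(v)\<close> and \<open>dR(v) = R \<sigma>(v)\<close>. So \<open>P\<close> and \<open>R\<close>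
  vary along the axis like multiples of a square root of \<open>\<kappa>\<close>.\<close>
lemma framed_first_integrals:
  assumes fr: "framed \<alpha> \<beta> t \<kappa> i j x" and v: "pairing (\<alpha> x) v = 0" "pairing (\<beta> x) v = 0"
  defines "P \<equiv> coframe_fst \<alpha> \<beta> t \<kappa> i j" and "R \<equiv> coframe_snd \<alpha> \<beta> t \<kappa> i j"
  shows "fd (\<lambda>x. P x * P x / \<kappa> x) x v = 0" "fd (\<lambda>x. R x * R x / \<kappa> x) x v = 0"
proof -
  have h: "holo_at \<kappa> x" "\<kappa> x \<noteq> 0" "\<alpha> x $ i * \<beta> x $ j - \<alpha> x $ j * \<beta> x $ i \<noteq> 0"
    using fr unfolding framed_def by blast+
  note hc = holo_coframe[OF fr, folded P_def R_def]
  note c = holo_at_imp_cdiff[OF h(1)] holo_at_imp_cdiff[OF hc(1)] holo_at_imp_cdiff[OF hc(2)]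
  define \<pi> where "\<pi> m = pdiff m P x - P x * half_dlog \<kappa> m x" for m
  define \<rho> where "\<rho> m = pdiff m R x - R x * half_dlog \<kappa> m x" for m
  define U where "U = (\<Sum>m\<in>UNIV. v $ m * \<pi> m)"
  define V where "V = (\<Sum>m\<in>UNIV. v $ m * \<rho> m)"
  have star: "\<kappa> x * (\<alpha> x $ m * \<beta> x $ l - \<alpha> x $ l * \<beta> x $ m) =
     \<pi> m * \<alpha> x $ l - \<pi> l * \<alpha> x $ m + (\<rho> m * \<beta> x $ l - \<rho> l * \<beta> x $ m)" for m l
    unfolding \<pi>_def \<rho>_def P_def R_def by (rule framed_coframe[OF fr])
  have "U * \<alpha> x $ l + V * \<beta> x $ l = 0" for l
  proof -
    have "(\<Sum>m\<in>UNIV. v $ m * (\<kappa> x * (\<alpha> x $ m * \<beta> x $ l - \<alpha> x $ l * \<beta> x $ m))) =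
      (\<Sum>m\<in>UNIV. v $ m * (\<pi> m * \<alpha> x $ l - \<pi> l * \<alpha> x $ m + (\<rho> m * \<beta> x $ l - \<rho> l * \<beta> x $ m)))"
      unfolding star ..
    moreover have "(\<Sum>m\<in>UNIV. v $ m * (\<kappa> x * (\<alpha> x $ m * \<beta> x $ l - \<alpha> x $ l * \<beta> x $ m))) =
      \<kappa> x * (pairing (\<alpha> x) v * \<beta> x $ l - \<alpha> x $ l * pairing (\<beta> x) v)"
      unfolding pairing_def by (simp add: algebra_simps sum_subtractf sum_distrib_left)
    moreover have "(\<Sum>m\<in>UNIV. v $ m * (\<pi> m * \<alpha> x $ l - \<pi> l * \<alpha> x $ m + (\<rho> m * \<beta> x $ l - \<rho> l * \<beta> x $ m))) =
      U * \<alpha> x $ l - \<pi> l * pairing (\<alpha> x) v + (V * \<beta> x $ l - \<rho> l * pairing (\<beta> x) v)"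
      unfolding pairing_def U_def V_def by (simp add: algebra_simps sum_subtractf sum.distrib sum_distrib_left)
    ultimately show ?thesis using v by simp
  qed
  then have "U = 0" "V = 0" using two_by_two[of U "\<alpha> x $ i" V "\<beta> x $ i" "\<alpha> x $ j" "\<beta> x $ j"] h(3)
    by (auto simp: algebra_simps)
  have kv: "(\<Sum>m\<in>UNIV. v $ m * half_dlog \<kappa> m x) = fd \<kappa> x v / (2 * \<kappa> x)"
    unfolding half_dlog_def fd_expand[OF c(1)] by (simp add: sum_divide_distrib)
  have "U = fd P x v - P x * (fd \<kappa> x v / (2 * \<kappa> x))"
    unfolding U_def \<pi>_def fd_expand[OF c(2)] kv[symmetric] by (simp add: algebra_simps sum_subtractf sum_distrib_left)
  then have fP: "fd P x v = P x * (fd \<kappa> x v / (2 * \<kappa> x))" using \<open>U = 0\<close> by simp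
  have "V = fd R x v - R x * (fd \<kappa> x v / (2 * \<kappa> x))"
    unfolding V_def \<rho>_def fd_expand[OF c(3)] kv[symmetric] by (simp add: algebra_simps sum_subtractf sum_distrib_left)
  then have fR: "fd R x v = R x * (fd \<kappa> x v / (2 * \<kappa> x))" using \<open>V = 0\<close> by simp
  show "fd (\<lambda>x. P x * P x / \<kappa> x) x v = 0"
    unfolding fd_divide[OF cdiff_mult[OF c(2) c(2)] c(1) h(2)] fd_mult[OF c(2) c(2)] fP using h(2) by (simp add: field_simps)
  show "fd (\<lambda>x. R x * R x / \<kappa> x) x v = 0"
    unfolding fd_divide[OF cdiff_mult[OF c(3) c(3)] c(1) h(2)] fd_mult[OF c(3) c(3)] fR using h(2) by (simp add: field_simps)
qed

lemma constant_square_quotient: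
  assumes "holo_at P x" "holo_at \<kappa> x" "\<kappa> x \<noteq> 0" "\<forall>\<^sub>F y in nhds x. P y * P y / \<kappa> y = c"
  shows "pdiff m P x = P x * half_dlog \<kappa> m x"
proof -
  note cd = holo_at_imp_cdiff[OF assms(1)] holo_at_imp_cdiff[OF assms(2)]
  have "pdiff m (\<lambda>y. P y * P y / \<kappa> y) x = 0" using pdiff_cong[OF assms(4)] by (simp add: pdiff_const)
  then have e: "2 * P x * pdiff m P x * \<kappa> x = P x * P x * pdiff m \<kappa> x"
    unfolding pdiff_divide[OF cdiff_mult[OF cd(1) cd(1)] cd(2) assms(3)] pdiff_mult[OF cd(1) cd(1)]
    using assms(3) by (simp add: algebra_simps)
  show ?thesis
  proof (cases "P x = 0")
    case True
    then have "c = 0" using eventually_nhds_x_imp_x[OF assms(4)] by simp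
    have "\<forall>\<^sub>F y in nhds x. P y = 0"
      using assms(4) eventually_neq[OF assms(2,3)] by eventually_elim (simp add: \<open>c = 0\<close>)
    from pdiff_cong[OF this] True show ?thesis by (simp add: pdiff_const)
  next
    case False
    then have "2 * pdiff m P x * \<kappa> x = P x * pdiff m \<kappa> x" using e by (simp add: mult_ac)
    then show ?thesis using assms(3) by (simp add: half_dlog_def field_simps)
  qed
qed

text \<open>If both are constant, then \<open>dP = P \<sigma>\<close> and \<open>dR = R \<sigma>\<close>, and \<open>framed_coframe\<close> reads \<open>\<kappa> \<alpha> \<and> \<beta> = 0\<close>.\<close>
lemma framed_not_both_constant:
  assumes fr: "framed \<alpha> \<beta> t \<kappa> i j x"
  defines "P \<equiv> coframe_fst \<alpha> \<beta> t \<kappa> i j" and "R \<equiv> coframe_snd \<alpha> \<beta> t \<kappa> i j"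
  assumes "\<forall>\<^sub>F y in nhds x. P y * P y / \<kappa> y = c" "\<forall>\<^sub>F y in nhds x. R y * R y / \<kappa> y = d"
  shows False
proof -
  have h: "holo_at \<kappa> x" "\<kappa> x \<noteq> 0" "\<alpha> x $ i * \<beta> x $ j - \<alpha> x $ j * \<beta> x $ i \<noteq> 0"
    using fr unfolding framed_def by blast+
  note hc = holo_coframe[OF fr, folded P_def R_def]
  have "\<kappa> x * (\<alpha> x $ i * \<beta> x $ j - \<alpha> x $ j * \<beta> x $ i) = 0"
    using framed_coframe[OF fr, of i j, folded P_def R_def] constant_square_quotient[OF hc(1) h(1,2) assms(4)]
      constant_square_quotient[OF hc(2) h(1,2) assms(5)] by simp
  with h(2,3) show False by simp
qed

section \<open>A closed twisting form or a first integral of the axis\<close>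

lemma ext_deriv_combination:
  assumes "holo_form1_at \<alpha> x" "holo_form1_at \<beta> x"
  shows "ext_deriv (\<lambda>x. a *s \<alpha> x + b *s \<beta> x) x $ k $ l = a * ext_deriv \<alpha> x $ k $ l + b * ext_deriv \<beta> x $ k $ l"
proof -
  note c = holo_at_imp_cdiff[OF holo_form1_nth[OF assms(1)]] holo_at_imp_cdiff[OF holo_form1_nth[OF assms(2)]]
  have "pdiff k (\<lambda>x. (a *s \<alpha> x + b *s \<beta> x) $ l) x = a * pdiff k (\<lambda>x. \<alpha> x $ l) x + b * pdiff k (\<lambda>x. \<beta> x $ l) x" for k l
    using pdiff_add[OF cdiff_mult[OF cdiff_const c(1)] cdiff_mult[OF cdiff_const c(2)], of k a l b l]
    by (simp add: pdiff_mult[OF cdiff_const c(1)] pdiff_mult[OF cdiff_const c(2)] pdiff_const)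
  then show ?thesis unfolding ext_deriv_nth by (simp add: algebra_simps)
qed

text \<open>The mixed identity is the polarisation of integrability, read off from \<open>\<omega>1 + \<omega>2\<close>.\<close>
lemma integrable_pencil_identities:
  assumes "integrable_pencil \<omega>1 \<omega>2"
  shows "\<forall>\<^sub>F x in nhds 0. \<forall>i j k.
     \<omega>1 x $ i * ext_deriv \<omega>1 x $ j $ k - \<omega>1 x $ j * ext_deriv \<omega>1 x $ i $ k + \<omega>1 x $ k * ext_deriv \<omega>1 x $ i $ j = 0 \<and>
     \<omega>2 x $ i * ext_deriv \<omega>2 x $ j $ k - \<omega>2 x $ j * ext_deriv \<omega>2 x $ i $ k + \<omega>2 x $ k * ext_deriv \<omega>2 x $ i $ j = 0 \<and>
     \<omega>1 x $ i * ext_deriv \<omega>2 x $ j $ k - \<omega>1 x $ j * ext_deriv \<omega>2 x $ i $ k + \<omega>1 x $ k * ext_deriv \<omega>2 x $ i $ j +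
     (\<omega>2 x $ i * ext_deriv \<omega>1 x $ j $ k - \<omega>2 x $ j * ext_deriv \<omega>1 x $ i $ k + \<omega>2 x $ k * ext_deriv \<omega>1 x $ i $ j) = 0"
proof -
  have h: "holo_form1_at \<omega>1 0" "holo_form1_at \<omega>2 0" using assms unfolding integrable_pencil_def by blast+
  have "integrable_form (\<lambda>x. a *s \<omega>1 x + b *s \<omega>2 x)" for a b
    using assms unfolding integrable_pencil_def pencil_def by blast
  then have I: "\<forall>\<^sub>F x in nhds 0. wedge12 (a *s \<omega>1 x + b *s \<omega>2 x) (ext_deriv (\<lambda>x. a *s \<omega>1 x + b *s \<omega>2 x) x) = 0" for a b
    unfolding integrable_form_def zero_germ_def by blast
  show ?thesis
    using I[of 1 0] I[of 0 1] I[of 1 1] holo_form1_eventually[OF h(1)] holo_form1_eventually[OF h(2)]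
  proof eventually_elim
    case (elim x)
    note ed = ext_deriv_combination[OF elim(4,5)]
    have w: "(a * \<omega>1 x $ i + b * \<omega>2 x $ i) * (a * ext_deriv \<omega>1 x $ j $ k + b * ext_deriv \<omega>2 x $ j $ k)
        - (a * \<omega>1 x $ j + b * \<omega>2 x $ j) * (a * ext_deriv \<omega>1 x $ i $ k + b * ext_deriv \<omega>2 x $ i $ k)
        + (a * \<omega>1 x $ k + b * \<omega>2 x $ k) * (a * ext_deriv \<omega>1 x $ i $ j + b * ext_deriv \<omega>2 x $ i $ j) = 0"
      if "wedge12 (a *s \<omega>1 x + b *s \<omega>2 x) (ext_deriv (\<lambda>x. a *s \<omega>1 x + b *s \<omega>2 x) x) = 0" for a b i j k
      using arg_cong[OF that, of "\<lambda>w. w $ i $ j $ k"] unfolding wedge12_def by (simp add: ed)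
    show ?case
    proof (intro allI)
      fix i j k
      have 1: "\<omega>1 x $ i * ext_deriv \<omega>1 x $ j $ k - \<omega>1 x $ j * ext_deriv \<omega>1 x $ i $ k + \<omega>1 x $ k * ext_deriv \<omega>1 x $ i $ j = 0"
        using w[OF elim(1), of i j k] by simp
      have 2: "\<omega>2 x $ i * ext_deriv \<omega>2 x $ j $ k - \<omega>2 x $ j * ext_deriv \<omega>2 x $ i $ k + \<omega>2 x $ k * ext_deriv \<omega>2 x $ i $ j = 0"
        using w[OF elim(2), of i j k] by simp
      have "\<omega>1 x $ i * ext_deriv \<omega>2 x $ j $ k - \<omega>1 x $ j * ext_deriv \<omega>2 x $ i $ k + \<omega>1 x $ k * ext_deriv \<omega>2 x $ i $ j +
         (\<omega>2 x $ i * ext_deriv \<omega>1 x $ j $ k - \<omega>2 x $ j * ext_deriv \<omega>1 x $ i $ k + \<omega>2 x $ k * ext_deriv \<omega>1 x $ i $ j) = 0"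
        using w[OF elim(3), of i j k] 1 2 unfolding mult_1 by algebra
      with 1 2 show "\<omega>1 x $ i * ext_deriv \<omega>1 x $ j $ k - \<omega>1 x $ j * ext_deriv \<omega>1 x $ i $ k + \<omega>1 x $ k * ext_deriv \<omega>1 x $ i $ j = 0 \<and>
         \<omega>2 x $ i * ext_deriv \<omega>2 x $ j $ k - \<omega>2 x $ j * ext_deriv \<omega>2 x $ i $ k + \<omega>2 x $ k * ext_deriv \<omega>2 x $ i $ j = 0 \<and>
         \<omega>1 x $ i * ext_deriv \<omega>2 x $ j $ k - \<omega>1 x $ j * ext_deriv \<omega>2 x $ i $ k + \<omega>1 x $ k * ext_deriv \<omega>2 x $ i $ j +
         (\<omega>2 x $ i * ext_deriv \<omega>1 x $ j $ k - \<omega>2 x $ j * ext_deriv \<omega>1 x $ i $ k + \<omega>2 x $ k * ext_deriv \<omega>1 x $ i $ j) = 0"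
        by blast
    qed
  qed
qed

lemma nonzero_minor:
  fixes \<omega>1 \<omega>2 :: "complex^'n \<Rightarrow> complex^'n"
  assumes "\<not> zero_germ (\<lambda>x. wedge11 (\<omega>1 x) (\<omega>2 x))"
  shows "\<exists>i j. \<not> zero_germ (\<lambda>x. \<omega>1 x $ i * \<omega>2 x $ j - \<omega>1 x $ j * \<omega>2 x $ i)"
proof (rule ccontr)
  assume "\<not> ?thesis"
  then have "\<forall>\<^sub>F x in nhds 0. \<forall>i j. \<omega>1 x $ i * \<omega>2 x $ j - \<omega>1 x $ j * \<omega>2 x $ i = 0"
    unfolding zero_germ_def by (intro eventually_all_fin) blast
  then have "\<forall>\<^sub>F x in nhds 0. wedge11 (\<omega>1 x) (\<omega>2 x) = 0"
    by eventually_elim (simp add: vec_eq_iff wedge11_nth)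
  with assms show False unfolding zero_germ_def by blast
qed

lemma twists_pencilI:
  assumes h: "holo_form1_at \<omega>1 0" "holo_form1_at \<omega>2 0"
    and "\<forall>\<^sub>F x in nhds 0. holo_form1_at \<theta> x \<longrightarrow> ext_deriv \<omega>1 x = wedge11 (\<theta> x) (\<omega>1 x)"
    "\<forall>\<^sub>F x in nhds 0. holo_form1_at \<theta> x \<longrightarrow> ext_deriv \<omega>2 x = wedge11 (\<theta> x) (\<omega>2 x)"
  shows "twists_pencil \<theta> (pencil \<omega>1 \<omega>2)"
  unfolding twists_pencil_def pencil_def
proof clarify
  fix a b
  show "\<forall>\<^sub>F x in nhds 0. holo_form1_at \<theta> x \<longrightarrow>
      ext_deriv (\<lambda>x. a *s \<omega>1 x + b *s \<omega>2 x) x = wedge11 (\<theta> x) (a *s \<omega>1 x + b *s \<omega>2 x)"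
    using assms(3,4) holo_form1_eventually[OF h(1)] holo_form1_eventually[OF h(2)]
  proof eventually_elim
    case (elim x)
    show ?case
    proof
      assume t: "holo_form1_at \<theta> x"
      show "ext_deriv (\<lambda>x. a *s \<omega>1 x + b *s \<omega>2 x) x = wedge11 (\<theta> x) (a *s \<omega>1 x + b *s \<omega>2 x)"
        using elim(1,2)[rule_format, OF t]
        by (simp add: vec_eq_iff ext_deriv_combination[OF elim(3,4)] wedge11_nth)
           (simp add: algebra_simps)
    qed
  qed
qed

text \<open>The derivative of \<open>f\<close> is tested on the common kernel of the two forms and off a hypersurface, as this is
  what the computation yields. Passing to the reduced 2-form of the axis foliation takes
  vector fields and density (\<open>meromorphic_axis_integral_tangent\<close>).\<close>
definition meromorphic_axis_integral where
  "meromorphic_axis_integral \<omega>1 \<omega>2 f \<longleftrightarrow> nonconstant_mero_germ f \<and> (\<exists>q. holo_at q 0 \<and> \<not> zero_germ q \<and>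
     (\<forall>\<^sub>F x in nhds 0. q x \<noteq> 0 \<longrightarrow> holo_at f x \<and> (\<forall>v. pairing (\<omega>1 x) v = 0 \<longrightarrow> pairing (\<omega>2 x) v = 0 \<longrightarrow> fd f x v = 0)))"

theorem pencil_dichotomy:
  fixes \<omega>1 \<omega>2 :: "complex^'n \<Rightarrow> complex^'n"
  assumes ip: "integrable_pencil \<omega>1 \<omega>2"
  shows "(\<exists>\<theta>. closed_mero_form1 \<theta> \<and> twists_pencil \<theta> (pencil \<omega>1 \<omega>2)) \<or> (\<exists>f. meromorphic_axis_integral \<omega>1 \<omega>2 f)"
proof -
  have h: "holo_form1_at \<omega>1 0" "holo_form1_at \<omega>2 0" and nw: "\<not> zero_germ (\<lambda>x. wedge11 (\<omega>1 x) (\<omega>2 x))"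
    using ip unfolding integrable_pencil_def by blast+
  obtain i j where nD: "\<not> zero_germ (\<lambda>x. \<omega>1 x $ i * \<omega>2 x $ j - \<omega>1 x $ j * \<omega>2 x $ i)"
    using nonzero_minor[OF nw] by blast
  define \<Delta> where "\<Delta> x = \<omega>1 x $ i * \<omega>2 x $ j - \<omega>1 x $ j * \<omega>2 x $ i" for x
  define \<mu> where "\<mu> x = (\<chi> k. ext_deriv \<omega>2 x $ i $ j * \<omega>1 x $ k - \<omega>2 x $ j * ext_deriv \<omega>1 x $ i $ k + \<omega>2 x $ i * ext_deriv \<omega>1 x $ j $ k)" for x
  define \<theta> where "\<theta> x = (1 / \<Delta> x) *s \<mu> x" for x
  have nD: "\<not> zero_germ \<Delta>" using nD unfolding \<Delta>_def .
  have hd: "holo_at (\<lambda>x. ext_deriv \<omega> x $ k $ l) x" if "holo_form1_at \<omega> x" for \<omega> :: "complex^'n \<Rightarrow> complex^'n" and k l x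
    unfolding ext_deriv_nth by (intro holo_at_diff holo_at_pdiff holo_form1_nth that)
  have h\<Delta>: "holo_at \<Delta> x" and h\<mu>: "holo_form1_at \<mu> x" if "holo_form1_at \<omega>1 x" "holo_form1_at \<omega>2 x" for x
    unfolding \<Delta>_def \<mu>_def holo_form1_at_def using that
    by (auto intro!: holo_intros holo_form1_nth hd)
  have h\<theta>: "holo_form1_at \<theta> x" if "holo_form1_at \<omega>1 x" "holo_form1_at \<omega>2 x" "\<Delta> x \<noteq> 0" for x
    unfolding \<theta>_def holo_form1_at_def using that
    by (auto intro!: holo_at_divide h\<Delta> holo_form1_nth h\<mu>)
  have tw: "\<forall>\<^sub>F x in nhds 0. \<Delta> x \<noteq> 0 \<longrightarrow> ext_deriv \<omega>1 x = wedge11 (\<theta> x) (\<omega>1 x) \<and> ext_deriv \<omega>2 x = wedge11 (\<theta> x) (\<omega>2 x)"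
    using integrable_pencil_identities[OF ip]
  proof eventually_elim
    case (elim x)
    have "\<Delta> x * ext_deriv \<omega>1 x $ k $ l = \<mu> x $ k * \<omega>1 x $ l - \<mu> x $ l * \<omega>1 x $ k \<and>
       \<Delta> x * ext_deriv \<omega>2 x $ k $ l = \<mu> x $ k * \<omega>2 x $ l - \<mu> x $ l * \<omega>2 x $ k" for k l
      unfolding \<Delta>_def
      using twist_algebra[of "\<lambda>k. \<omega>1 x $ k" "\<lambda>k l. ext_deriv \<omega>1 x $ k $ l" "\<lambda>k. \<omega>2 x $ k" "\<lambda>k l. ext_deriv \<omega>2 x $ k $ l" "\<lambda>k. \<mu> x $ k" i j k l]
        elim by (simp add: \<mu>_def)
    then show ?case by (auto simp: vec_eq_iff wedge11_nth \<theta>_def field_simps)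
  qed
  \<comment> \<open>From \<open>\<theta> = \<mu>/\<Delta>\<close> one gets \<open>d\<theta>\<^sub>i\<^sub>j = N/\<Delta>\<^sup>2\<close>; dividing by the minor \<open>\<Delta>\<close> of \<open>\<omega>1 \<and> \<omega>2\<close> gives \<open>\<kappa> = N/\<Delta>\<^sup>3\<close>.\<close>
  define N where "N x = \<Delta> x * ext_deriv \<mu> x $ i $ j - (pdiff i \<Delta> x * \<mu> x $ j - pdiff j \<Delta> x * \<mu> x $ i)" for x
  define \<kappa> where "\<kappa> x = N x / (\<Delta> x * \<Delta> x * \<Delta> x)" for x
  have hN: "holo_at N x" if "holo_form1_at \<omega>1 x" "holo_form1_at \<omega>2 x" for x
    unfolding N_def using that by (intro holo_intros hd h\<Delta> h\<mu> holo_at_pdiff holo_form1_nth)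
  have ev: "\<forall>\<^sub>F x in nhds 0. holo_form1_at \<omega>1 x \<and> holo_form1_at \<omega>2 x \<and>
     (\<Delta> x \<noteq> 0 \<longrightarrow> ext_deriv \<omega>1 x = wedge11 (\<theta> x) (\<omega>1 x) \<and> ext_deriv \<omega>2 x = wedge11 (\<theta> x) (\<omega>2 x))"
    by (intro eventually_conj tw holo_form1_eventually h)
  have dth: "\<forall>\<^sub>F x in nhds 0. \<Delta> x \<noteq> 0 \<longrightarrow> (\<forall>k l. ext_deriv \<theta> x $ k $ l = \<kappa> x * (\<omega>1 x $ k * \<omega>2 x $ l - \<omega>1 x $ l * \<omega>2 x $ k))"
    using ev ev[THEN eventually_eventually[THEN iffD2]]
  proof eventually_elim
    case (elim x)
    show ?case
    proof (intro impI allI)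
      fix k l assume nz: "\<Delta> x \<noteq> 0"
      have x: "holo_form1_at \<omega>1 x" "holo_form1_at \<omega>2 x" using elim(1) by blast+
      have "\<forall>\<^sub>F y in nhds x. ext_deriv \<omega>1 y = wedge11 (\<theta> y) (\<omega>1 y)" "\<forall>\<^sub>F y in nhds x. ext_deriv \<omega>2 y = wedge11 (\<theta> y) (\<omega>2 y)"
        using elim(2) eventually_neq[OF h\<Delta>[OF x] nz] by (eventually_elim; blast)+
      note dw = dtheta_wedge_zero[OF x(1) h\<theta>[OF x nz] this(1)] dtheta_wedge_zero[OF x(2) h\<theta>[OF x nz] this(2)]
      have dec: "\<Delta> x * ext_deriv \<theta> x $ k $ l = ext_deriv \<theta> x $ i $ j * (\<omega>1 x $ k * \<omega>2 x $ l - \<omega>1 x $ l * \<omega>2 x $ k)"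
        unfolding \<Delta>_def using dw nz
        by (intro decomposable_algebra[of "\<lambda>k l. ext_deriv \<theta> x $ k $ l" "\<lambda>k. \<omega>1 x $ k" "\<lambda>k. \<omega>2 x $ k"]) (auto simp: \<Delta>_def)
      have cd: "cdiff \<Delta> x" "cdiff (\<lambda>y. \<mu> y $ k) x" for k
        using holo_at_imp_cdiff[OF h\<Delta>[OF x]] holo_at_imp_cdiff[OF holo_form1_nth[OF h\<mu>[OF x]]] by blast+
      have "pdiff k (\<lambda>y. \<theta> y $ l) x = (pdiff k (\<lambda>y. \<mu> y $ l) x * \<Delta> x - \<mu> x $ l * pdiff k \<Delta> x) / (\<Delta> x)\<^sup>2" for k l
        using pdiff_divide[OF cd(2) cd(1) nz, of k l] by (simp add: \<theta>_def)
      then have "ext_deriv \<theta> x $ i $ j = N x / (\<Delta> x)\<^sup>2"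
        unfolding ext_deriv_nth N_def by (simp add: diff_divide_distrib[symmetric] algebra_simps)
      then have "ext_deriv \<theta> x $ i $ j = \<Delta> x * \<kappa> x" using nz by (simp add: \<kappa>_def power2_eq_square)
      then show "ext_deriv \<theta> x $ k $ l = \<kappa> x * (\<omega>1 x $ k * \<omega>2 x $ l - \<omega>1 x $ l * \<omega>2 x $ k)"
        using dec nz by simp
    qed
  qed
  show ?thesis
  proof (cases "zero_germ N")
    case True
    have "mero_form1 \<theta>"
      unfolding mero_form1_def mero_germ_def
    proof
      fix k
      show "\<exists>p q. holo_at p 0 \<and> holo_at q 0 \<and> \<not> zero_germ q \<and> (\<forall>\<^sub>F x in nhds 0. q x \<noteq> 0 \<longrightarrow> \<theta> x $ k = p x / q x)"
        by (rule exI[of _ "\<lambda>x. \<mu> x $ k"], rule exI[of _ \<Delta>])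
           (simp add: \<theta>_def h\<Delta>[OF h] nD holo_form1_nth[OF h\<mu>[OF h]])
    qed
    moreover have "\<forall>\<^sub>F x in nhds 0. \<Delta> x \<noteq> 0 \<longrightarrow> ext_deriv \<theta> x = 0"
      using dth True[unfolded zero_germ_def] by eventually_elim (auto simp: vec_eq_iff \<kappa>_def)
    from closed_dense[OF h\<Delta>[OF h] nD this]
    have "\<forall>\<^sub>F x in nhds 0. holo_form1_at \<theta> x \<longrightarrow> ext_deriv \<theta> x = 0" .
    ultimately have "closed_mero_form1 \<theta>" unfolding closed_mero_form1_def by blast
    moreover have "twists_pencil \<theta> (pencil \<omega>1 \<omega>2)"
      by (intro twists_pencilI h twist_dense[OF h\<Delta>[OF h] nD])
         (use tw in \<open>eventually_elim, blast\<close>)+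
    ultimately show ?thesis by blast
  next
    case nN: False
    define P where "P = coframe_fst \<omega>1 \<omega>2 \<theta> \<kappa> i j"
    define R where "R = coframe_snd \<omega>1 \<omega>2 \<theta> \<kappa> i j"
    \<comment> \<open>The common denominator of \<open>P\<^sup>2/\<kappa>\<close> and \<open>R\<^sup>2/\<kappa>\<close>.\<close>
    define q where "q x = 4 * (N x * N x * N x * \<Delta> x)" for x
    have hq: "holo_at q 0" unfolding q_def by (intro holo_intros hN h h\<Delta>)
    have nq: "\<not> zero_germ q"
    proof
      assume "zero_germ q"
      then have "zero_germ (\<lambda>x. N x * N x * N x * \<Delta> x)" unfolding zero_germ_def q_def by eventually_elim simp
      moreover have "\<not> zero_germ (\<lambda>x. N x * N x * N x * \<Delta> x)"
        by (intro zero_germ_mult holo_intros hN h h\<Delta> nN nD)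
      ultimately show False by blast
    qed
    have fr: "\<forall>\<^sub>F x in nhds 0. q x \<noteq> 0 \<longrightarrow> framed \<omega>1 \<omega>2 \<theta> \<kappa> i j x"
      using ev ev[THEN eventually_eventually[THEN iffD2]] dth[THEN eventually_eventually[THEN iffD2]]
    proof eventually_elim
      case (elim x)
      show ?case
      proof
        assume "q x \<noteq> 0"
        then have nz: "\<Delta> x \<noteq> 0" "N x \<noteq> 0" by (auto simp: q_def)
        have x: "holo_form1_at \<omega>1 x" "holo_form1_at \<omega>2 x" using elim(1) by blast+
        have D: "\<forall>\<^sub>F y in nhds x. \<Delta> y \<noteq> 0" by (rule eventually_neq[OF h\<Delta>[OF x] nz(1)])
        have "holo_at \<kappa> x" unfolding \<kappa>_def using nz by (intro holo_at_divide holo_intros hN h\<Delta> x) auto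
        moreover have "\<forall>\<^sub>F y in nhds x. ext_deriv \<omega>1 y = wedge11 (\<theta> y) (\<omega>1 y)" "\<forall>\<^sub>F y in nhds x. ext_deriv \<omega>2 y = wedge11 (\<theta> y) (\<omega>2 y)"
          using elim(2) D by (eventually_elim; blast)+
        moreover have "\<forall>\<^sub>F y in nhds x. \<forall>k l. ext_deriv \<theta> y $ k $ l = \<kappa> y * (\<omega>1 y $ k * \<omega>2 y $ l - \<omega>1 y $ l * \<omega>2 y $ k)"
          using elim(3) D by eventually_elim blast
        ultimately show "framed \<omega>1 \<omega>2 \<theta> \<kappa> i j x"
          unfolding framed_def using x h\<theta>[OF x nz(1)] nz by (auto simp: \<Delta>_def[symmetric] \<kappa>_def)
      qed
    qed
    \<comment> \<open>The numerator of \<open>\<theta> + d\<kappa>/2\<kappa>\<close> over the denominator \<open>2 N \<Delta>\<close>.\<close>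
    define \<tau> where "\<tau> l x = 2 * (N x * \<mu> x $ l) + \<Delta> x * pdiff l N x - 3 * (N x * pdiff l \<Delta> x)" for l x
    have h\<tau>: "holo_at (\<tau> l) 0" for l
      unfolding \<tau>_def by (intro holo_intros hN h h\<Delta> holo_form1_nth[OF h\<mu>] holo_at_pdiff)
    have th: "\<forall>\<^sub>F x in nhds 0. q x \<noteq> 0 \<longrightarrow> (\<forall>l. \<theta> x $ l + half_dlog \<kappa> l x = \<tau> l x / (2 * N x * \<Delta> x))"
      using ev
    proof eventually_elim
      case (elim x)
      show ?case
      proof (intro impI allI)
        fix l assume "q x \<noteq> 0"
        then have nz: "\<Delta> x \<noteq> 0" "N x \<noteq> 0" by (auto simp: q_def)
        have x: "holo_form1_at \<omega>1 x" "holo_form1_at \<omega>2 x" using elim by blast+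
        note cd = holo_at_imp_cdiff[OF h\<Delta>[OF x]] holo_at_imp_cdiff[OF hN[OF x]]
        have "pdiff l (\<lambda>x. \<Delta> x * \<Delta> x * \<Delta> x) x = 3 * (\<Delta> x * \<Delta> x * pdiff l \<Delta> x)"
          unfolding pdiff_mult[OF cdiff_mult[OF cd(1) cd(1)] cd(1)] pdiff_mult[OF cd(1) cd(1)] by (simp add: algebra_simps)
        then have pl: "pdiff l \<kappa> x = (pdiff l N x * (\<Delta> x * \<Delta> x * \<Delta> x) - N x * (3 * (\<Delta> x * \<Delta> x * pdiff l \<Delta> x))) / (\<Delta> x * \<Delta> x * \<Delta> x)\<^sup>2"
          unfolding \<kappa>_def using pdiff_divide[OF cd(2) cdiff_mult[OF cdiff_mult[OF cd(1) cd(1)] cd(1)], of l] nz by simp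
        have L: "half_dlog \<kappa> l x = (\<Delta> x * pdiff l N x - 3 * (N x * pdiff l \<Delta> x)) / (2 * N x * \<Delta> x)"
          unfolding half_dlog_def pl unfolding \<kappa>_def using nz by (simp add: field_simps power2_eq_square)
        show "\<theta> x $ l + half_dlog \<kappa> l x = \<tau> l x / (2 * N x * \<Delta> x)"
          unfolding L \<tau>_def \<theta>_def using nz by (simp add: field_simps)
      qed
    qed
    have quot: "(c / (2 * n * d) * e - f / (2 * n * d) * g) / d * ((c / (2 * n * d) * e - f / (2 * n * d) * g) / d) / (n / (d * d * d))
         = (c * e - f * g) * (c * e - f * g) / (4 * (n * n * n * d))" if "n \<noteq> 0" "d \<noteq> 0" for c d e f g n :: complex
    proof -
      have "(c / (2 * n * d) * e - f / (2 * n * d) * g) / d = (c * e - f * g) / (2 * n * d * d)"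
        using that by (simp add: field_simps)
      then show ?thesis using that by (simp add: field_simps)
    qed
    have mero: "mero_germ (\<lambda>x. P x * P x / \<kappa> x)" "mero_germ (\<lambda>x. R x * R x / \<kappa> x)"
    proof -
      let ?p = "\<lambda>x. (\<tau> i x * \<omega>2 x $ j - \<tau> j x * \<omega>2 x $ i) * (\<tau> i x * \<omega>2 x $ j - \<tau> j x * \<omega>2 x $ i)"
      let ?r = "\<lambda>x. (\<tau> j x * \<omega>1 x $ i - \<tau> i x * \<omega>1 x $ j) * (\<tau> j x * \<omega>1 x $ i - \<tau> i x * \<omega>1 x $ j)"
      have "holo_at ?p 0" "holo_at ?r 0" by (intro holo_intros h\<tau> holo_form1_nth h)+
      moreover have "\<forall>\<^sub>F x in nhds 0. q x \<noteq> 0 \<longrightarrow> P x * P x / \<kappa> x = ?p x / q x \<and> R x * R x / \<kappa> x = ?r x / q x"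
        using th
      proof eventually_elim
        case (elim x)
        show ?case
        proof
          assume q0: "q x \<noteq> 0"
          then have nz: "\<Delta> x \<noteq> 0" "N x \<noteq> 0" by (auto simp: q_def)
          have T: "\<theta> x $ l + half_dlog \<kappa> l x = \<tau> l x / (2 * N x * \<Delta> x)" for l using elim q0 by blast
          have "P x * P x / \<kappa> x = ?p x / q x"
            unfolding P_def coframe_fst_def T \<Delta>_def[symmetric] unfolding \<kappa>_def q_def by (rule quot[OF nz(2,1)])
          moreover have "R x * R x / \<kappa> x = ?r x / q x"
            unfolding R_def coframe_snd_def T \<Delta>_def[symmetric] unfolding \<kappa>_def q_def
            unfolding mult.commute[of "\<omega>1 x $ i"] mult.commute[of "\<omega>1 x $ j"] by (rule quot[OF nz(2,1)])
          ultimately show "P x * P x / \<kappa> x = ?p x / q x \<and> R x * R x / \<kappa> x = ?r x / q x" by blast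
        qed
      qed
      ultimately show "mero_germ (\<lambda>x. P x * P x / \<kappa> x)" "mero_germ (\<lambda>x. R x * R x / \<kappa> x)"
        unfolding mero_germ_def using hq nq
        by (intro exI[of _ ?p] exI[of _ ?r] exI[of _ q]; auto elim: eventually_mono)+
    qed
    have fi: "\<forall>\<^sub>F x in nhds 0. q x \<noteq> 0 \<longrightarrow> holo_at (\<lambda>x. P x * P x / \<kappa> x) x \<and> holo_at (\<lambda>x. R x * R x / \<kappa> x) x \<and>
       (\<forall>v. pairing (\<omega>1 x) v = 0 \<longrightarrow> pairing (\<omega>2 x) v = 0 \<longrightarrow> fd (\<lambda>x. P x * P x / \<kappa> x) x v = 0 \<and> fd (\<lambda>x. R x * R x / \<kappa> x) x v = 0)"
      using fr
    proof eventually_elim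
      case (elim x)
      show ?case
      proof
        assume "q x \<noteq> 0"
        then have f: "framed \<omega>1 \<omega>2 \<theta> \<kappa> i j x" using elim by blast
        then have k: "holo_at \<kappa> x" "\<kappa> x \<noteq> 0" unfolding framed_def by blast+
        show "holo_at (\<lambda>x. P x * P x / \<kappa> x) x \<and> holo_at (\<lambda>x. R x * R x / \<kappa> x) x \<and>
          (\<forall>v. pairing (\<omega>1 x) v = 0 \<longrightarrow> pairing (\<omega>2 x) v = 0 \<longrightarrow> fd (\<lambda>x. P x * P x / \<kappa> x) x v = 0 \<and> fd (\<lambda>x. R x * R x / \<kappa> x) x v = 0)"
          using framed_first_integrals[OF f] holo_coframe[OF f] k unfolding P_def R_def
          by (auto intro!: holo_at_divide holo_at_mult)
      qed
    qed
    have "nonconstant_mero_germ (\<lambda>x. P x * P x / \<kappa> x) \<or> nonconstant_mero_germ (\<lambda>x. R x * R x / \<kappa> x)"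
    proof (rule ccontr)
      assume "\<not> ?thesis"
      then obtain c d where cd: "\<forall>\<^sub>F x in nhds 0. holo_at (\<lambda>x. P x * P x / \<kappa> x) x \<longrightarrow> P x * P x / \<kappa> x = c"
        "\<forall>\<^sub>F x in nhds 0. holo_at (\<lambda>x. R x * R x / \<kappa> x) x \<longrightarrow> R x * R x / \<kappa> x = d"
        using mero unfolding nonconstant_mero_germ_def by blast
      have "\<forall>\<^sub>F x in nhds 0. q x \<noteq> 0 \<longrightarrow> (\<forall>\<^sub>F y in nhds x. P y * P y / \<kappa> y = c) \<and> (\<forall>\<^sub>F y in nhds x. R y * R y / \<kappa> y = d)
          \<and> framed \<omega>1 \<omega>2 \<theta> \<kappa> i j x"
        using cd[THEN eventually_eventually[THEN iffD2]] fi fr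
      proof eventually_elim
        case (elim x)
        show ?case
        proof
          assume q0: "q x \<noteq> 0"
          have h: "\<forall>\<^sub>F y in nhds x. holo_at (\<lambda>x. P x * P x / \<kappa> x) y" "\<forall>\<^sub>F y in nhds x. holo_at (\<lambda>x. R x * R x / \<kappa> x) y"
            using elim(3) q0 by (auto intro: holo_at_eventually)
          have "\<forall>\<^sub>F y in nhds x. P y * P y / \<kappa> y = c" using elim(1) h(1) by eventually_elim blast
          moreover have "\<forall>\<^sub>F y in nhds x. R y * R y / \<kappa> y = d" using elim(2) h(2) by eventually_elim blast
          ultimately show "(\<forall>\<^sub>F y in nhds x. P y * P y / \<kappa> y = c) \<and> (\<forall>\<^sub>F y in nhds x. R y * R y / \<kappa> y = d)
            \<and> framed \<omega>1 \<omega>2 \<theta> \<kappa> i j x" using elim(4) q0 by blast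
        qed
      qed
      then have "\<forall>\<^sub>F x in nhds 0. q x = 0"
      proof eventually_elim
        case (elim x)
        show ?case
          using framed_not_both_constant[of \<omega>1 \<omega>2 \<theta> \<kappa> i j x c d] elim unfolding P_def R_def by blast
      qed
      with nq show False unfolding zero_germ_def by blast
    qed
    then have "meromorphic_axis_integral \<omega>1 \<omega>2 (\<lambda>x. P x * P x / \<kappa> x) \<or> meromorphic_axis_integral \<omega>1 \<omega>2 (\<lambda>x. R x * R x / \<kappa> x)"
    proof
      assume "nonconstant_mero_germ (\<lambda>x. P x * P x / \<kappa> x)"
      moreover have "\<forall>\<^sub>F x in nhds 0. q x \<noteq> 0 \<longrightarrow> holo_at (\<lambda>x. P x * P x / \<kappa> x) x \<and>
         (\<forall>v. pairing (\<omega>1 x) v = 0 \<longrightarrow> pairing (\<omega>2 x) v = 0 \<longrightarrow> fd (\<lambda>x. P x * P x / \<kappa> x) x v = 0)"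
        using fi by eventually_elim blast
      ultimately show ?thesis unfolding meromorphic_axis_integral_def using hq nq by blast
    next
      assume "nonconstant_mero_germ (\<lambda>x. R x * R x / \<kappa> x)"
      moreover have "\<forall>\<^sub>F x in nhds 0. q x \<noteq> 0 \<longrightarrow> holo_at (\<lambda>x. R x * R x / \<kappa> x) x \<and>
         (\<forall>v. pairing (\<omega>1 x) v = 0 \<longrightarrow> pairing (\<omega>2 x) v = 0 \<longrightarrow> fd (\<lambda>x. R x * R x / \<kappa> x) x v = 0)"
        using fi by eventually_elim blast
      ultimately show ?thesis unfolding meromorphic_axis_integral_def using hq nq by blast
    qed
    then show ?thesis by blast
  qed
qed

section \<open>Invariant hypersurfaces\<close>

definition tangent_field where
  "tangent_field \<omega>1 \<omega>2 X \<longleftrightarrow> holo_form1_at X 0 \<and> (\<forall>\<^sub>F x in nhds 0. pairing (\<omega>1 x) (X x) = 0 \<and> pairing (\<omega>2 x) (X x) = 0)"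

text \<open>The principal ideal of \<open>D\<close> is stable under the fields tangent to the axis.\<close>
definition invariant_equation where
  "invariant_equation \<omega>1 \<omega>2 D \<longleftrightarrow> holo_at D 0 \<and> D 0 = 0 \<and> \<not> zero_germ D \<and>
     (\<forall>X. tangent_field \<omega>1 \<omega>2 X \<longrightarrow> germ_dvd D (\<lambda>x. fd D x (X x)))"

lemma germ_dvd_dense:
  assumes "holo_at r 0" "\<not> zero_germ r" "holo_at a 0" "holo_at c 0" "holo_at q 0"
    and "\<forall>\<^sub>F x in nhds 0. r x \<noteq> 0 \<longrightarrow> a x = c x * q x"
  shows "germ_dvd q a"
  unfolding germ_dvd_def using holo_eq_dense[OF assms(1-3) holo_at_mult[OF assms(4,5)] assms(6)] assms(4) by blast

lemma germ_dvd_unit: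
  assumes "holo_at d 0" "d 0 \<noteq> 0" "holo_at a 0"
  shows "germ_dvd d a"
  unfolding germ_dvd_def
proof (intro exI conjI)
  show "holo_at (\<lambda>x. a x / d x) 0" by (rule holo_at_divide[OF assms(3,1,2)])
  show "\<forall>\<^sub>F x in nhds 0. a x = a x / d x * d x"
    using eventually_neq[OF assms(1,2)] by eventually_elim simp
qed

lemma germ_dvd_zero: "\<forall>\<^sub>F x in nhds 0. a x = 0 \<Longrightarrow> germ_dvd d a"
  unfolding germ_dvd_def by (rule exI[of _ "\<lambda>_. 0"]) (simp add: holo_at_const)

text \<open>The level of \<open>k\<close> through \<open>0\<close>: its equation is annihilated by the tangent fields.\<close>
lemma invariant_equationI_first_integral:
  assumes "holo_at k 0" "\<not> (\<exists>c. \<forall>\<^sub>F x in nhds 0. k x = c)"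
    and "\<And>X. tangent_field \<omega>1 \<omega>2 X \<Longrightarrow> \<forall>\<^sub>F x in nhds 0. fd k x (X x) = 0"
  shows "\<exists>D. invariant_equation \<omega>1 \<omega>2 D"
proof
  show "invariant_equation \<omega>1 \<omega>2 (\<lambda>x. k x - k 0)"
    unfolding invariant_equation_def
  proof (intro conjI allI impI)
    show "holo_at (\<lambda>x. k x - k 0) 0" by (intro holo_intros assms(1))
    show "\<not> zero_germ (\<lambda>x. k x - k 0)" using assms(2) by (simp add: zero_germ_def)
    fix X assume "tangent_field \<omega>1 \<omega>2 X"
    from assms(3)[OF this] holo_at_eventually[OF assms(1)]
    have "\<forall>\<^sub>F x in nhds 0. fd (\<lambda>x. k x - k 0) x (X x) = 0"
      by eventually_elim (simp add: fd_diff[OF holo_at_imp_cdiff cdiff_const] fd_const)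
    then show "germ_dvd (\<lambda>x. k x - k 0) (\<lambda>x. fd (\<lambda>x. k x - k 0) x (X x))" by (rule germ_dvd_zero)
  qed simp
qed

text \<open>Let \<open>d\<close> generate the ideal \<open>{a. a f holomorphic}\<close>. For a tangent field \<open>X\<close>, \<open>X(f) = 0\<close> implies
  \<open>X(d) f = X(d f)\<close>, which is holomorphic; so \<open>X(d)\<close> belongs to the ideal and \<open>d\<close> divides it. If
  \<open>d(0) = 0\<close>, this is the polar hypersurface of \<open>f\<close>; otherwise \<open>f\<close> is holomorphic and has a level through \<open>0\<close>.\<close>
lemma polar_or_level_hypersurface:
  assumes "meromorphic_axis_integral \<omega>1 \<omega>2 f"
  shows "\<exists>D. invariant_equation \<omega>1 \<omega>2 D"
proof -
  obtain r where f: "nonconstant_mero_germ f" and r: "holo_at r 0" "\<not> zero_germ r"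
    "\<forall>\<^sub>F x in nhds 0. r x \<noteq> 0 \<longrightarrow> holo_at f x \<and> (\<forall>v. pairing (\<omega>1 x) v = 0 \<longrightarrow> pairing (\<omega>2 x) v = 0 \<longrightarrow> fd f x v = 0)"
    using assms unfolding meromorphic_axis_integral_def by blast
  obtain p q where pq: "holo_at p 0" "holo_at q 0" "\<not> zero_germ q" "\<forall>\<^sub>F x in nhds 0. q x \<noteq> 0 \<longrightarrow> f x = p x / q x"
    using f unfolding nonconstant_mero_germ_def mero_germ_def by blast
  define s where "s x = q x * r x" for x
  have s: "holo_at s 0" "\<not> zero_germ s" unfolding s_def by (rule holo_at_mult[OF pq(2) r(1)], rule zero_germ_mult[OF pq(2) r(1) pq(3) r(2)])
  obtain d where d: "holo_at d 0" "\<not> zero_germ d" "\<And>a. holo_at a 0 \<Longrightarrow> germ_dvd q (\<lambda>x. a x * p x) \<longleftrightarrow> germ_dvd d a"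
    using denominators_principal[OF pq(2,3), of "{p}"] pq(1) by auto
  show ?thesis
  proof (cases "d 0 = 0")
    case True
    have "germ_dvd d d" unfolding germ_dvd_def by (rule exI[of _ "\<lambda>_. 1"]) (simp add: holo_at_const)
    then obtain k where k: "holo_at k 0" "\<forall>\<^sub>F x in nhds 0. d x * p x = k x * q x"
      using d(3)[OF d(1)] unfolding germ_dvd_def by blast
    have "germ_dvd d (\<lambda>x. fd d x (X x))" if X: "tangent_field \<omega>1 \<omega>2 X" for X
    proof -
      have hX: "holo_form1_at X 0" using X by (simp add: tangent_field_def)
      have "germ_dvd q (\<lambda>x. fd d x (X x) * p x)"
      proof (rule germ_dvd_dense[OF s])
        show "holo_at (\<lambda>x. fd d x (X x) * p x) 0" by (intro holo_at_mult holo_fd_field d hX pq)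
        show "holo_at (\<lambda>x. fd k x (X x)) 0" by (intro holo_fd_field k hX)
        show "\<forall>\<^sub>F x in nhds 0. s x \<noteq> 0 \<longrightarrow> fd d x (X x) * p x = fd k x (X x) * q x"
          using X[unfolded tangent_field_def, THEN conjunct2] r(3) pq(4)[THEN eventually_eventually[THEN iffD2]]
            k(2)[THEN eventually_eventually[THEN iffD2]]
            holo_at_eventually[OF pq(1)] holo_at_eventually[OF pq(2)] holo_at_eventually[OF d(1)] holo_at_eventually[OF k(1)]
        proof eventually_elim
          case (elim x)
          show ?case
          proof
            assume "s x \<noteq> 0"
            then have nz: "q x \<noteq> 0" "r x \<noteq> 0" by (auto simp: s_def)
            note c = elim(5-8)[THEN holo_at_imp_cdiff]
            let ?v = "X x"
            have "\<forall>\<^sub>F y in nhds x. f y = p y / q y" using elim(3) eventually_neq[OF elim(6) nz(1)] by eventually_elim blast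
            then have "fd (\<lambda>y. p y / q y) x ?v = fd f x ?v" by (simp only: fd_cong)
            also have "\<dots> = 0" using elim(1,2) nz by blast
            finally have 1: "fd p x ?v * q x = p x * fd q x ?v" using nz by (simp add: fd_divide[OF c(1,2)])
            have 2: "fd d x ?v * p x + d x * fd p x ?v = fd k x ?v * q x + k x * fd q x ?v"
              using fun_cong[OF fd_cong[OF elim(4)], of ?v] unfolding fd_mult[OF c(3,1)] fd_mult[OF c(4,2)] .
            have 3: "d x * p x = k x * q x" using eventually_nhds_x_imp_x[OF elim(4)] .
            have "q x * (fd d x ?v * p x) = q x * (fd k x ?v * q x)" using 1 2 3 by algebra
            then show "fd d x ?v * p x = fd k x ?v * q x" using nz by simp
          qed
        qed
      qed (fact pq)
      then show ?thesis using d(3)[OF holo_fd_field[OF d(1) hX]] by blast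
    qed
    then have "invariant_equation \<omega>1 \<omega>2 d" unfolding invariant_equation_def using d True by blast
    then show ?thesis by blast
  next
    case False
    have "germ_dvd q (\<lambda>x. 1 * p x)" using d(3)[OF holo_at_const] germ_dvd_unit[OF d(1) False holo_at_const] by blast
    then obtain k where k: "holo_at k 0" "\<forall>\<^sub>F x in nhds 0. p x = k x * q x" unfolding germ_dvd_def by auto
    have fk: "\<forall>\<^sub>F x in nhds 0. q x \<noteq> 0 \<longrightarrow> f x = k x"
      using pq(4) k(2) by eventually_elim auto
    show ?thesis
    proof (rule invariant_equationI_first_integral[OF k(1)])
      show "\<not> (\<exists>c. \<forall>\<^sub>F x in nhds 0. k x = c)"
      proof
        assume "\<exists>c. \<forall>\<^sub>F x in nhds 0. k x = c"
        then obtain c where c: "\<forall>\<^sub>F x in nhds 0. k x = c" by blast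
        with fk have "\<forall>\<^sub>F x in nhds 0. q x \<noteq> 0 \<longrightarrow> f x = c" by eventually_elim blast
        from nonzero_dense_on[OF pq(2,3) this] have "\<forall>\<^sub>F x in nhds 0. holo_at f x \<longrightarrow> f x = c"
        proof eventually_elim
          case (elim x)
          have "\<exists>\<^sub>F y in nhds x. f y = c" using elim by (rule frequently_elim1) blast
          then show ?case using dense_eq[OF holo_at_isCont, of f x "\<lambda>_. c"] by simp
        qed
        with f show False unfolding nonconstant_mero_germ_def by blast
      qed
      fix X assume X: "tangent_field \<omega>1 \<omega>2 X"
      have hX: "holo_form1_at X 0" using X by (simp add: tangent_field_def)
      show "\<forall>\<^sub>F x in nhds 0. fd k x (X x) = 0"
      proof (rule holo_eq_dense[OF s holo_fd_field[OF k(1) hX] holo_at_const])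
        show "\<forall>\<^sub>F x in nhds 0. s x \<noteq> 0 \<longrightarrow> fd k x (X x) = 0"
          using X[unfolded tangent_field_def, THEN conjunct2] r(3) fk[THEN eventually_eventually[THEN iffD2]] holo_at_eventually[OF pq(2)]
        proof eventually_elim
          case (elim x)
          show ?case
          proof
            assume "s x \<noteq> 0"
            then have nz: "q x \<noteq> 0" "r x \<noteq> 0" by (auto simp: s_def)
            have "\<forall>\<^sub>F y in nhds x. k y = f y" using elim(3) eventually_neq[OF elim(4) nz(1)] by eventually_elim auto
            then have "fd k x = fd f x" by (rule fd_cong)
            then show "fd k x (X x) = 0" using elim(1,2) nz by auto
          qed
        qed
      qed
    qed
  qed
qed

lemma nonzero_component:
  fixes \<omega> :: "complex^'n \<Rightarrow> complex^'n"
  assumes "\<not> zero_germ \<omega>"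
  shows "\<exists>k. \<not> zero_germ (\<lambda>x. \<omega> x $ k)"
proof (rule ccontr)
  assume "\<not> ?thesis"
  then have "\<forall>\<^sub>F x in nhds 0. \<forall>k. \<omega> x $ k = 0" unfolding zero_germ_def by (intro eventually_all_fin) blast
  then have "\<forall>\<^sub>F x in nhds 0. \<omega> x = 0" by eventually_elim (simp add: vec_eq_iff)
  with assms show False by (simp add: zero_germ_def)
qed

text \<open>Let \<open>a\<close> be a non-zero coefficient and \<open>D\<close> a generator of the ideal of \<open>c\<close> such that \<open>c p/a\<close> is holomorphic for
  all coefficients \<open>p\<close>. Then \<open>g = a/D\<close> is a greatest common divisor: \<open>p/g = D p/a\<close> is holomorphic, and a
  common divisor \<open>e\<close> of all \<open>p/g\<close> divides \<open>a/g = D\<close> with quotient \<open>c\<close> in the ideal; so \<open>D\<close> divides \<open>c = D/e\<close>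
  and \<open>e\<close> is a unit.\<close>
lemma gcd_reduction:
  fixes \<omega>1 \<omega>2 :: "complex^'n \<Rightarrow> complex^'n"
  assumes h: "holo_form1_at \<omega>1 0" "holo_form1_at \<omega>2 0" and nz: "\<not> zero_germ \<omega>1"
  shows "\<exists>g w1 w2. holo_at g 0 \<and> \<not> zero_germ g \<and> holo_form1_at w1 0 \<and> holo_form1_at w2 0 \<and>
    (\<forall>\<^sub>F x in nhds 0. \<omega>1 x = g x *s w1 x \<and> \<omega>2 x = g x *s w2 x) \<and>
    (\<forall>e. holo_at e 0 \<longrightarrow> (\<forall>k. germ_dvd e (\<lambda>x. w1 x $ k)) \<longrightarrow> (\<forall>k. germ_dvd e (\<lambda>x. w2 x $ k)) \<longrightarrow> e 0 \<noteq> 0)"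
proof -
  obtain k0 where k0: "\<not> zero_germ (\<lambda>x. \<omega>1 x $ k0)" using nonzero_component[OF nz] by blast
  define a where "a x = \<omega>1 x $ k0" for x
  have a: "holo_at a 0" "\<not> zero_germ a" unfolding a_def using h k0 by (auto intro: holo_form1_nth)
  define S where "S = (\<lambda>k x. \<omega>1 x $ k) ` UNIV \<union> (\<lambda>k x. \<omega>2 x $ k) ` (UNIV :: 'n set)"
  have S: "finite S" "\<And>p. p \<in> S \<Longrightarrow> holo_at p 0" unfolding S_def using h by (auto intro: holo_form1_nth)
  obtain D where D: "holo_at D 0" "\<not> zero_germ D"
    "\<And>c. holo_at c 0 \<Longrightarrow> (\<forall>p\<in>S. germ_dvd a (\<lambda>x. c x * p x)) \<longleftrightarrow> germ_dvd D c"
    using denominators_principal[OF a S] by blast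
  have "\<forall>p\<in>S. germ_dvd a (\<lambda>x. a x * p x)"
  proof
    fix p assume "p \<in> S"
    then show "germ_dvd a (\<lambda>x. a x * p x)"
      unfolding germ_dvd_def by (intro exI[of _ p] conjI S(2)) (simp_all add: mult.commute)
  qed
  then have "germ_dvd D a" using D(3)[OF a(1)] by blast
  then obtain g where g: "holo_at g 0" "\<forall>\<^sub>F x in nhds 0. a x = g x * D x" unfolding germ_dvd_def by blast
  have ng: "\<not> zero_germ g"
  proof
    assume "zero_germ g"
    then have "zero_germ a" using g(2) unfolding zero_germ_def by eventually_elim simp
    with a(2) show False by blast
  qed
  have "germ_dvd D D" unfolding germ_dvd_def by (rule exI[of _ "\<lambda>_. 1"]) (simp add: holo_at_const)
  then have "\<forall>p\<in>S. \<exists>b. holo_at b 0 \<and> (\<forall>\<^sub>F x in nhds 0. D x * p x = b x * a x)"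
    using D(3)[OF D(1)] unfolding germ_dvd_def by blast
  from bchoice[OF this] obtain b where b: "\<And>p. p \<in> S \<Longrightarrow> holo_at (b p) 0"
    "\<And>p. p \<in> S \<Longrightarrow> \<forall>\<^sub>F x in nhds 0. D x * p x = b p x * a x" by blast
  have pg: "\<forall>\<^sub>F x in nhds 0. p x = g x * b p x" if p: "p \<in> S" for p
  proof (rule holo_eq_dense[OF D(1,2) S(2)[OF p] holo_at_mult[OF g(1) b(1)[OF p]]])
    show "\<forall>\<^sub>F x in nhds 0. D x \<noteq> 0 \<longrightarrow> p x = g x * b p x"
      using g(2) b(2)[OF p] by eventually_elim auto
  qed
  define w1 where "w1 x = (\<chi> k. b (\<lambda>x. \<omega>1 x $ k) x)" for x
  define w2 where "w2 x = (\<chi> k. b (\<lambda>x. \<omega>2 x $ k) x)" for x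
  have inS: "(\<lambda>x. \<omega>1 x $ k) \<in> S" "(\<lambda>x. \<omega>2 x $ k) \<in> S" for k unfolding S_def by auto
  have aS: "a \<in> S" using inS(1)[of k0] by (simp add: a_def[abs_def])
  have hw: "holo_form1_at w1 0" "holo_form1_at w2 0"
    unfolding holo_form1_at_def w1_def w2_def using b(1)[OF inS(1)] b(1)[OF inS(2)] by auto
  have "\<forall>\<^sub>F x in nhds 0. \<forall>k. \<omega>1 x $ k = g x * w1 x $ k \<and> \<omega>2 x $ k = g x * w2 x $ k"
    using pg[OF inS(1)] pg[OF inS(2)] by (intro eventually_all_fin eventually_conj) (simp_all add: w1_def w2_def)
  then have eq: "\<forall>\<^sub>F x in nhds 0. \<omega>1 x = g x *s w1 x \<and> \<omega>2 x = g x *s w2 x"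
    by eventually_elim (simp add: vec_eq_iff)
  have "e 0 \<noteq> 0" if e: "holo_at e 0" "\<And>k. germ_dvd e (\<lambda>x. w1 x $ k)" "\<And>k. germ_dvd e (\<lambda>x. w2 x $ k)" for e
  proof
    assume e0: "e 0 = 0"
    have eb: "germ_dvd e (b p)" if "p \<in> S" for p
      using that e(2,3) unfolding S_def w1_def w2_def by auto
    obtain c where c: "holo_at c 0" "\<forall>\<^sub>F x in nhds 0. b a x = c x * e x" using eb[OF aS] unfolding germ_dvd_def by blast
    have Dba: "\<forall>\<^sub>F x in nhds 0. D x = b a x"
      by (rule holo_eq_dense[OF a D(1) b(1)[OF aS]]) (use b(2)[OF aS] in \<open>eventually_elim, auto\<close>)
    have "\<forall>p\<in>S. germ_dvd a (\<lambda>x. c x * p x)"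
    proof
      fix p assume p: "p \<in> S"
      then obtain k where k: "holo_at k 0" "\<forall>\<^sub>F x in nhds 0. b p x = k x * e x" using eb unfolding germ_dvd_def by blast
      have "\<forall>\<^sub>F x in nhds 0. c x * p x = k x * a x"
        using pg[OF p] k(2) g(2) Dba c(2) by eventually_elim simp
      with k(1) show "germ_dvd a (\<lambda>x. c x * p x)" unfolding germ_dvd_def by blast
    qed
    then obtain t where t: "holo_at t 0" "\<forall>\<^sub>F x in nhds 0. c x = t x * D x"
      using D(3)[OF c(1)] unfolding germ_dvd_def by blast
    have "\<forall>\<^sub>F x in nhds 0. t x * e x = 1"
    proof (rule holo_eq_dense[OF D(1,2) holo_at_mult[OF t(1) e(1)] holo_at_const])
      show "\<forall>\<^sub>F x in nhds 0. D x \<noteq> 0 \<longrightarrow> t x * e x = 1"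
        using Dba c(2) t(2)
      proof eventually_elim
        case (elim x)
        have "D x = (t x * e x) * D x" using elim by simp
        then show ?case by (metis mult_cancel_right2)
      qed
    qed
    from eventually_nhds_x_imp_x[OF this] e0 show False by simp
  qed
  with g(1) ng hw eq show ?thesis by blast
qed

text \<open>The meromorphic twisting form \<open>t\<close> extends to the holomorphic \<open>\<eta>\<close>; its two equations extend by density,
  and \<open>integrating_factor\<close> applies. The primitive is not constant, for its differential is \<open>u \<omega>\<close> with \<open>u\<close>
  without zeros.\<close>
lemma exact_of_holomorphic_twist:
  fixes \<omega> \<eta> t :: "complex^'n \<Rightarrow> complex^'n"
  assumes h\<omega>: "holo_form1_at \<omega> 0" and n\<omega>: "\<not> zero_germ \<omega>" and h\<eta>: "holo_form1_at \<eta> 0"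
    and Q: "holo_at Q 0" "\<not> zero_germ Q"
    and eq: "\<forall>\<^sub>F x in nhds 0. Q x \<noteq> 0 \<longrightarrow> \<eta> x = t x"
    and cl: "\<forall>\<^sub>F x in nhds 0. Q x \<noteq> 0 \<longrightarrow> ext_deriv t x = 0"
    and tw: "\<forall>\<^sub>F x in nhds 0. Q x \<noteq> 0 \<longrightarrow> ext_deriv \<omega> x = wedge11 (t x) (\<omega> x)"
  shows "\<exists>u F. holo_at F 0 \<and> \<not> (\<exists>c. \<forall>\<^sub>F x in nhds 0. F x = c) \<and> (\<forall>\<^sub>F x in nhds 0. \<forall>k. pdiff k F x = u x * \<omega> x $ k)"
proof -
  have "\<forall>\<^sub>F x in nhds 0. Q x \<noteq> 0 \<longrightarrow> ext_deriv \<eta> x = 0"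
    using eq[THEN eventually_eventually[THEN iffD2]] cl holo_at_eventually[OF Q(1)]
  proof eventually_elim
    case (elim x)
    show ?case
    proof
      assume nz: "Q x \<noteq> 0"
      have "\<forall>\<^sub>F y in nhds x. \<eta> y = t y" using elim(1) eventually_neq[OF elim(3) nz] by eventually_elim blast
      from ext_deriv_cong[OF this] show "ext_deriv \<eta> x = 0" using elim(2) nz by simp
    qed
  qed
  from closed_dense[OF Q this] holo_form1_eventually[OF h\<eta>] have cl\<eta>: "\<forall>\<^sub>F x in nhds 0. ext_deriv \<eta> x = 0"
    by eventually_elim blast
  have "\<forall>\<^sub>F x in nhds 0. Q x \<noteq> 0 \<longrightarrow> ext_deriv \<omega> x = wedge11 (\<eta> x) (\<omega> x)"
    using eq tw by eventually_elim simp
  from twist_dense[OF Q h\<omega> this] holo_form1_eventually[OF h\<eta>]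
  have "\<forall>\<^sub>F x in nhds 0. ext_deriv \<omega> x = wedge11 (\<eta> x) (\<omega> x)" by eventually_elim blast
  from integrating_factor[OF h\<omega> h\<eta> cl\<eta> this] obtain u F where F: "holo_at F 0" "\<And>x. u x \<noteq> 0"
    "\<forall>\<^sub>F x in nhds 0. \<forall>k. pdiff k F x = u x * \<omega> x $ k" by blast
  have "\<not> (\<exists>c. \<forall>\<^sub>F x in nhds 0. F x = c)"
  proof
    assume "\<exists>c. \<forall>\<^sub>F x in nhds 0. F x = c"
    then obtain c where "\<forall>\<^sub>F x in nhds 0. F x = c" by blast
    from this[THEN eventually_eventually[THEN iffD2]] F(3) have "\<forall>\<^sub>F x in nhds 0. \<omega> x = 0"
    proof eventually_elim
      case (elim x)
      have "pdiff k F x = 0" for k using pdiff_cong[OF elim(1)] by (simp add: pdiff_const)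
      then show ?case using elim(2) F(2) by (simp add: vec_eq_iff)
    qed
    with n\<omega> show False by (simp add: zero_germ_def)
  qed
  with F show ?thesis by blast
qed

text \<open>Let \<open>\<theta> = \<mu>/Q\<close> and let \<open>d\<close> generate the ideal \<open>{c. c \<theta> holomorphic}\<close>. For a tangent field \<open>X\<close>,
  contracting \<open>dw = \<theta> \<and> w\<close> gives \<open>\<theta>(X) w = i\<^sub>X dw\<close> for \<open>w = w1, w2\<close>: the denominator of \<open>\<theta>(X)\<close> divides all
  coefficients of \<open>w1\<close> and \<open>w2\<close>, which have no common factor. So \<open>\<theta>(X) = \<rho>\<close> is holomorphic. By closedness
  the Lie derivative of \<open>\<theta>\<close> along \<open>X\<close> is \<open>d\<rho>\<close>, that is,
  \<open>X(\<theta>\<^sub>k) = \<partial>\<^sub>k\<rho> - (\<Sum>m. \<theta>\<^sub>m \<partial>\<^sub>kX\<^sub>m)\<close>. Hence \<open>X(d) \<theta>\<^sub>k = X(d \<theta>\<^sub>k) - d X(\<theta>\<^sub>k)\<close> is holomorphic, and \<open>d\<close> divides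
  \<open>X(d)\<close>.\<close>
lemma reduced_twist_hypersurface:
  fixes w1 w2 \<mu> :: "complex^'n \<Rightarrow> complex^'n"
  assumes hw: "holo_form1_at w1 0" "holo_form1_at w2 0" and nw: "\<not> zero_germ w1"
    and cop: "\<And>e. holo_at e 0 \<Longrightarrow> (\<And>k. germ_dvd e (\<lambda>x. w1 x $ k)) \<Longrightarrow> (\<And>k. germ_dvd e (\<lambda>x. w2 x $ k)) \<Longrightarrow> e 0 \<noteq> 0"
    and h\<mu>: "holo_form1_at \<mu> 0" and Q: "holo_at Q 0" "\<not> zero_germ Q"
    and cl: "\<forall>\<^sub>F x in nhds 0. Q x \<noteq> 0 \<longrightarrow> ext_deriv (\<lambda>x. (1 / Q x) *s \<mu> x) x = 0"
    and tw: "\<forall>\<^sub>F x in nhds 0. Q x \<noteq> 0 \<longrightarrow> ext_deriv w1 x = wedge11 ((1 / Q x) *s \<mu> x) (w1 x)"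
      "\<forall>\<^sub>F x in nhds 0. Q x \<noteq> 0 \<longrightarrow> ext_deriv w2 x = wedge11 ((1 / Q x) *s \<mu> x) (w2 x)"
  shows "\<exists>D. invariant_equation w1 w2 D"
proof -
  define th where "th x = (1 / Q x) *s \<mu> x" for x
  define S where "S = (\<lambda>k x. \<mu> x $ k) ` (UNIV :: 'n set)"
  have S: "finite S" "\<And>p. p \<in> S \<Longrightarrow> holo_at p 0" unfolding S_def using h\<mu> by (auto intro: holo_form1_nth)
  obtain d where d: "holo_at d 0" "\<not> zero_germ d"
    "\<And>c. holo_at c 0 \<Longrightarrow> (\<forall>p\<in>S. germ_dvd Q (\<lambda>x. c x * p x)) \<longleftrightarrow> germ_dvd d c"
    using denominators_principal[OF Q S] by blast
  have hth: "holo_form1_at th x" if "holo_form1_at \<mu> x" "holo_at Q x" "Q x \<noteq> 0" for x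
    unfolding th_def holo_form1_at_def using that by (auto intro!: holo_at_divide holo_form1_nth)
  show ?thesis
  \<comment> \<open>For \<open>d(0) = 0\<close> the polar set of \<open>\<theta>\<close> passes through \<open>0\<close>; otherwise \<open>\<theta>\<close> is holomorphic and \<open>w1\<close> has a
    holomorphic first integral.\<close>
  proof (cases "d 0 = 0")
    case True
    have "germ_dvd d d" unfolding germ_dvd_def by (rule exI[of _ "\<lambda>_. 1"]) (simp add: holo_at_const)
    then have dS: "\<forall>p\<in>S. germ_dvd Q (\<lambda>x. d x * p x)" using d(3)[OF d(1)] by blast
    have "\<forall>k. \<exists>\<eta>. holo_at \<eta> 0 \<and> (\<forall>\<^sub>F x in nhds 0. d x * \<mu> x $ k = \<eta> x * Q x)"
    proof
      fix k
      have "germ_dvd Q (\<lambda>x. d x * \<mu> x $ k)" using dS by (simp add: S_def)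
      then show "\<exists>\<eta>. holo_at \<eta> 0 \<and> (\<forall>\<^sub>F x in nhds 0. d x * \<mu> x $ k = \<eta> x * Q x)" unfolding germ_dvd_def .
    qed
    from choice[OF this] obtain \<eta> where \<eta>: "\<And>k. holo_at (\<eta> k) 0" "\<And>k. \<forall>\<^sub>F x in nhds 0. d x * \<mu> x $ k = \<eta> k x * Q x" by blast
    have "germ_dvd d (\<lambda>x. fd d x (X x))" if X: "tangent_field w1 w2 X" for X
    proof -
      have hX: "holo_form1_at X 0" and tX: "\<forall>\<^sub>F x in nhds 0. pairing (w1 x) (X x) = 0 \<and> pairing (w2 x) (X x) = 0"
        using X by (auto simp: tangent_field_def)
      define \<nu> where "\<nu> x = pairing (\<mu> x) (X x)" for x
      have h\<nu>: "holo_at \<nu> 0" unfolding \<nu>_def by (rule holo_pairing[OF h\<mu> hX])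
      have div: "germ_dvd Q (\<lambda>x. w x $ l * \<nu> x)"
        if w: "holo_form1_at w 0" "\<forall>\<^sub>F x in nhds 0. pairing (w x) (X x) = 0"
          "\<forall>\<^sub>F x in nhds 0. Q x \<noteq> 0 \<longrightarrow> ext_deriv w x = wedge11 ((1 / Q x) *s \<mu> x) (w x)" for w l
      proof (rule germ_dvd_dense[OF Q])
        show "holo_at (\<lambda>x. w x $ l * \<nu> x) 0" by (intro holo_at_mult h\<nu> holo_form1_nth w)
        show "holo_at (\<lambda>x. \<Sum>m\<in>UNIV. X x $ m * ext_deriv w x $ m $ l) 0"
          unfolding ext_deriv_nth by (intro holo_intros holo_form1_nth hX w holo_at_pdiff)
        show "\<forall>\<^sub>F x in nhds 0. Q x \<noteq> 0 \<longrightarrow> w x $ l * \<nu> x = (\<Sum>m\<in>UNIV. X x $ m * ext_deriv w x $ m $ l) * Q x"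
          using w(2,3)
        proof eventually_elim
          case (elim x)
          show ?case
          proof
            assume nz: "Q x \<noteq> 0"
            have "(\<Sum>m\<in>UNIV. X x $ m * ext_deriv w x $ m $ l) * Q x
                = (\<Sum>m\<in>UNIV. X x $ m * (\<mu> x $ m * w x $ l - \<mu> x $ l * w x $ m))"
              unfolding sum_distrib_right using elim(2) nz
              by (intro sum.cong refl) (simp add: wedge11_nth field_simps)
            also have "\<dots> = w x $ l * \<nu> x - \<mu> x $ l * pairing (w x) (X x)"
              unfolding \<nu>_def pairing_def sum_distrib_left sum_subtractf[symmetric] by (intro sum.cong refl) (simp add: algebra_simps)
            finally show "w x $ l * \<nu> x = (\<Sum>m\<in>UNIV. X x $ m * ext_deriv w x $ m $ l) * Q x" using elim(1) by simp
          qed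
        qed
      qed (fact Q)
      \<comment> \<open>The reduced denominator of \<open>\<theta>(X) = \<nu>/Q\<close>.\<close>
      obtain e where e: "holo_at e 0" "\<And>c. holo_at c 0 \<Longrightarrow> germ_dvd Q (\<lambda>x. c x * \<nu> x) \<longleftrightarrow> germ_dvd e c"
        using denominators_principal[OF Q, of "{\<nu>}"] h\<nu> by auto
      have tX1: "\<forall>\<^sub>F x in nhds 0. pairing (w1 x) (X x) = 0" using tX by eventually_elim blast
      have tX2: "\<forall>\<^sub>F x in nhds 0. pairing (w2 x) (X x) = 0" using tX by eventually_elim blast
      have "germ_dvd e (\<lambda>x. w1 x $ k)" "germ_dvd e (\<lambda>x. w2 x $ k)" for k
        using div[OF hw(1) tX1 tw(1), of k] div[OF hw(2) tX2 tw(2), of k]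
          e(2)[OF holo_form1_nth[OF hw(1)], of k] e(2)[OF holo_form1_nth[OF hw(2)], of k] by blast+
      from cop[OF e(1) this] have "germ_dvd e (\<lambda>_. 1)" using germ_dvd_unit[OF e(1) _ holo_at_const] by blast
      then have "germ_dvd Q (\<lambda>x. 1 * \<nu> x)" using e(2)[OF holo_at_const] by blast
      then obtain \<rho> where \<rho>: "holo_at \<rho> 0" "\<forall>\<^sub>F x in nhds 0. \<nu> x = \<rho> x * Q x" unfolding germ_dvd_def by auto
      have "germ_dvd Q (\<lambda>x. fd d x (X x) * \<mu> x $ k)" for k
      proof (rule germ_dvd_dense[OF Q])
        show "holo_at (\<lambda>x. fd d x (X x) * \<mu> x $ k) 0" by (intro holo_at_mult holo_fd_field d hX holo_form1_nth h\<mu>)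
        show "holo_at (\<lambda>x. fd (\<eta> k) x (X x) - d x * pdiff k \<rho> x + (\<Sum>m\<in>UNIV. pdiff k (\<lambda>x. X x $ m) x * \<eta> m x)) 0"
          by (intro holo_intros holo_fd_field \<eta> hX d holo_at_pdiff \<rho> holo_form1_nth)
        have all\<eta>: "\<forall>\<^sub>F x in nhds 0. \<forall>m. d x * \<mu> x $ m = \<eta> m x * Q x" by (intro eventually_all_fin \<eta>)
        have hall: "\<forall>\<^sub>F x in nhds 0. \<forall>m. holo_at (\<eta> m) x" by (intro eventually_all_fin holo_at_eventually \<eta>)
        show "\<forall>\<^sub>F x in nhds 0. Q x \<noteq> 0 \<longrightarrow> fd d x (X x) * \<mu> x $ k =
           (fd (\<eta> k) x (X x) - d x * pdiff k \<rho> x + (\<Sum>m\<in>UNIV. pdiff k (\<lambda>x. X x $ m) x * \<eta> m x)) * Q x"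
          using all\<eta>[THEN eventually_eventually[THEN iffD2]] \<rho>(2)[THEN eventually_eventually[THEN iffD2]] cl
            holo_form1_eventually[OF h\<mu>] holo_at_eventually[OF Q(1)] holo_at_eventually[OF d(1)] holo_at_eventually[OF \<rho>(1)]
            holo_form1_eventually[OF hX] hall
        proof eventually_elim
          case (elim x)
          show ?case
          proof
            assume nz: "Q x \<noteq> 0"
            have hx: "holo_form1_at th x" by (rule hth[OF elim(4,5) nz])
            note ct = holo_at_imp_cdiff[OF holo_form1_nth[OF hx]] and cd = holo_at_imp_cdiff[OF elim(6)]
              and cX = holo_at_imp_cdiff[OF holo_form1_nth[OF elim(8)]]
            have Qn: "\<forall>\<^sub>F y in nhds x. Q y \<noteq> 0" by (rule eventually_neq[OF elim(5) nz])
            have "\<forall>\<^sub>F y in nhds x. \<eta> k y = d y * th y $ k"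
              using elim(1) Qn by eventually_elim (simp add: th_def field_simps)
            then have f\<eta>: "fd (\<eta> k) x (X x) = fd d x (X x) * th x $ k + d x * fd (\<lambda>y. th y $ k) x (X x)"
              by (simp only: fd_cong fd_mult[OF cd ct])
            have \<eta>m: "\<eta> m x = d x * th x $ m" for m
              using eventually_nhds_x_imp_x[OF elim(1)] nz by (simp add: th_def field_simps)
            have "\<forall>\<^sub>F y in nhds x. \<rho> y = (\<Sum>m\<in>UNIV. X y $ m * th y $ m)"
              using elim(2) Qn
            proof eventually_elim
              case (elim y)
              have "(\<Sum>m\<in>UNIV. X y $ m * th y $ m) = \<nu> y / Q y"
                unfolding \<nu>_def pairing_def th_def sum_divide_distrib by (intro sum.cong refl) (simp add: field_simps)
              then show ?case using elim by simp
            qed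
            from pdiff_cong[OF this] have "pdiff k \<rho> x = pdiff k (\<lambda>y. \<Sum>m\<in>UNIV. X y $ m * th y $ m) x" .
            also have "\<dots> = (\<Sum>m\<in>UNIV. pdiff k (\<lambda>y. X y $ m) x * th x $ m + X x $ m * pdiff k (\<lambda>y. th y $ m) x)"
              by (subst pdiff_sum) (auto intro!: cdiff_mult cX ct simp: pdiff_mult[OF cX ct])
            finally have pr: "pdiff k \<rho> x = (\<Sum>m\<in>UNIV. pdiff k (\<lambda>y. X y $ m) x * th x $ m) + (\<Sum>m\<in>UNIV. X x $ m * pdiff k (\<lambda>y. th y $ m) x)"
              by (simp add: sum.distrib)
            have "ext_deriv th x = 0" using elim(3) nz unfolding th_def by blast
            then have "pdiff m (\<lambda>y. th y $ k) x = pdiff k (\<lambda>y. th y $ m) x" for m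
              using ext_deriv_nth[of th x m k] by simp
            then have "fd (\<lambda>y. th y $ k) x (X x) = (\<Sum>m\<in>UNIV. X x $ m * pdiff k (\<lambda>y. th y $ m) x)"
              unfolding fd_expand[OF ct] by simp
            then have "fd (\<eta> k) x (X x) - d x * pdiff k \<rho> x + (\<Sum>m\<in>UNIV. pdiff k (\<lambda>x. X x $ m) x * \<eta> m x) = fd d x (X x) * th x $ k"
              unfolding f\<eta> pr \<eta>m by (simp add: algebra_simps sum_distrib_left)
            then show "fd d x (X x) * \<mu> x $ k = (fd (\<eta> k) x (X x) - d x * pdiff k \<rho> x + (\<Sum>m\<in>UNIV. pdiff k (\<lambda>x. X x $ m) x * \<eta> m x)) * Q x"
              using nz by (simp add: th_def)
          qed
        qed
      qed (fact Q)
      then show ?thesis using d(3)[OF holo_fd_field[OF d(1) hX]] unfolding S_def by blast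
    qed
    then have "invariant_equation w1 w2 d" unfolding invariant_equation_def using d True by blast
    then show ?thesis by blast
  next
    case False
    have "\<forall>p\<in>S. germ_dvd Q (\<lambda>x. 1 * p x)" using d(3)[OF holo_at_const] germ_dvd_unit[OF d(1) False holo_at_const] by blast
    then have "\<forall>k. \<exists>\<eta>. holo_at \<eta> 0 \<and> (\<forall>\<^sub>F x in nhds 0. \<mu> x $ k = \<eta> x * Q x)" unfolding germ_dvd_def S_def by auto
    from choice[OF this] obtain \<eta>' where \<eta>': "\<And>k. holo_at (\<eta>' k) 0" "\<And>k. \<forall>\<^sub>F x in nhds 0. \<mu> x $ k = \<eta>' k x * Q x" by blast
    define \<eta> where "\<eta> x = (\<chi> k. \<eta>' k x)" for x
    have h\<eta>: "holo_form1_at \<eta> 0" unfolding holo_form1_at_def \<eta>_def using \<eta>' by simp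
    have "\<forall>\<^sub>F x in nhds 0. \<forall>k. \<mu> x $ k = \<eta>' k x * Q x" by (intro eventually_all_fin \<eta>')
    then have e\<eta>: "\<forall>\<^sub>F x in nhds 0. Q x \<noteq> 0 \<longrightarrow> \<eta> x = (1 / Q x) *s \<mu> x"
      by eventually_elim (simp add: vec_eq_iff \<eta>_def)
    from exact_of_holomorphic_twist[OF hw(1) nw h\<eta> Q e\<eta> cl tw(1)]
    obtain u F where F: "holo_at F 0" "\<not> (\<exists>c. \<forall>\<^sub>F x in nhds 0. F x = c)"
      "\<forall>\<^sub>F x in nhds 0. \<forall>k. pdiff k F x = u x * w1 x $ k" by blast
    show ?thesis
    proof (rule invariant_equationI_first_integral[OF F(1,2)])
      fix X assume "tangent_field w1 w2 X"
      then have "\<forall>\<^sub>F x in nhds 0. pairing (w1 x) (X x) = 0" unfolding tangent_field_def by (auto elim: eventually_mono)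
      with F(3) holo_at_eventually[OF F(1)] show "\<forall>\<^sub>F x in nhds 0. fd F x (X x) = 0"
      proof eventually_elim
        case (elim x)
        have "fd F x (X x) = u x * pairing (w1 x) (X x)"
          unfolding fd_expand[OF holo_at_imp_cdiff[OF elim(2)]] pairing_def sum_distrib_left
          by (intro sum.cong refl) (use elim(1) in \<open>simp add: mult_ac\<close>)
        then show ?case using elim(3) by simp
      qed
    qed
  qed
qed

lemma closed_twist_data:
  fixes \<theta> :: "complex^'n \<Rightarrow> complex^'n"
  assumes "closed_mero_form1 \<theta>"
  shows "\<exists>\<mu> q. holo_form1_at \<mu> 0 \<and> holo_at q 0 \<and> \<not> zero_germ q \<and>
    (\<forall>\<^sub>F x in nhds 0. q x \<noteq> 0 \<longrightarrow> holo_form1_at \<theta> x \<and> \<theta> x = (1 / q x) *s \<mu> x \<and> ext_deriv \<theta> x = 0)"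
proof -
  obtain \<mu> q where \<mu>: "holo_form1_at \<mu> 0" "holo_at q 0" "\<not> zero_germ q"
    "\<forall>\<^sub>F x in nhds 0. q x \<noteq> 0 \<longrightarrow> holo_form1_at \<theta> x \<and> \<theta> x = (1 / q x) *s \<mu> x"
    using mero_form1_common_denominator[of \<theta>] assms unfolding closed_mero_form1_def by blast
  have "\<forall>\<^sub>F x in nhds 0. q x \<noteq> 0 \<longrightarrow> holo_form1_at \<theta> x \<and> \<theta> x = (1 / q x) *s \<mu> x \<and> ext_deriv \<theta> x = 0"
    using \<mu>(4) assms[unfolded closed_mero_form1_def, THEN conjunct2] by eventually_elim blast
  with \<mu> show ?thesis by blast
qed

lemma pencil_generators: "\<omega>1 \<in> pencil \<omega>1 \<omega>2" "\<omega>2 \<in> pencil \<omega>1 \<omega>2"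
proof -
  have "\<omega>1 = (\<lambda>x. 1 *s \<omega>1 x + 0 *s \<omega>2 x)" "\<omega>2 = (\<lambda>x. 0 *s \<omega>1 x + 1 *s \<omega>2 x)" by auto
  then show "\<omega>1 \<in> pencil \<omega>1 \<omega>2" "\<omega>2 \<in> pencil \<omega>1 \<omega>2" unfolding pencil_def by blast+
qed

text \<open>The argument for the reduced pencil needs coefficients without common factor. If \<open>\<omega> = g w\<close>, then
  \<open>d\<omega> = \<theta> \<and> \<omega>\<close> becomes \<open>dw = (\<theta> - dg/g) \<and> w\<close>, and \<open>\<theta> - dg/g\<close> is again closed; both pencils have the same
  tangent fields.\<close>
lemma twist_hypersurface:
  fixes \<omega>1 \<omega>2 \<theta> :: "complex^'n \<Rightarrow> complex^'n"
  assumes h: "holo_form1_at \<omega>1 0" "holo_form1_at \<omega>2 0" and nz: "\<not> zero_germ \<omega>1"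
    and \<theta>: "closed_mero_form1 \<theta>" "twists_pencil \<theta> (pencil \<omega>1 \<omega>2)"
  shows "\<exists>D. invariant_equation \<omega>1 \<omega>2 D"
proof -
  obtain \<mu> q where \<mu>: "holo_form1_at \<mu> 0" and q: "holo_at q 0" "\<not> zero_germ q"
    and \<theta>q: "\<forall>\<^sub>F x in nhds 0. q x \<noteq> 0 \<longrightarrow> holo_form1_at \<theta> x \<and> \<theta> x = (1 / q x) *s \<mu> x \<and> ext_deriv \<theta> x = 0"
    using closed_twist_data[OF \<theta>(1)] by blast
  obtain g w1 w2 where g: "holo_at g 0" "\<not> zero_germ g" and w: "holo_form1_at w1 0" "holo_form1_at w2 0"
    and gw: "\<forall>\<^sub>F x in nhds 0. \<omega>1 x = g x *s w1 x \<and> \<omega>2 x = g x *s w2 x"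
    and cop: "\<And>e. holo_at e 0 \<Longrightarrow> (\<And>k. germ_dvd e (\<lambda>x. w1 x $ k)) \<Longrightarrow> (\<And>k. germ_dvd e (\<lambda>x. w2 x $ k)) \<Longrightarrow> e 0 \<noteq> 0"
    using gcd_reduction[OF h nz] by blast
  define Q where "Q x = g x * q x" for x
  \<comment> \<open>\<open>\<theta> - dg/g = \<mu>/q - dg/g = \<mu>'/(g q)\<close>\<close>
  define \<mu>' where "\<mu>' x = (\<chi> k. g x * \<mu> x $ k - q x * pdiff k g x)" for x
  have Q: "holo_at Q 0" "\<not> zero_germ Q" unfolding Q_def by (rule holo_at_mult[OF g(1) q(1)], rule zero_germ_mult[OF g(1) q(1) g(2) q(2)])
  have h\<mu>': "holo_form1_at \<mu>' 0" unfolding holo_form1_at_def \<mu>'_def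
    by (auto intro!: holo_intros g q holo_form1_nth[OF \<mu>] holo_at_pdiff)
  have nw: "\<not> zero_germ w1"
  proof
    assume "zero_germ w1"
    then have "zero_germ \<omega>1" using gw unfolding zero_germ_def by eventually_elim simp
    with nz show False by blast
  qed
  have twist: "\<forall>\<^sub>F x in nhds 0. holo_form1_at \<theta> x \<longrightarrow> ext_deriv \<omega>1 x = wedge11 (\<theta> x) (\<omega>1 x)"
    "\<forall>\<^sub>F x in nhds 0. holo_form1_at \<theta> x \<longrightarrow> ext_deriv \<omega>2 x = wedge11 (\<theta> x) (\<omega>2 x)"
    using \<theta>(2) pencil_generators unfolding twists_pencil_def by blast+
  have red: "\<forall>\<^sub>F x in nhds 0. Q x \<noteq> 0 \<longrightarrow> (\<forall>\<^sub>F y in nhds x. \<forall>k. ((1 / Q y) *s \<mu>' y) $ k = \<theta> y $ k - pdiff k g y / g y)"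
    using \<theta>q[THEN eventually_eventually[THEN iffD2]] holo_at_eventually[OF Q(1)]
  proof eventually_elim
    case (elim x)
    show ?case
    proof
      assume "Q x \<noteq> 0"
      with elim(1) eventually_neq[OF elim(2)] have "\<forall>\<^sub>F y in nhds x. (q y \<noteq> 0 \<longrightarrow> holo_form1_at \<theta> y \<and> \<theta> y = (1 / q y) *s \<mu> y \<and> ext_deriv \<theta> y = 0) \<and> Q y \<noteq> 0"
        by (intro eventually_conj) auto
      then show "\<forall>\<^sub>F y in nhds x. \<forall>k. ((1 / Q y) *s \<mu>' y) $ k = \<theta> y $ k - pdiff k g y / g y"
        by eventually_elim (auto simp: Q_def \<mu>'_def field_simps)
    qed
  qed
  have "\<exists>D. invariant_equation w1 w2 D"
  proof (rule reduced_twist_hypersurface[OF w nw _ h\<mu>' Q])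
    show "e 0 \<noteq> 0" if "holo_at e 0" "\<And>k. germ_dvd e (\<lambda>x. w1 x $ k)" "\<And>k. germ_dvd e (\<lambda>x. w2 x $ k)" for e
      using cop[OF that] .
    show "\<forall>\<^sub>F x in nhds 0. Q x \<noteq> 0 \<longrightarrow> ext_deriv (\<lambda>x. (1 / Q x) *s \<mu>' x) x = 0"
      using red \<theta>q holo_at_eventually[OF g(1)]
    proof eventually_elim
      case (elim x)
      show ?case
      proof
        assume nQ: "Q x \<noteq> 0"
        then have n: "g x \<noteq> 0" "q x \<noteq> 0" by (auto simp: Q_def)
        have ht: "holo_form1_at \<theta> x" and e0: "ext_deriv \<theta> x = 0" using elim(2) n by auto
        note ct = holo_at_imp_cdiff[OF holo_form1_nth[OF ht]] and cg = holo_at_imp_cdiff[OF elim(3)]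
          and cpg = holo_at_imp_cdiff[OF holo_at_pdiff[OF elim(3)]]
        have p: "pdiff m (\<lambda>y. ((1 / Q y) *s \<mu>' y) $ k) x = pdiff m (\<lambda>y. \<theta> y $ k) x -
            (pdiff m (\<lambda>y. pdiff k g y) x * g x - pdiff k g x * pdiff m g x) / (g x)\<^sup>2" for m k
        proof -
          have "\<forall>\<^sub>F y in nhds x. ((1 / Q y) *s \<mu>' y) $ k = \<theta> y $ k - pdiff k g y / g y"
            using elim(1) nQ by (auto elim: eventually_mono)
          from pdiff_cong[OF this] show ?thesis
            by (simp only: pdiff_diff[OF ct cdiff_divide[OF cpg cg n(1)]] pdiff_divide[OF cpg cg n(1)])
        qed
        have "ext_deriv (\<lambda>x. (1 / Q x) *s \<mu>' x) x $ m $ k = 0" for m k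
          using ext_deriv_nth[of \<theta> x m k] pdiff_commute[OF elim(3), of m k]
          unfolding ext_deriv_nth p e0 by (simp add: mult.commute)
        then show "ext_deriv (\<lambda>x. (1 / Q x) *s \<mu>' x) x = 0" by (simp add: vec_eq_iff)
      qed
    qed
    have tw: "\<forall>\<^sub>F x in nhds 0. Q x \<noteq> 0 \<longrightarrow> ext_deriv w x = wedge11 ((1 / Q x) *s \<mu>' x) (w x)"
      if hw: "holo_form1_at w 0" and \<omega>w: "\<forall>\<^sub>F x in nhds 0. \<omega> x = g x *s w x"
        and t: "\<forall>\<^sub>F x in nhds 0. holo_form1_at \<theta> x \<longrightarrow> ext_deriv \<omega> x = wedge11 (\<theta> x) (\<omega> x)" for w \<omega>
      using red \<theta>q holo_at_eventually[OF g(1)] holo_form1_eventually[OF hw] t \<omega>w[THEN eventually_eventually[THEN iffD2]]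
    proof eventually_elim
      case (elim x)
      show ?case
      proof
        assume nQ: "Q x \<noteq> 0"
        then have n: "g x \<noteq> 0" "q x \<noteq> 0" by (auto simp: Q_def)
        have ht: "holo_form1_at \<theta> x" using elim(2) n by auto
        note cg = holo_at_imp_cdiff[OF elim(3)] and cw = holo_at_imp_cdiff[OF holo_form1_nth[OF elim(4)]]
        have p: "pdiff k (\<lambda>y. \<omega> y $ l) x = pdiff k g x * w x $ l + g x * pdiff k (\<lambda>y. w y $ l) x" for k l
        proof -
          have "\<forall>\<^sub>F y in nhds x. \<omega> y $ l = g y * w y $ l" using elim(6) by eventually_elim simp
          from pdiff_cong[OF this] show ?thesis by (simp only: pdiff_mult[OF cg cw])
        qed
        have r: "((1 / Q x) *s \<mu>' x) $ k = \<theta> x $ k - pdiff k g x / g x" for k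
          using eventually_nhds_x_imp_x[of _ x] elim(1) nQ by blast
        have \<omega>x: "\<omega> x = g x *s w x" using eventually_nhds_x_imp_x[OF elim(6)] .
        have "ext_deriv w x $ k $ l = wedge11 ((1 / Q x) *s \<mu>' x) (w x) $ k $ l" for k l
        proof -
          have "ext_deriv \<omega> x $ k $ l = \<theta> x $ k * (g x * w x $ l) - \<theta> x $ l * (g x * w x $ k)"
            using elim(5) ht by (simp add: wedge11_nth \<omega>x)
          then have "g x * ext_deriv w x $ k $ l = g x * ((\<theta> x $ k - pdiff k g x / g x) * w x $ l - (\<theta> x $ l - pdiff l g x / g x) * w x $ k)"
          proof -
            have "g x * ((\<theta> x $ k - pdiff k g x / g x) * w x $ l - (\<theta> x $ l - pdiff l g x / g x) * w x $ k)
                = (g x * \<theta> x $ k - pdiff k g x) * w x $ l - (g x * \<theta> x $ l - pdiff l g x) * w x $ k"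
              using n by (simp add: right_diff_distrib left_diff_distrib)
            then show ?thesis
              using \<open>ext_deriv \<omega> x $ k $ l = \<theta> x $ k * (g x * w x $ l) - \<theta> x $ l * (g x * w x $ k)\<close>
              unfolding ext_deriv_nth p by algebra
          qed
          then show ?thesis unfolding wedge11_nth r using n by simp
        qed
        then show "ext_deriv w x = wedge11 ((1 / Q x) *s \<mu>' x) (w x)" by (simp add: vec_eq_iff)
      qed
    qed
    show "\<forall>\<^sub>F x in nhds 0. Q x \<noteq> 0 \<longrightarrow> ext_deriv w1 x = wedge11 ((1 / Q x) *s \<mu>' x) (w1 x)"
      by (rule tw[OF w(1) _ twist(1)]) (use gw in \<open>auto elim: eventually_mono\<close>)
    show "\<forall>\<^sub>F x in nhds 0. Q x \<noteq> 0 \<longrightarrow> ext_deriv w2 x = wedge11 ((1 / Q x) *s \<mu>' x) (w2 x)"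
      by (rule tw[OF w(2) _ twist(2)]) (use gw in \<open>auto elim: eventually_mono\<close>)
  qed
  then obtain D where D: "invariant_equation w1 w2 D" by blast
  have "tangent_field w1 w2 X" if X: "tangent_field \<omega>1 \<omega>2 X" for X
  proof -
    have hX: "holo_form1_at X 0" and tX: "\<forall>\<^sub>F x in nhds 0. pairing (\<omega>1 x) (X x) = 0 \<and> pairing (\<omega>2 x) (X x) = 0"
      using X by (auto simp: tangent_field_def)
    have gc: "pairing (c *s a) v = c * pairing a v" for c a and v :: "complex^'n"
      unfolding pairing_def by (simp add: sum_distrib_left mult.assoc)
    have ev: "\<forall>\<^sub>F x in nhds 0. g x \<noteq> 0 \<longrightarrow> pairing (w1 x) (X x) = 0 \<and> pairing (w2 x) (X x) = 0"
      using tX gw by eventually_elim (auto simp: gc)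
    have "\<forall>\<^sub>F x in nhds 0. pairing (w1 x) (X x) = 0" "\<forall>\<^sub>F x in nhds 0. pairing (w2 x) (X x) = 0"
      by (rule holo_eq_dense[OF g holo_pairing[OF _ hX] holo_at_const], rule w, use ev in \<open>auto elim: eventually_mono\<close>)+
    then show ?thesis unfolding tangent_field_def using hX by (auto intro: eventually_conj)
  qed
  then have "invariant_equation \<omega>1 \<omega>2 D" using D unfolding invariant_equation_def by blast
  then show ?thesis by blast
qed

section \<open>The axis foliation\<close>

text \<open>The axis 2-form \<open>\<Omega>\<close> is \<open>\<omega>1 \<and> \<omega>2\<close> divided by some germ. Off the zeros of that germ \<open>\<Omega>\<close> is decomposable and
  its fields are visibly tangent; the identities extend by density.\<close>
lemma axis_fields:
  fixes \<omega>1 \<omega>2 :: "complex^'n \<Rightarrow> complex^'n"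
  assumes h: "holo_form1_at \<omega>1 0" "holo_form1_at \<omega>2 0" and nw: "\<not> zero_germ (\<lambda>x. wedge11 (\<omega>1 x) (\<omega>2 x))"
    and ax: "axis_foliation \<omega>1 \<omega>2 \<Omega>"
  shows "holo_form2_at \<Omega> 0" "\<forall>\<^sub>F x in nhds 0. \<forall>i j. \<Omega> x $ i $ j = - \<Omega> x $ j $ i"
    "tangent_field \<omega>1 \<omega>2 (\<lambda>x. axis_field (\<Omega> x) i j k)"
proof -
  obtain c where \<Omega>: "holo_form2_at \<Omega> 0" and c: "holo_at c 0"
    "\<forall>\<^sub>F x in nhds 0. wedge11 (\<omega>1 x) (\<omega>2 x) = (\<chi> i j. c x * \<Omega> x $ i $ j)"
    using ax unfolding axis_foliation_def by blast
  show "holo_form2_at \<Omega> 0" by (rule \<Omega>)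
  have h\<Omega>: "holo_at (\<lambda>x. \<Omega> x $ i $ j) 0" for i j using \<Omega> unfolding holo_form2_at_def by blast
  have cw: "\<forall>\<^sub>F x in nhds 0. \<forall>i j. c x * \<Omega> x $ i $ j = \<omega>1 x $ i * \<omega>2 x $ j - \<omega>1 x $ j * \<omega>2 x $ i"
    using c(2) by eventually_elim (simp add: vec_eq_iff wedge11_nth)
  have nc: "\<not> zero_germ c"
  proof
    assume "zero_germ c"
    then have "zero_germ (\<lambda>x. wedge11 (\<omega>1 x) (\<omega>2 x))" using c(2) unfolding zero_germ_def
      by eventually_elim (simp add: vec_eq_iff)
    with nw show False by blast
  qed
  show "\<forall>\<^sub>F x in nhds 0. \<forall>i j. \<Omega> x $ i $ j = - \<Omega> x $ j $ i"
  proof (intro eventually_all_fin)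
    fix i j
    show "\<forall>\<^sub>F x in nhds 0. \<Omega> x $ i $ j = - \<Omega> x $ j $ i"
    proof (rule holo_eq_dense[OF c(1) nc h\<Omega> holo_at_uminus[OF h\<Omega>]])
      show "\<forall>\<^sub>F x in nhds 0. c x \<noteq> 0 \<longrightarrow> \<Omega> x $ i $ j = - \<Omega> x $ j $ i"
        using cw
      proof eventually_elim
        case (elim x)
        have "c x * \<Omega> x $ i $ j = c x * (- \<Omega> x $ j $ i)" using elim by simp
        then show ?case by (metis mult_cancel_left)
      qed
    qed
  qed
  have hX: "holo_form1_at (\<lambda>x. axis_field (\<Omega> x) i j k) 0"
    unfolding holo_form1_at_def axis_field_def by (auto intro!: holo_intros h\<Omega>)
  have z: "\<forall>\<^sub>F x in nhds 0. c x \<noteq> 0 \<longrightarrow> pairing (\<omega>1 x) (axis_field (\<Omega> x) i j k) = 0 \<and> pairing (\<omega>2 x) (axis_field (\<Omega> x) i j k) = 0"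
    using cw
  proof eventually_elim
    case (elim x)
    have "c x * pairing (\<omega>1 x) (axis_field (\<Omega> x) i j k) = 0" "c x * pairing (\<omega>2 x) (axis_field (\<Omega> x) i j k) = 0"
      unfolding pairing_axis_field using elim[rule_format, of j k] elim[rule_format, of i k] elim[rule_format, of i j] by algebra+
    then show ?case by auto
  qed
  have "\<forall>\<^sub>F x in nhds 0. pairing (\<omega>1 x) (axis_field (\<Omega> x) i j k) = 0" "\<forall>\<^sub>F x in nhds 0. pairing (\<omega>2 x) (axis_field (\<Omega> x) i j k) = 0"
    by (rule holo_eq_dense[OF c(1) nc holo_pairing[OF _ hX] holo_at_const], rule h, use z in \<open>auto elim: eventually_mono\<close>)+
  then show "tangent_field \<omega>1 \<omega>2 (\<lambda>x. axis_field (\<Omega> x) i j k)"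
    unfolding tangent_field_def using hX by (auto intro: eventually_conj)
qed

lemma norm_square_nonzero:
  fixes \<Omega> :: "complex^'n^'n"
  assumes "\<Omega> \<noteq> 0"
  shows "(\<Sum>i\<in>UNIV. \<Sum>j\<in>UNIV. cnj (\<Omega> $ i $ j) * \<Omega> $ i $ j) \<noteq> 0"
proof
  assume "(\<Sum>i\<in>UNIV. \<Sum>j\<in>UNIV. cnj (\<Omega> $ i $ j) * \<Omega> $ i $ j) = 0"
  moreover have "cnj z * z = complex_of_real ((cmod z)\<^sup>2)" for z by (metis complex_norm_square mult.commute)
  ultimately have "complex_of_real (\<Sum>i\<in>UNIV. \<Sum>j\<in>UNIV. (cmod (\<Omega> $ i $ j))\<^sup>2) = 0" by simp
  then have "(\<Sum>i\<in>UNIV. \<Sum>j\<in>UNIV. (cmod (\<Omega> $ i $ j))\<^sup>2) = 0" using of_real_eq_0_iff by blast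
  then have "\<forall>i j. \<Omega> $ i $ j = 0" by (simp add: sum_nonneg_eq_0_iff sum_nonneg)
  then show False using assms by (simp add: vec_eq_iff)
qed

lemma fd_kernel_span:
  fixes \<Omega> :: "complex^'n^'n"
  assumes "cdiff f x" "\<And>i j. \<Omega> $ i $ j = - \<Omega> $ j $ i" "v \<in> ker2 \<Omega>"
  shows "(\<Sum>i\<in>UNIV. \<Sum>j\<in>UNIV. cnj (\<Omega> $ i $ j) * \<Omega> $ i $ j) * fd f x v =
     (\<Sum>i\<in>UNIV. \<Sum>j\<in>UNIV. \<Sum>k\<in>UNIV. (cnj (\<Omega> $ i $ j) * v $ k) * fd f x (axis_field \<Omega> i j k))"
  using arg_cong[OF kernel_span[OF assms(2,3)], of "fd f x"]
  by (simp only: fd_linear[OF assms(1)])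

lemma meromorphic_axis_integral_tangent:
  fixes \<omega>1 \<omega>2 :: "complex^'n \<Rightarrow> complex^'n"
  assumes h: "holo_form1_at \<omega>1 0" "holo_form1_at \<omega>2 0" and nw: "\<not> zero_germ (\<lambda>x. wedge11 (\<omega>1 x) (\<omega>2 x))"
    and f: "meromorphic_axis_integral \<omega>1 \<omega>2 f" and ax: "axis_foliation \<omega>1 \<omega>2 \<Omega>"
  shows "tangent_to_levels ker2 \<Omega> f"
proof -
  note af = axis_fields[OF h nw ax]
  obtain q where q: "holo_at q 0" "\<not> zero_germ q"
    "\<forall>\<^sub>F x in nhds 0. q x \<noteq> 0 \<longrightarrow> holo_at f x \<and> (\<forall>v. pairing (\<omega>1 x) v = 0 \<longrightarrow> pairing (\<omega>2 x) v = 0 \<longrightarrow> fd f x v = 0)"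
    using f unfolding meromorphic_axis_integral_def by blast
  have tf: "\<forall>\<^sub>F x in nhds 0. \<forall>i j k. pairing (\<omega>1 x) (axis_field (\<Omega> x) i j k) = 0 \<and> pairing (\<omega>2 x) (axis_field (\<Omega> x) i j k) = 0"
    by (intro eventually_all_fin) (use af(3) in \<open>simp add: tangent_field_def\<close>)
  have z: "\<forall>\<^sub>F x in nhds 0. q x \<noteq> 0 \<longrightarrow> (\<forall>i j k. fd f x (axis_field (\<Omega> x) i j k) = 0)"
    using q(3) tf by eventually_elim blast
  have h2: "\<forall>\<^sub>F x in nhds 0. \<forall>i j k. holo_form1_at (\<lambda>x. axis_field (\<Omega> x) i j k) x"
    by (intro eventually_all_fin holo_form1_eventually) (use af(3) in \<open>simp add: tangent_field_def\<close>)
  show ?thesis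
    unfolding tangent_to_levels_def using nonzero_dense_on[OF q(1,2) z] h2 af(2)
  proof eventually_elim
    case (elim x)
    show ?case
    proof (intro impI ballI)
      fix v assume a: "holo_at f x \<and> x \<notin> sing \<Omega>" and v: "v \<in> ker2 (\<Omega> x)"
      have z: "fd f x (axis_field (\<Omega> x) i j k) = 0" for i j k
      proof (rule dense_eq[where F = "\<lambda>x. fd f x (axis_field (\<Omega> x) i j k)" and G = "\<lambda>_. 0"])
        show "isCont (\<lambda>x. fd f x (axis_field (\<Omega> x) i j k)) x"
          using a elim(2) by (intro holo_at_isCont holo_fd_field) auto
        show "\<exists>\<^sub>F y in nhds x. fd f y (axis_field (\<Omega> y) i j k) = 0" using elim(1) by (rule frequently_elim1) blast
      qed simp
      have "cdiff f x" using a by (blast intro: holo_at_imp_cdiff)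
      from fd_kernel_span[OF this elim(3)[rule_format] v]
      have "(\<Sum>i\<in>UNIV. \<Sum>j\<in>UNIV. cnj (\<Omega> x $ i $ j) * \<Omega> x $ i $ j) * fd f x v = 0"
        by (simp only: z mult_zero_right sum.neutral_const)
      moreover have "\<Omega> x \<noteq> 0" using a by (simp add: sing_def)
      ultimately show "fd f x v = 0" using norm_square_nonzero[of "\<Omega> x"] by simp
    qed
  qed
qed

text \<open>On a leaf the velocity \<open>\<gamma>'\<close> is a combination of the fields of \<open>\<Omega>\<close> with continuous coefficients
  (\<open>kernel_span\<close>), and each field multiplies \<open>D\<close> by a germ. So \<open>D \<circ> \<gamma>\<close> solves a homogeneous linear equation.\<close>
lemma invariant_equation_germ:
  fixes \<omega>1 \<omega>2 :: "complex^'n \<Rightarrow> complex^'n"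
  assumes h: "holo_form1_at \<omega>1 0" "holo_form1_at \<omega>2 0" and nw: "\<not> zero_germ (\<lambda>x. wedge11 (\<omega>1 x) (\<omega>2 x))"
    and D: "invariant_equation \<omega>1 \<omega>2 D" and ax: "axis_foliation \<omega>1 \<omega>2 \<Omega>"
  shows "invariant_germ ker2 \<Omega> {x. D x = 0}"
proof -
  note af = axis_fields[OF h nw ax]
  have hD: "holo_at D 0" using D by (simp add: invariant_equation_def)
  have dvd: "germ_dvd D (\<lambda>x. fd D x (axis_field (\<Omega> x) i j k))" for i j k
    using D af(3)[of i j k] unfolding invariant_equation_def by blast
  have "\<forall>ijk. \<exists>c. holo_at c 0 \<and> (\<forall>\<^sub>F x in nhds 0. fd D x (axis_field (\<Omega> x) (fst ijk) (fst (snd ijk)) (snd (snd ijk))) = c x * D x)"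
    using dvd unfolding germ_dvd_def by (intro allI)
  from choice[OF this] obtain c' where c': "\<forall>ijk. holo_at (c' ijk) 0 \<and>
    (\<forall>\<^sub>F x in nhds 0. fd D x (axis_field (\<Omega> x) (fst ijk) (fst (snd ijk)) (snd (snd ijk))) = c' ijk x * D x)"
    by blast
  define C where "C i j k = c' (i, j, k)" for i j k
  have C: "holo_at (C i j k) 0" "\<forall>\<^sub>F x in nhds 0. fd D x (axis_field (\<Omega> x) i j k) = C i j k x * D x" for i j k
    unfolding C_def using spec[OF c', of "(i, j, k)"] by simp_all
  have "\<forall>\<^sub>F x in nhds 0. cdiff D x \<and> (\<forall>i j. \<Omega> x $ i $ j = - \<Omega> x $ j $ i) \<and> (\<forall>i j. isCont (\<lambda>x. \<Omega> x $ i $ j) x) \<and>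
     (\<forall>i j k. isCont (C i j k) x) \<and> (\<forall>i j k. fd D x (axis_field (\<Omega> x) i j k) = C i j k x * D x)"
  proof (intro eventually_conj af(2))
    show "\<forall>\<^sub>F x in nhds 0. cdiff D x" using hD by (simp add: holo_at_def)
    show "\<forall>\<^sub>F x in nhds 0. \<forall>i j. isCont (\<lambda>x. \<Omega> x $ i $ j) x"
    proof (intro eventually_all_fin)
      fix i j
      have "holo_at (\<lambda>x. \<Omega> x $ i $ j) 0" using af(1) unfolding holo_form2_at_def by blast
      from holo_at_eventually[OF this] show "\<forall>\<^sub>F x in nhds 0. isCont (\<lambda>x. \<Omega> x $ i $ j) x"
        by eventually_elim (rule holo_at_isCont)
    qed
    show "\<forall>\<^sub>F x in nhds 0. \<forall>i j k. isCont (C i j k) x"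
    proof (intro eventually_all_fin)
      fix i j k
      from holo_at_eventually[OF C(1)[of i j k]] show "\<forall>\<^sub>F x in nhds 0. isCont (C i j k) x"
        by eventually_elim (rule holo_at_isCont)
    qed
    show "\<forall>\<^sub>F x in nhds 0. \<forall>i j k. fd D x (axis_field (\<Omega> x) i j k) = C i j k x * D x"
      by (intro eventually_all_fin C)
  qed
  from open_of_eventually[OF this] obtain U where U: "open U" "0 \<in> U" and
    UU: "\<forall>x\<in>U. cdiff D x \<and> (\<forall>i j. \<Omega> x $ i $ j = - \<Omega> x $ j $ i) \<and> (\<forall>i j. isCont (\<lambda>x. \<Omega> x $ i $ j) x) \<and>
     (\<forall>i j k. isCont (C i j k) x) \<and> (\<forall>i j k. fd D x (axis_field (\<Omega> x) i j k) = C i j k x * D x)" by (elim exE conjE)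
  have UD: "cdiff D x" and Ua: "\<Omega> x $ i $ j = - \<Omega> x $ j $ i" and U\<Omega>: "isCont (\<lambda>x. \<Omega> x $ i $ j) x"
    and UC: "isCont (C i j k) x" and Ue: "fd D x (axis_field (\<Omega> x) i j k) = C i j k x * D x" if "x \<in> U" for x i j k
    using UU[rule_format, OF that] by blast+
  have "y \<in> {x. D x = 0}" if p: "D p = 0" and leaf: "y \<in> leaf ker2 \<Omega> U p" for p y
  proof -
    obtain \<gamma> \<gamma>' where g: "\<gamma> 0 = p" "\<gamma> 1 = y" "continuous_on {0..1::real} \<gamma>'"
      "\<And>t. t \<in> {0..1} \<Longrightarrow> (\<gamma> has_vector_derivative \<gamma>' t) (at t within {0..1}) \<and> \<gamma> t \<in> U - sing \<Omega> \<and> \<gamma>' t \<in> ker2 (\<Omega> (\<gamma> t))"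
      using leaf unfolding leaf_def by blast
    \<comment> \<open>By \<open>kernel_span\<close>, \<open>n \<gamma>'\<close> is a combination of the fields, and \<open>D\<close> has derivative \<open>s D\<close> in this direction; the
      equation for \<open>D \<circ> \<gamma>\<close> has coefficient \<open>s/n\<close>.\<close>
    define n where "n t = (\<Sum>i\<in>UNIV. \<Sum>j\<in>UNIV. cnj (\<Omega> (\<gamma> t) $ i $ j) * \<Omega> (\<gamma> t) $ i $ j)" for t
    define s where "s t = (\<Sum>i\<in>UNIV. \<Sum>j\<in>UNIV. \<Sum>k\<in>UNIV. (cnj (\<Omega> (\<gamma> t) $ i $ j) * \<gamma>' t $ k) * C i j k (\<gamma> t))" for t
    have n0: "n t \<noteq> 0" if "t \<in> {0..1}" for t
      unfolding n_def using g(4)[OF that] by (intro norm_square_nonzero) (simp add: sing_def)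
    have contg: "continuous_on {0..1} \<gamma>"
      by (rule continuous_on_vector_derivative[where f' = \<gamma>']) (use g(4) in blast)
    have c1: "continuous_on {0..1} (\<lambda>t. \<Omega> (\<gamma> t) $ i $ j)" for i j
    proof (rule continuous_on_compose2[of U "\<lambda>x. \<Omega> x $ i $ j"])
      show "continuous_on U (\<lambda>x. \<Omega> x $ i $ j)" using U\<Omega> by (intro continuous_at_imp_continuous_on) blast
    qed (use contg g(4) in auto)
    have c2: "continuous_on {0..1} (\<lambda>t. C i j k (\<gamma> t))" for i j k
    proof (rule continuous_on_compose2[of U "C i j k"])
      show "continuous_on U (C i j k)" using UC by (intro continuous_at_imp_continuous_on) blast
    qed (use contg g(4) in auto)
    have "continuous_on {0..1} (\<lambda>t. s t / n t)"
      unfolding s_def n_def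
      by (intro continuous_on_divide continuous_on_sum continuous_on_mult continuous_on_cnj c1 c2 continuous_on_component g(3) ballI n0[unfolded n_def])
    moreover have "((\<lambda>t. D (\<gamma> t)) has_vector_derivative (s t / n t) * D (\<gamma> t)) (at t within {0..1})" if t: "t \<in> {0..1}" for t
    proof -
      have x: "\<gamma> t \<in> U" "\<gamma>' t \<in> ker2 (\<Omega> (\<gamma> t))" using g(4)[OF t] by auto
      have "n t * fd D (\<gamma> t) (\<gamma>' t) = s t * D (\<gamma> t)"
        unfolding n_def s_def fd_kernel_span[OF UD[OF x(1)] Ua[OF x(1)] x(2)] Ue[OF x(1)]
        by (simp add: sum_distrib_right mult.assoc)
      then have "fd D (\<gamma> t) (\<gamma>' t) = s t / n t * D (\<gamma> t)" using n0[OF t] by (simp add: field_simps)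
      then show ?thesis
        using path_chain[where f = D and \<gamma> = \<gamma> and t = t and \<gamma>' = "\<gamma>' t" and A = "{0..1}"] UD[OF x(1)] g(4)[OF t] by simp
    qed
    ultimately have "D (\<gamma> 1) = 0"
      using linear_ode_zero[of "\<lambda>t. D (\<gamma> t)" "\<lambda>t. s t / n t"] g(1) p by auto
    then show ?thesis using g(2) by simp
  qed
  then show ?thesis unfolding invariant_germ_def using U(1,2) by blast
qed

lemma holomorphic_twist_first_integral:
  fixes \<omega>1 \<omega>2 \<theta> :: "complex^'n \<Rightarrow> complex^'n"
  assumes h: "holo_form1_at \<omega>1 0" "holo_form1_at \<omega>2 0"
    and \<theta>: "closed_mero_form1 \<theta>" "twists_pencil \<theta> (pencil \<omega>1 \<omega>2)" "mero_form1_is_holo \<theta>"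
    and fol: "foliation_in_pencil (pencil \<omega>1 \<omega>2) \<eta>"
  shows "\<exists>f. holo_first_integral ker1 \<eta> f"
proof -
  obtain \<mu> q where q: "holo_at q 0" "\<not> zero_germ q"
    and \<theta>q: "\<forall>\<^sub>F x in nhds 0. q x \<noteq> 0 \<longrightarrow> holo_form1_at \<theta> x \<and> \<theta> x = (1 / q x) *s \<mu> x \<and> ext_deriv \<theta> x = 0"
    using closed_twist_data[OF \<theta>(1)] by blast
  obtain \<xi> where \<xi>: "holo_form1_at \<xi> 0" "\<forall>\<^sub>F x in nhds 0. holo_form1_at \<theta> x \<longrightarrow> \<theta> x = \<xi> x"
    using \<theta>(3) unfolding mero_form1_is_holo_def by blast
  obtain \<omega> c where \<omega>: "\<omega> \<in> pencil \<omega>1 \<omega>2" "\<not> zero_germ \<omega>" "\<forall>\<^sub>F x in nhds 0. \<omega> x = c x *s \<eta> x"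
    using fol unfolding foliation_in_pencil_def by blast
  have h\<omega>: "holo_form1_at \<omega> 0"
    using \<omega>(1) h unfolding pencil_def holo_form1_at_def by (auto intro!: holo_intros)
  have ev: "\<forall>\<^sub>F x in nhds 0. q x \<noteq> 0 \<longrightarrow> \<theta> x = \<xi> x" using \<theta>q \<xi>(2) by eventually_elim blast
  have cl: "\<forall>\<^sub>F x in nhds 0. q x \<noteq> 0 \<longrightarrow> ext_deriv \<theta> x = 0" using \<theta>q by eventually_elim blast
  have "\<forall>\<^sub>F x in nhds 0. holo_form1_at \<theta> x \<longrightarrow> ext_deriv \<omega> x = wedge11 (\<theta> x) (\<omega> x)"
    using \<theta>(2) \<omega>(1) unfolding twists_pencil_def by blast
  with \<theta>q have tw: "\<forall>\<^sub>F x in nhds 0. q x \<noteq> 0 \<longrightarrow> ext_deriv \<omega> x = wedge11 (\<theta> x) (\<omega> x)"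
    by eventually_elim blast
  have "\<forall>\<^sub>F x in nhds 0. q x \<noteq> 0 \<longrightarrow> \<xi> x = \<theta> x" using ev by eventually_elim simp
  from exact_of_holomorphic_twist[OF h\<omega> \<omega>(2) \<xi>(1) q this cl tw]
  obtain u F where F: "holo_at F 0" "\<not> (\<exists>c. \<forall>\<^sub>F x in nhds 0. F x = c)"
    "\<forall>\<^sub>F x in nhds 0. \<forall>k. pdiff k F x = u x * \<omega> x $ k" by blast
  have "holo_first_integral ker1 \<eta> F"
  proof (rule first_integral_of_differential[OF F(1,2)])
    show "\<forall>\<^sub>F x in nhds 0. \<forall>v\<in>ker1 (\<eta> x). fd F x v = 0"
      using F(3) \<omega>(3) holo_at_eventually[OF F(1)]
    proof eventually_elim
      case (elim x)
      show ?case
      proof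
        fix v assume v: "v \<in> ker1 (\<eta> x)"
        have "fd F x v = u x * c x * (\<Sum>k\<in>UNIV. \<eta> x $ k * v $ k)"
          unfolding fd_expand[OF holo_at_imp_cdiff[OF elim(3)]] sum_distrib_left
          by (intro sum.cong refl) (use elim(1,2) in \<open>simp add: mult_ac\<close>)
        then show "fd F x v = 0" using v by (simp add: ker1_def)
      qed
    qed
  qed
  then show ?thesis by blast
qed

theorem theorem4p5:
  fixes \<omega>1 \<omega>2 :: "complex^'n \<Rightarrow> complex^'n"
  assumes "CARD('n) \<ge> 3"
    and "integrable_pencil \<omega>1 \<omega>2"
  shows "((\<exists>\<theta>. closed_mero_form1 \<theta> \<and> twists_pencil \<theta> (pencil \<omega>1 \<omega>2))
          \<or> (\<exists>f. nonconstant_mero_germ f \<and>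
               (\<forall>\<Omega>. axis_foliation \<omega>1 \<omega>2 \<Omega> \<longrightarrow> tangent_to_levels ker2 \<Omega> f)))
       \<and> (\<forall>\<theta>. closed_mero_form1 \<theta> \<and> twists_pencil \<theta> (pencil \<omega>1 \<omega>2) \<and> mero_form1_is_holo \<theta> \<longrightarrow>
            (\<forall>\<eta>. foliation_in_pencil (pencil \<omega>1 \<omega>2) \<eta> \<longrightarrow> (\<exists>f. holo_first_integral ker1 \<eta> f)))
       \<and> (\<exists>H. hypersurface_germ H \<and>
            (\<forall>\<Omega>. axis_foliation \<omega>1 \<omega>2 \<Omega> \<longrightarrow> invariant_germ ker2 \<Omega> H))"
proof -
  have h: "holo_form1_at \<omega>1 0" "holo_form1_at \<omega>2 0" and nw: "\<not> zero_germ (\<lambda>x. wedge11 (\<omega>1 x) (\<omega>2 x))"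
    using assms(2) unfolding integrable_pencil_def by blast+
  have n1: "\<not> zero_germ \<omega>1"
  proof
    assume "zero_germ \<omega>1"
    then have "zero_germ (\<lambda>x. wedge11 (\<omega>1 x) (\<omega>2 x))"
      unfolding zero_germ_def by eventually_elim (simp add: vec_eq_iff wedge11_nth)
    with nw show False by blast
  qed
  note dich = pencil_dichotomy[OF assms(2)]
  have 1: "(\<exists>\<theta>. closed_mero_form1 \<theta> \<and> twists_pencil \<theta> (pencil \<omega>1 \<omega>2))
          \<or> (\<exists>f. nonconstant_mero_germ f \<and> (\<forall>\<Omega>. axis_foliation \<omega>1 \<omega>2 \<Omega> \<longrightarrow> tangent_to_levels ker2 \<Omega> f))"
    using dich meromorphic_axis_integral_tangent[OF h nw] unfolding meromorphic_axis_integral_def by blast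
  have "\<exists>D. invariant_equation \<omega>1 \<omega>2 D"
    using dich twist_hypersurface[OF h n1] polar_or_level_hypersurface by blast
  then obtain D where D: "invariant_equation \<omega>1 \<omega>2 D" by blast
  have "hypersurface_germ {x. D x = 0}"
    using D unfolding invariant_equation_def hypersurface_germ_def germ_set_eq_def by (intro exI[of _ D]) auto
  then have 3: "\<exists>H. hypersurface_germ H \<and> (\<forall>\<Omega>. axis_foliation \<omega>1 \<omega>2 \<Omega> \<longrightarrow> invariant_germ ker2 \<Omega> H)"
    using invariant_equation_germ[OF h nw D] by blast
  show ?thesis using 1 holomorphic_twist_first_integral[OF h] 3 by blast
qed

end
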